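(* Let $\alpha\in(0,1)$ and $\alpha^{-1}<p<\infty$. Then $\mathcal{H}_{\alpha,p}\subseteq H^\alpha_p([0,1])$ and the inclusion is a continuous embedding $\mathcal{H}_{\alpha,p}\hookrightarrow H^\alpha_p([0,1])$.
   Context: $\mathcal{H}_{\alpha,p}$ is the space of functions $f:[0,1]\to\mathbb{R}$ of the form $f(x)=c+\frac{1}{\Gamma(\alpha)}\int_0^1\tilde f(t)(x-t)_+^{\alpha-1}dt$ with $c\in\mathbb{R}$ and $\tilde f\in L_p([0,1])$, where $(x-t)_+^{\alpha-1}=(x-t)^{\alpha-1}$ for $x>t$ and $0$ otherwise; $c=f(0)$ and $\tilde f$ are uniquely determined, and it is normed by $(|f(0)|^q+\Gamma(\alpha)^{-q}\|\tilde f\|_{L_p}^q)^{1/q}$ for any fixed $q\in[1,\infty]$ (all equivalent). Bessel potential space: $H^\alpha_p(\mathbb{R})$ is the space of tempered distributions $g$ with $\|g\|_{H^\alpha_p(\mathbb{R})}=\|\mathcal{F}^{-1}[(1+|\xi|^2)^{\alpha/2}\mathcal{F}g]\|_{L_p(\mathbb{R})}<\infty$; $H^\alpha_p([0,1])$ is the space of restrictions $g|_{[0,1]}$ with the quotient norm $\|f\|_{H^\alpha_p([0,1])}=\inf\{\|g\|_{H^\alpha_p(\mathbb{R})}:g|_{[0,1]}=f\}$. *)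

theory Defs
  imports "HOL-Analysis.Analysis"
begin

definition Lp01 :: "real \<Rightarrow> (real \<Rightarrow> real) \<Rightarrow> bool" where
  "Lp01 p ft \<longleftrightarrow> set_borel_measurable lborel {0..1} ft
      \<and> set_integrable lborel {0..1} (\<lambda>t. \<bar>ft t\<bar> powr p)"

definition Lp01_norm :: "real \<Rightarrow> (real \<Rightarrow> real) \<Rightarrow> real" where
  "Lp01_norm p ft = (LINT t:{0..1}|lborel. \<bar>ft t\<bar> powr p) powr (1/p)"

definition pluspow :: "real \<Rightarrow> real \<Rightarrow> real" where
  "pluspow a y = (if y > 0 then y powr a else 0)"

definition RL_rep :: "real \<Rightarrow> real \<Rightarrow> (real \<Rightarrow> real) \<Rightarrow> real \<Rightarrow> (real \<Rightarrow> real) \<Rightarrow> bool" where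
  "RL_rep \<alpha> p f c ft \<longleftrightarrow> Lp01 p ft \<and>
     (\<forall>x\<in>{0..1}. f x = c + (1 / Gamma \<alpha>) *
         (LINT t:{0..1}|lborel. ft t * pluspow (\<alpha> - 1) (x - t)))"

definition RL_space :: "real \<Rightarrow> real \<Rightarrow> (real \<Rightarrow> real) set" where
  "RL_space \<alpha> p = {f. \<exists>c ft. RL_rep \<alpha> p f c ft}"

text \<open>Norm with q = 1: |f(0)| + Gamma(alpha)^(-1) * ||ft||_p (ft is unique a.e., so
  the infimum over representations is just this value).\<close>
definition RL_norm :: "real \<Rightarrow> real \<Rightarrow> (real \<Rightarrow> real) \<Rightarrow> real" where
  "RL_norm \<alpha> p f = Inf {\<bar>f 0\<bar> + Lp01_norm p ft / Gamma \<alpha> | c ft. RL_rep \<alpha> p f c ft}"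

definition test_fun :: "(real \<Rightarrow> real) \<Rightarrow> bool" where
  "test_fun \<phi> \<longleftrightarrow> (\<forall>n x. ((deriv ^^ n) \<phi>) differentiable (at x))
      \<and> (\<exists>R. \<forall>x. \<bar>x\<bar> > R \<longrightarrow> \<phi> x = 0)"

definition fourier :: "(real \<Rightarrow> real) \<Rightarrow> real \<Rightarrow> complex" where
  "fourier \<phi> \<xi> = (LINT y|lborel. complex_of_real (\<phi> y) * cis (- (y * \<xi>)))"

text \<open>J^{-alpha} phi = F^{-1}[(1+|xi|^2)^{-alpha/2} F phi], real for real phi.\<close>
definition bessel_inv :: "real \<Rightarrow> (real \<Rightarrow> real) \<Rightarrow> real \<Rightarrow> real" where
  "bessel_inv \<alpha> \<phi> x = Re ((1 / (2 * pi)) *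
      (LINT \<xi>|lborel. complex_of_real ((1 + \<xi>\<^sup>2) powr (- \<alpha> / 2)) * fourier \<phi> \<xi> * cis (x * \<xi>)))"

definition Lp :: "real \<Rightarrow> (real \<Rightarrow> real) \<Rightarrow> bool" where
  "Lp p h \<longleftrightarrow> h \<in> borel_measurable lborel \<and> integrable lborel (\<lambda>x. \<bar>h x\<bar> powr p)"

definition Lp_norm :: "real \<Rightarrow> (real \<Rightarrow> real) \<Rightarrow> real" where
  "Lp_norm p h = (LINT x|lborel. \<bar>h x\<bar> powr p) powr (1/p)"

text \<open>g = J^{-alpha} h in the sense of distributions, h in L_p; then
  ||g||_{H^alpha_p(R)} = ||h||_{L_p}.\<close>
definition bessel_rep :: "real \<Rightarrow> real \<Rightarrow> (real \<Rightarrow> real) \<Rightarrow> (real \<Rightarrow> real) \<Rightarrow> bool" where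
  "bessel_rep \<alpha> p g h \<longleftrightarrow> Lp p g \<and> Lp p h \<and>
     (\<forall>\<phi>. test_fun \<phi> \<longrightarrow>
        (LINT x|lborel. g x * \<phi> x) = (LINT x|lborel. h x * bessel_inv \<alpha> \<phi> x))"

definition extends01 :: "(real \<Rightarrow> real) \<Rightarrow> (real \<Rightarrow> real) \<Rightarrow> bool" where
  "extends01 g f \<longleftrightarrow> (AE x in lborel. x \<in> {0..1} \<longrightarrow> g x = f x)"

definition Bessel01 :: "real \<Rightarrow> real \<Rightarrow> (real \<Rightarrow> real) set" where
  "Bessel01 \<alpha> p = {f. \<exists>g h. bessel_rep \<alpha> p g h \<and> extends01 g f}"

definition Bessel01_norm :: "real \<Rightarrow> real \<Rightarrow> (real \<Rightarrow> real) \<Rightarrow> real" where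
  "Bessel01_norm \<alpha> p f = Inf {Lp_norm p h | g h. bessel_rep \<alpha> p g h \<and> extends01 g f}"

end

theory Submission
  imports Defs "HOL-Complex_Analysis.Complex_Analysis"
begin

text \<open>The exponentially damped kernel \<open>K(x) = e\<^sup>-\<^sup>x x\<^sub>+\<^bsup>\<alpha>-1\<^esup> / \<Gamma>(\<alpha>)\<close> has Fourier multiplier \<open>(1 + i \<xi>)\<^bsup>-\<alpha>\<^esup>\<close>, which
  differs from the Bessel multiplier \<open>(1 + \<xi>\<^sup>2)\<^bsup>-\<alpha>/2\<^esup>\<close> only by the phase \<open>exp (- i \<alpha> arctan \<xi>)\<close>. This phase is
  \<open>exp (\<alpha> A)\<close>, where \<open>A\<close> is the principal value convolution with \<open>e\<^bsup>-|x|\<^esup> / (2 x)\<close>, so it preserves \<open>L\<^sub>p\<close> as soon as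
  \<open>A\<close> is bounded on \<open>L\<^sub>p\<close>. Up to an integrable kernel, \<open>A\<close> is convolution with \<open>1 / (2 sinh x)\<close>; for \<open>p \<le> 2\<close>
  its boundedness follows as in M. Riesz' theorem on conjugate functions, by applying Cauchy's theorem in
  the strip \<open>0 < Im z < \<pi>\<close> to the \<open>p\<close>-th power of a holomorphic function with positive real part, and for
  \<open>p > 2\<close> by duality. Finally, on \<open>[0,1]\<close> each \<open>f\<close> in the Riemann--Liouville space, including its
  constant \<open>f(0)\<close>, is of the form \<open>K * \<psi>\<close> with \<open>\<psi>\<close> in \<open>L\<^sub>p\<close> supported in a bounded interval.\<close>

section \<open>Basic theory of the spaces of p-integrable functions\<close>

text \<open>The hyperbolic kernel is preferred to 1/x because \<open>\<i> / sinh z\<close> decays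
  exponentially along the strip and its imaginary part vanishes on the middle line Im z = \<pi>/2;
  there the holomorphic function is real and positive, so its p-th power is controlled by a positive
  kernel alone. Damping makes K integrable, so that convolution with it acts on all of L_p; the
  price is that the undamped kernel must be recovered on a bounded range, which works because both
  kernels are one-sided. The constant f(0) is a separate obstacle: the density t^(-\<alpha>), whose
  potential is constant for x > 0, is not in L_p near 0 when \<alpha> p > 1. The constant is
  therefore produced by a bounded density that starts to the left of the unit interval.\<close>

lemma Lp_norm_nonneg [simp]: "0 \<le> Lp_norm p f"
  by (simp add: Lp_norm_def)

lemma LpD:
  assumes "Lp p f"
  shows Lp_meas: "f \<in> borel_measurable borel" and Lp_int: "integrable lborel (\<lambda>x. \<bar>f x\<bar> powr p)"
  using assms by (auto simp: Lp_def)

lemma Lp_norm_powr: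
  assumes "p > 0"
  shows "Lp_norm p f powr p = (LINT x|lborel. \<bar>f x\<bar> powr p)"
  using assms by (simp add: Lp_norm_def powr_powr)

lemma Lp_norm_le_iff:
  assumes "p > 0" "0 \<le> s"
  shows "Lp_norm p f \<le> s \<longleftrightarrow> (LINT x|lborel. \<bar>f x\<bar> powr p) \<le> s powr p"
proof -
  have "Lp_norm p f \<le> s \<longleftrightarrow> Lp_norm p f powr p \<le> s powr p"
    using assms powr_mono2[of p "Lp_norm p f" s] powr_less_mono2[of p s "Lp_norm p f"]
    by (auto simp: not_le[symmetric])
  then show ?thesis using assms by (simp add: Lp_norm_powr)
qed

lemma Lp_bound:
  assumes "Lp p g" "f \<in> borel_measurable borel" "\<And>x. \<bar>f x\<bar> \<le> \<bar>g x\<bar>" "p > 0"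
  shows "Lp p f" "Lp_norm p f \<le> Lp_norm p g"
proof -
  have le: "\<bar>f x\<bar> powr p \<le> \<bar>g x\<bar> powr p" for x
    using assms by (intro powr_mono2) auto
  have i: "integrable lborel (\<lambda>x. \<bar>f x\<bar> powr p)"
    by (rule Bochner_Integration.integrable_bound[OF Lp_int[OF assms(1)]]) (use assms le in auto)
  show "Lp p f" using assms i by (auto simp: Lp_def)
  show "Lp_norm p f \<le> Lp_norm p g"
    unfolding Lp_norm_def
    using assms i le by (intro powr_mono2 integral_mono Lp_int[OF assms(1)]) auto
qed

lemma Lp_scale:
  assumes "Lp p f" "p > 0"
  shows "Lp p (\<lambda>x. c * f x)" "Lp_norm p (\<lambda>x. c * f x) = \<bar>c\<bar> * Lp_norm p f"
  using assms unfolding Lp_def Lp_norm_def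
  by (auto simp: abs_mult powr_mult powr_powr)

text \<open>Extends convexity of x^p from the open to the closed half-line: if \<open>a\<close> or
  \<open>b\<close> is 0, only l^p \<le> l for l in [0,1] remains, which is
  \<open>small\<close>.\<close>

lemma powr_convex_comb:
  fixes a b l p :: real
  assumes "a \<ge> 0" "b \<ge> 0" "0 \<le> l" "l \<le> 1" "p \<ge> 1"
  shows "(l * a + (1 - l) * b) powr p \<le> l * a powr p + (1 - l) * b powr p"
proof -
  have small: "x powr p \<le> x" if "0 \<le> x" "x \<le> 1" for x :: real
    using that assms powr_mono'[of 1 p x] by (cases "x = 0") auto
  consider "a = 0" | "b = 0" | "a > 0" "b > 0" using assms by linarith
  then show ?thesis
  proof cases
    case 1 then show ?thesis using small[of "1 - l"] assms
      by (auto simp: powr_mult intro: mult_right_mono)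
  next
    case 2 then show ?thesis using small[of l] assms
      by (auto simp: powr_mult intro: mult_right_mono)
  next
    case 3
    have "convex_on {0<..} (\<lambda>x::real. x powr p)" using assms by (intro powr_convex)
    from convex_onD[OF this, of "1 - l" a b] show ?thesis using 3 assms by auto
  qed
qed

lemma Lp_add:
  assumes "Lp p f" "Lp p g" "p \<ge> 1"
  shows "Lp p (\<lambda>x. f x + g x)"
proof -
  have le: "\<bar>f x + g x\<bar> powr p \<le> 2 powr p * (\<bar>f x\<bar> powr p + \<bar>g x\<bar> powr p)" for x
  proof -
    have "\<bar>f x + g x\<bar> powr p \<le> (2 * ((1/2) * \<bar>f x\<bar> + (1 - 1/2) * \<bar>g x\<bar>)) powr p"
      using assms by (intro powr_mono2) auto
    also have "\<dots> = 2 powr p * ((1/2) * \<bar>f x\<bar> + (1 - 1/2) * \<bar>g x\<bar>) powr p"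
      by (subst powr_mult) auto
    also have "\<dots> \<le> 2 powr p * ((1/2) * \<bar>f x\<bar> powr p + (1 - 1/2) * \<bar>g x\<bar> powr p)"
      using assms by (intro mult_left_mono powr_convex_comb) auto
    also have "\<dots> \<le> 2 powr p * (\<bar>f x\<bar> powr p + \<bar>g x\<bar> powr p)"
      using powr_ge_zero[of "\<bar>f x\<bar>" p] powr_ge_zero[of "\<bar>g x\<bar>" p]
    proof (intro mult_left_mono)
      have "0 \<le> \<bar>f x\<bar> powr p" "0 \<le> \<bar>g x\<bar> powr p" by auto
      then show "(1/2) * \<bar>f x\<bar> powr p + (1 - 1/2) * \<bar>g x\<bar> powr p \<le> \<bar>f x\<bar> powr p + \<bar>g x\<bar> powr p" by argo
    qed auto
    finally show ?thesis .
  qed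
  have "integrable lborel (\<lambda>x. 2 powr p * (\<bar>f x\<bar> powr p + \<bar>g x\<bar> powr p))"
    using assms by (auto intro!: Bochner_Integration.integrable_add Lp_int)
  then have "integrable lborel (\<lambda>x. \<bar>f x + g x\<bar> powr p)"
    by (rule Bochner_Integration.integrable_bound) (use Lp_meas[OF assms(1)] Lp_meas[OF assms(2)] le in auto)
  then show ?thesis using assms by (auto simp: Lp_def)
qed

text \<open>Minkowski by convexity: with weights s/(s+t) and t/(s+t), |f+g|/(s+t) is dominated by a
  convex combination of |f|/s and |g|/t, both of norm at most 1. Taking s and t strictly above the
  norms keeps the divisors positive when a norm is 0.\<close>

lemma Lp_norm_add:
  assumes f: "Lp p f" and g: "Lp p g" and p: "p \<ge> 1"
  shows "Lp_norm p (\<lambda>x. f x + g x) \<le> Lp_norm p f + Lp_norm p g"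
proof -
  have key: "Lp_norm p (\<lambda>x. f x + g x) \<le> s + t" if s: "Lp_norm p f < s" and t: "Lp_norm p g < t" for s t
  proof -
    have s0: "s > 0" and t0: "t > 0" using s t Lp_norm_nonneg[of p f] Lp_norm_nonneg[of p g] by linarith+
    define l where "l = s / (s + t)"
    have l: "0 \<le> l" "l \<le> 1" "1 - l = t / (s + t)" using s0 t0 by (auto simp: l_def field_simps)
    have pw: "\<bar>f x + g x\<bar> powr p \<le> (s + t) powr p * (l * (\<bar>f x\<bar> powr p / s powr p) + (1 - l) * (\<bar>g x\<bar> powr p / t powr p))" for x
    proof -
      have "\<bar>f x + g x\<bar> \<le> (s + t) * (l * (\<bar>f x\<bar> / s) + (1 - l) * (\<bar>g x\<bar> / t))"
      proof -
        have "(s + t) * (l * (\<bar>f x\<bar> / s) + (1 - l) * (\<bar>g x\<bar> / t)) = \<bar>f x\<bar> + \<bar>g x\<bar>"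
          unfolding l(3) unfolding l_def using s0 t0 by (simp add: distrib_left)
        then show ?thesis by simp
      qed
      then have "\<bar>f x + g x\<bar> powr p \<le> ((s + t) * (l * (\<bar>f x\<bar> / s) + (1 - l) * (\<bar>g x\<bar> / t))) powr p"
        using p by (intro powr_mono2) auto
      also have "\<dots> = (s + t) powr p * (l * (\<bar>f x\<bar> / s) + (1 - l) * (\<bar>g x\<bar> / t)) powr p"
        using s0 t0 l by (subst powr_mult) auto
      also have "\<dots> \<le> (s + t) powr p * (l * (\<bar>f x\<bar> / s) powr p + (1 - l) * (\<bar>g x\<bar> / t) powr p)"
        using p l s0 t0 by (intro mult_left_mono powr_convex_comb) auto
      finally show ?thesis using s0 t0 by (simp add: powr_divide)
    qed
    have "(LINT x|lborel. \<bar>f x + g x\<bar> powr p) \<le>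
      (LINT x|lborel. (s + t) powr p * (l * (\<bar>f x\<bar> powr p / s powr p) + (1 - l) * (\<bar>g x\<bar> powr p / t powr p)))"
      using pw Lp_int[OF f] Lp_int[OF g] Lp_int[OF Lp_add[OF f g p]]
      by (intro integral_mono) auto
    also have "\<dots> = (s + t) powr p * (l * ((LINT x|lborel. \<bar>f x\<bar> powr p) / s powr p) + (1 - l) * ((LINT x|lborel. \<bar>g x\<bar> powr p) / t powr p))"
      using Lp_int[OF f] Lp_int[OF g] by simp
    also have "\<dots> \<le> (s + t) powr p * (l * 1 + (1 - l) * 1)"
    proof (intro mult_left_mono add_mono)
      show "(LINT x|lborel. \<bar>f x\<bar> powr p) / s powr p \<le> 1"
        using s s0 p Lp_norm_le_iff[of p s f] by (auto simp: divide_le_eq)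
      show "(LINT x|lborel. \<bar>g x\<bar> powr p) / t powr p \<le> 1"
        using t t0 p Lp_norm_le_iff[of p t g] by (auto simp: divide_le_eq)
    qed (use l in auto)
    finally show ?thesis using p s0 t0 by (subst Lp_norm_le_iff) auto
  qed
  show ?thesis
  proof (rule field_le_epsilon)
    fix e :: real assume "e > 0"
    then show "Lp_norm p (\<lambda>x. f x + g x) \<le> Lp_norm p f + Lp_norm p g + e"
      using key[of "Lp_norm p f + e/2" "Lp_norm p g + e/2"] by auto
  qed
qed

lemma Lp_diff:
  assumes f: "Lp p f" and g: "Lp p g" and p: "p \<ge> 1"
  shows "Lp p (\<lambda>x. f x - g x)" "Lp_norm p (\<lambda>x. f x - g x) \<le> Lp_norm p f + Lp_norm p g"
proof -
  have g': "Lp p (\<lambda>x. (-1) * g x)" "Lp_norm p (\<lambda>x. (-1) * g x) = Lp_norm p g"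
    using Lp_scale[OF g, of "-1"] p by auto
  show "Lp p (\<lambda>x. f x - g x)" "Lp_norm p (\<lambda>x. f x - g x) \<le> Lp_norm p f + Lp_norm p g"
    using Lp_add[OF f g'(1) p] Lp_norm_add[OF f g'(1) p] g'(2) by auto
qed

lemma Lp_norm_minus_commute: "Lp_norm p (\<lambda>x. f x - g x) = Lp_norm p (\<lambda>x. g x - f x)"
  by (simp add: Lp_norm_def abs_minus_commute)

lemma Lp_norm_triangle3:
  assumes f: "Lp p f" and g: "Lp p g" and h: "Lp p h" and p: "p \<ge> 1"
  shows "Lp_norm p (\<lambda>x. f x - h x) \<le> Lp_norm p (\<lambda>x. f x - g x) + Lp_norm p (\<lambda>x. g x - h x)"
  using Lp_norm_add[OF Lp_diff(1)[OF f g p] Lp_diff(1)[OF g h p] p] by simp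

lemma Lp_zero [simp]: "Lp p (\<lambda>x. 0)" "Lp_norm p (\<lambda>x. 0) = 0"
  by (auto simp: Lp_def Lp_norm_def)

lemma Lp_sum:
  assumes "\<And>i. i \<in> I \<Longrightarrow> Lp p (f i)" "p \<ge> 1" "finite I"
  shows "Lp p (\<lambda>x. \<Sum>i\<in>I. f i x) \<and> Lp_norm p (\<lambda>x. \<Sum>i\<in>I. f i x) \<le> (\<Sum>i\<in>I. Lp_norm p (f i))"
  using assms(3,1)
proof (induction I)
  case (insert i I)
  then show ?case
    using Lp_add[of p "f i" "\<lambda>x. \<Sum>i\<in>I. f i x"] Lp_norm_add[of p "f i" "\<lambda>x. \<Sum>i\<in>I. f i x"] assms(2)
    by fastforce
qed auto

lemma Lp_norm_cong_AE:
  assumes "AE x in lborel. f x = g x" "f \<in> borel_measurable borel" "g \<in> borel_measurable borel"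
  shows "Lp_norm p f = Lp_norm p g" "Lp p f \<longleftrightarrow> Lp p g"
proof -
  show "Lp_norm p f = Lp_norm p g" unfolding Lp_norm_def
    using assms by (intro arg_cong2[where f="(powr)"] integral_cong_AE refl) auto
  have "integrable lborel (\<lambda>x. \<bar>f x\<bar> powr p) = integrable lborel (\<lambda>x. \<bar>g x\<bar> powr p)"
    using assms by (intro integrable_cong_AE) auto
  then show "Lp p f \<longleftrightarrow> Lp p g" using assms by (auto simp: Lp_def)
qed

lemma Hoelder:
  assumes f: "Lp p f" and g: "Lp q g" and pq: "p > 1" "q > 1" "1/p + 1/q = 1"
  shows "integrable lborel (\<lambda>x. f x * g x)"
    and "(LINT x|lborel. \<bar>f x * g x\<bar>) \<le> Lp_norm p f * Lp_norm q g"
    and "\<bar>LINT x|lborel. f x * g x\<bar> \<le> Lp_norm p f * Lp_norm q g"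
proof -
  have [measurable]: "f \<in> borel_measurable borel" "g \<in> borel_measurable borel"
    using Lp_meas f g by auto
  \<comment> \<open>Young's inequality for the normalised values |f|/s and |g|/t; for s and t above
    the norms the right side integrates to at most s t (1/p + 1/q) = s t.\<close>
  have young: "\<bar>f x * g x\<bar> \<le> s * t * ((\<bar>f x\<bar> powr p / s powr p) / p + (\<bar>g x\<bar> powr q / t powr q) / q)"
    if "s > 0" "t > 0" for s t x
  proof -
    have "(\<bar>f x\<bar> / s) * (\<bar>g x\<bar> / t) \<le> (\<bar>f x\<bar> / s) powr p / p + (\<bar>g x\<bar> / t) powr q / q"
      using pq that by (intro Youngs_inequality) auto
    then have "s * t * ((\<bar>f x\<bar> / s) * (\<bar>g x\<bar> / t)) \<le> s * t * ((\<bar>f x\<bar> / s) powr p / p + (\<bar>g x\<bar> / t) powr q / q)"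
      using that by (intro mult_left_mono) auto
    moreover have "s * t * ((\<bar>f x\<bar> / s) * (\<bar>g x\<bar> / t)) = \<bar>f x * g x\<bar>"
      using that by (simp add: abs_mult)
    ultimately show ?thesis using that by (simp add: powr_divide)
  qed
  have int: "integrable lborel (\<lambda>x. s * t * ((\<bar>f x\<bar> powr p / s powr p) / p + (\<bar>g x\<bar> powr q / t powr q) / q))" for s t
    using Lp_int[OF f] Lp_int[OF g] by auto
  show i: "integrable lborel (\<lambda>x. f x * g x)"
  proof (rule Bochner_Integration.integrable_bound[OF int[of 1 1]])
    show "AE x in lborel. norm (f x * g x) \<le> norm (1 * 1 * ((\<bar>f x\<bar> powr p / 1 powr p) / p + (\<bar>g x\<bar> powr q / 1 powr q) / q))"
    proof (rule AE_I2)
      fix x show "norm (f x * g x) \<le> norm (1 * 1 * ((\<bar>f x\<bar> powr p / 1 powr p) / p + (\<bar>g x\<bar> powr q / 1 powr q) / q))"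
        unfolding real_norm_def by (rule order_trans[OF young[of 1 1 x] abs_ge_self]) auto
    qed
  qed auto
  have key: "(LINT x|lborel. \<bar>f x * g x\<bar>) \<le> s * t" if s: "Lp_norm p f < s" and t: "Lp_norm q g < t" for s t
  proof -
    have s0: "s > 0" and t0: "t > 0" using s t Lp_norm_nonneg[of p f] Lp_norm_nonneg[of q g] by linarith+
    have "(LINT x|lborel. \<bar>f x * g x\<bar>) \<le> (LINT x|lborel. s * t * ((\<bar>f x\<bar> powr p / s powr p) / p + (\<bar>g x\<bar> powr q / t powr q) / q))"
      using young[OF s0 t0] i int by (intro integral_mono) auto
    also have "\<dots> = s * t * (((LINT x|lborel. \<bar>f x\<bar> powr p) / s powr p) / p + ((LINT x|lborel. \<bar>g x\<bar> powr q) / t powr q) / q)"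
      using Lp_int[OF f] Lp_int[OF g] by simp
    also have "\<dots> \<le> s * t * (1 / p + 1 / q)"
    proof (intro mult_left_mono add_mono divide_right_mono)
      show "(LINT x|lborel. \<bar>f x\<bar> powr p) / s powr p \<le> 1"
        using s s0 pq Lp_norm_le_iff[of p s f] by (auto simp: divide_le_eq)
      show "(LINT x|lborel. \<bar>g x\<bar> powr q) / t powr q \<le> 1"
        using t t0 pq Lp_norm_le_iff[of q t g] by (auto simp: divide_le_eq)
    qed (use pq s0 t0 in auto)
    finally show ?thesis using pq by simp
  qed
  \<comment> \<open>Letting s and t decrease to the norms also covers the case that a norm is
    0.\<close>
  have lim: "((\<lambda>e. (Lp_norm p f + e) * (Lp_norm q g + e)) \<longlongrightarrow> (Lp_norm p f + 0) * (Lp_norm q g + 0)) (at_right 0)"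
    by (intro tendsto_intros)
  have "(LINT x|lborel. \<bar>f x * g x\<bar>) \<le> (Lp_norm p f + 0) * (Lp_norm q g + 0)"
  proof (rule tendsto_lowerbound[OF lim])
    show "\<forall>\<^sub>F e in at_right 0. (LINT x|lborel. \<bar>f x * g x\<bar>) \<le> (Lp_norm p f + e) * (Lp_norm q g + e)"
      by (rule eventually_at_rightI[of 0 1]) (auto intro!: key)
  qed simp
  then show 2: "(LINT x|lborel. \<bar>f x * g x\<bar>) \<le> Lp_norm p f * Lp_norm q g" by simp
  show "\<bar>LINT x|lborel. f x * g x\<bar> \<le> Lp_norm p f * Lp_norm q g"
    using integral_abs_bound[of lborel "\<lambda>x. f x * g x"] 2 by linarith
qed

section \<open>Limits and completeness in L_p\<close>

lemma Lp_Fatou: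
  assumes F: "\<And>n. Lp p (F n)" "\<And>n::nat. Lp_norm p (F n) \<le> C" and p: "p > 0"
    and f: "f \<in> borel_measurable borel" and lim: "AE x in lborel. (\<lambda>n. F n x) \<longlonglongrightarrow> f x"
  shows "Lp p f" "Lp_norm p f \<le> C"
proof -
  have C: "C \<ge> 0" using F(2)[of 0] Lp_norm_nonneg[of p "F 0"] by linarith
  have [measurable]: "F n \<in> borel_measurable borel" for n using Lp_meas F by auto
  note f[measurable]
  have "(\<integral>\<^sup>+x. ennreal (\<bar>f x\<bar> powr p) \<partial>lborel) = (\<integral>\<^sup>+x. liminf (\<lambda>n. ennreal (\<bar>F n x\<bar> powr p)) \<partial>lborel)"
  proof (rule nn_integral_cong_AE, use lim in eventually_elim)
    fix x assume "(\<lambda>n. F n x) \<longlonglongrightarrow> f x"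
    then have "(\<lambda>n. ennreal (\<bar>F n x\<bar> powr p)) \<longlonglongrightarrow> ennreal (\<bar>f x\<bar> powr p)"
      using p by (intro tendsto_ennrealI tendsto_powr' tendsto_rabs tendsto_const) auto
    then show "ennreal (\<bar>f x\<bar> powr p) = liminf (\<lambda>n. ennreal (\<bar>F n x\<bar> powr p))"
      by (rule lim_imp_Liminf[symmetric, rotated]) simp
  qed
  also have "\<dots> \<le> liminf (\<lambda>n. \<integral>\<^sup>+x. ennreal (\<bar>F n x\<bar> powr p) \<partial>lborel)"
    by (intro nn_integral_liminf) auto
  also have "\<dots> \<le> liminf (\<lambda>n. ennreal (C powr p))"
  proof (intro Liminf_mono always_eventually allI)
    fix n
    have "(\<integral>\<^sup>+x. ennreal (\<bar>F n x\<bar> powr p) \<partial>lborel) = ennreal (LINT x|lborel. \<bar>F n x\<bar> powr p)"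
      using F(1)[of n] by (intro nn_integral_eq_integral Lp_int) auto
    also have "\<dots> \<le> ennreal (C powr p)"
      using F(2)[of n] p C by (subst (asm) Lp_norm_le_iff) (auto intro: ennreal_leI)
    finally show "(\<integral>\<^sup>+x. ennreal (\<bar>F n x\<bar> powr p) \<partial>lborel) \<le> ennreal (C powr p)" .
  qed
  also have "\<dots> = ennreal (C powr p)" by (simp add: Liminf_const)
  finally have le: "(\<integral>\<^sup>+x. ennreal (\<bar>f x\<bar> powr p) \<partial>lborel) \<le> ennreal (C powr p)" .
  then have i: "integrable lborel (\<lambda>x. \<bar>f x\<bar> powr p)"
    by (intro integrableI_bounded) (auto intro: le_less_trans)
  then show "Lp p f" by (auto simp: Lp_def)
  have "(LINT x|lborel. \<bar>f x\<bar> powr p) \<le> C powr p"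
    using le nn_integral_eq_integral[OF i] by (auto simp: ennreal_le_iff2)
  then show "Lp_norm p f \<le> C" using p C by (simp add: Lp_norm_le_iff)
qed

lemma Lp_dominated_convergence:
  assumes F: "\<And>n. F n \<in> borel_measurable borel" and f: "f \<in> borel_measurable borel"
    and G: "Lp p G" and p: "p > 0"
    and lim: "\<And>x. (\<lambda>n::nat. F n x) \<longlonglongrightarrow> f x" and dom: "\<And>n x. \<bar>F n x\<bar> \<le> \<bar>G x\<bar>"
  shows "Lp p f" "(\<lambda>n. Lp_norm p (\<lambda>x. F n x - f x)) \<longlonglongrightarrow> 0"
proof -
  have [measurable]: "F n \<in> borel_measurable borel" "f \<in> borel_measurable borel" "G \<in> borel_measurable borel" for n
    using F f Lp_meas[OF G] by auto
  have fG: "\<bar>f x\<bar> \<le> \<bar>G x\<bar>" for x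
    by (rule tendsto_upperbound[OF tendsto_rabs[OF lim[of x]]]) (use dom in auto)
  show "Lp p f" using Lp_bound[OF G f] fG p by auto
  have G2: "integrable lborel (\<lambda>x. \<bar>2 * G x\<bar> powr p)" using Lp_scale(1)[OF G p] by (auto simp: Lp_def)
  have le: "\<bar>F n x - f x\<bar> powr p \<le> \<bar>2 * G x\<bar> powr p" for n x
    using dom[of n x] fG[of x] p by (intro powr_mono2) auto
  have "(\<lambda>n. LINT x|lborel. \<bar>F n x - f x\<bar> powr p) \<longlonglongrightarrow> (LINT x::real|lborel. 0::real)"
  proof (rule Bochner_Integration.integral_dominated_convergence[where w = "\<lambda>x. \<bar>2 * G x\<bar> powr p"])
    show "AE x in lborel. (\<lambda>n. \<bar>F n x - f x\<bar> powr p) \<longlonglongrightarrow> 0"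
    proof (rule AE_I2)
      fix x
      have "(\<lambda>n. \<bar>F n x - f x\<bar> powr p) \<longlonglongrightarrow> \<bar>f x - f x\<bar> powr p"
        using p by (intro tendsto_powr' tendsto_intros lim) auto
      then show "(\<lambda>n. \<bar>F n x - f x\<bar> powr p) \<longlonglongrightarrow> 0" by simp
    qed
  qed (use le G2 in auto)
  then have "(\<lambda>n. (LINT x|lborel. \<bar>F n x - f x\<bar> powr p) powr (1/p)) \<longlonglongrightarrow> 0 powr (1/p)"
    using p by (intro tendsto_powr') (auto simp: eventually_sequentially)
  then show "(\<lambda>n. Lp_norm p (\<lambda>x. F n x - f x)) \<longlonglongrightarrow> 0"
    by (simp add: Lp_norm_def)
qed

text \<open>Riesz-Fischer: along a subsequence with consecutive distances below (1/2)^k the sum of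
  the absolute differences has norm at most 2, hence is finite almost everywhere, which makes the
  subsequence converge pointwise.\<close>

lemma Lp_complete:
  assumes F: "\<And>n::nat. Lp p (F n)" and p: "p \<ge> 1"
    and Cauchy: "\<And>e. e > 0 \<Longrightarrow> \<exists>M. \<forall>m\<ge>M. \<forall>n\<ge>M. Lp_norm p (\<lambda>x. F m x - F n x) < e"
  obtains f where "Lp p f" "(\<lambda>n. Lp_norm p (\<lambda>x. F n x - f x)) \<longlonglongrightarrow> 0"
proof -
  have "\<exists>r. \<forall>k. (\<forall>m\<ge>r k. \<forall>n\<ge>r k. Lp_norm p (\<lambda>x. F m x - F n x) < (1/2)^k) \<and> r k < r (Suc k)"
  proof (rule dependent_nat_choice)
    show "\<exists>M. \<forall>m\<ge>M. \<forall>n\<ge>M. Lp_norm p (\<lambda>x. F m x - F n x) < (1/2)^0" using Cauchy[of 1] by simp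
    fix M k
    obtain M' where M': "\<forall>m\<ge>M'. \<forall>n\<ge>M'. Lp_norm p (\<lambda>x. F m x - F n x) < (1/2)^Suc k"
      using Cauchy[of "(1/2)^Suc k"] by auto
    show "\<exists>N. (\<forall>m\<ge>N. \<forall>n\<ge>N. Lp_norm p (\<lambda>x. F m x - F n x) < (1/2)^Suc k) \<and> M < N"
      using M' by (intro exI[of _ "max M' (Suc M)"]) auto
  qed
  then obtain r where r: "\<And>k m n. m \<ge> r k \<Longrightarrow> n \<ge> r k \<Longrightarrow> Lp_norm p (\<lambda>x. F m x - F n x) < (1/2)^k"
    and rS: "\<And>k. r k < r (Suc k)" by blast
  have mono: "strict_mono r" using rS by (simp add: strict_mono_Suc_iff)
  have [measurable]: "F n \<in> borel_measurable borel" for n using Lp_meas F by auto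
  define d where "d k x = \<bar>F (r (Suc k)) x - F (r k) x\<bar>" for k x
  have d: "Lp p (d k)" "Lp_norm p (d k) \<le> (1/2)^k" for k
  proof -
    have "Lp p (\<lambda>x. F (r (Suc k)) x - F (r k) x)" using Lp_diff F p by auto
    then show "Lp p (d k)" unfolding d_def by (rule Lp_bound) (use p in auto)
    have "Lp_norm p (d k) = Lp_norm p (\<lambda>x. F (r (Suc k)) x - F (r k) x)"
      by (simp add: d_def Lp_norm_def)
    also have "\<dots> < (1/2)^k" using rS[of k] by (intro r) auto
    finally show "Lp_norm p (d k) \<le> (1/2)^k" by simp
  qed
  define G where "G n x = (\<Sum>k<n. d k x)" for n x
  have G: "Lp p (G n)" "Lp_norm p (G n) \<le> 2" for n
  proof -
    have *: "Lp p (G n) \<and> Lp_norm p (G n) \<le> (\<Sum>k<n. Lp_norm p (d k))"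
      unfolding G_def using d p by (intro Lp_sum) auto
    have "(\<Sum>k<n. Lp_norm p (d k)) \<le> (\<Sum>k<n. (1/2::real)^k)" using d by (intro sum_mono) auto
    also have "\<dots> \<le> 2" by (simp add: geometric_sum)
    finally show "Lp p (G n)" "Lp_norm p (G n) \<le> 2" using * by auto
  qed
  have [measurable]: "G n \<in> borel_measurable borel" for n using Lp_meas G by auto
  have dpos: "d k x \<ge> 0" for k x by (simp add: d_def)
  have Gpos: "G n x \<ge> 0" for n x unfolding G_def by (intro sum_nonneg dpos)
  have Gmono: "G n x \<le> G m x" if "n \<le> m" for n m x
    unfolding G_def using that dpos by (intro sum_mono2) auto
  have "(\<integral>\<^sup>+x. (SUP n. ennreal (G n x powr p)) \<partial>lborel) = (SUP n. \<integral>\<^sup>+x. ennreal (G n x powr p) \<partial>lborel)"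
    using Gmono Gpos p
    by (intro nn_integral_monotone_convergence_SUP)
      (auto simp: incseq_def le_fun_def intro!: ennreal_leI powr_mono2)
  also have "\<dots> \<le> ennreal (2 powr p)"
  proof (intro SUP_least)
    fix n
    have "(\<integral>\<^sup>+x. ennreal (G n x powr p) \<partial>lborel) = ennreal (LINT x|lborel. \<bar>G n x\<bar> powr p)"
      using Lp_int[OF G(1)[of n]] Gpos by (subst nn_integral_eq_integral[symmetric]) auto
    also have "\<dots> \<le> ennreal (2 powr p)"
      using G(2)[of n] p by (subst (asm) Lp_norm_le_iff) (auto intro: ennreal_leI)
    finally show "(\<integral>\<^sup>+x. ennreal (G n x powr p) \<partial>lborel) \<le> ennreal (2 powr p)" .
  qed
  finally have "(\<integral>\<^sup>+x. (SUP n. ennreal (G n x powr p)) \<partial>lborel) \<noteq> \<infinity>"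
    by (auto simp: top_unique)
  then have "AE x in lborel. (SUP n. ennreal (G n x powr p)) \<noteq> \<infinity>"
    by (intro nn_integral_PInf_AE) auto
  then have conv: "AE x in lborel. convergent (\<lambda>k. F (r k) x)"
  proof eventually_elim
    fix x assume fin: "(SUP n. ennreal (G n x powr p)) \<noteq> \<infinity>"
    define B where "B = enn2real (SUP n. ennreal (G n x powr p))"
    have B: "G n x powr p \<le> B" for n
    proof -
      have "ennreal (G n x powr p) \<le> (SUP n. ennreal (G n x powr p))" by (intro SUP_upper) auto
      also have "\<dots> = ennreal B" using fin unfolding B_def by (metis ennreal_enn2real_if infinity_ennreal_def)
      finally show ?thesis by (subst (asm) ennreal_le_iff) (auto simp: B_def)
    qed
    have "G n x \<le> B powr (1/p)" for n
    proof -
      have "G n x = (G n x powr p) powr (1/p)" using p Gpos[of n x] by (simp add: powr_powr)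
      also have "\<dots> \<le> B powr (1/p)" using p B by (intro powr_mono2) auto
      finally show ?thesis .
    qed
    then have "summable (\<lambda>k. d k x)"
      using dpos by (intro bounded_imp_summable[of _ "B powr (1/p)"])
        (simp_all only: G_def lessThan_Suc_atMost[symmetric])
    then have "summable (\<lambda>k. F (r (Suc k)) x - F (r k) x)"
      unfolding d_def by (rule summable_rabs_cancel)
    then have "convergent (\<lambda>n. \<Sum>k<n. F (r (Suc k)) x - F (r k) x)"
      by (simp add: summable_iff_convergent)
    then have "convergent (\<lambda>n. F (r n) x - F (r 0) x)"
      by (subst (asm) sum_lessThan_telescope)
    then show "convergent (\<lambda>k. F (r k) x)"
      using convergent_add_const_iff[of "- F (r 0) x" "\<lambda>n. F (r n) x"] by (simp add: add.commute)
  qed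
  define f where "f x = lim (\<lambda>k. F (r k) x)" for x
  have f[measurable]: "f \<in> borel_measurable borel"
    unfolding f_def by (intro borel_measurable_lim_metric) auto
  have lim: "AE x in lborel. (\<lambda>k. F (r k) x) \<longlonglongrightarrow> f x"
    using conv by eventually_elim (simp add: f_def convergent_LIMSEQ_iff)
  \<comment> \<open>Fatou along the subsequence carries a bound on the distance of F m to F n, valid
    for all large n, over to the distance of F m to f.\<close>
  have diff: "Lp p (\<lambda>x. F m x - f x) \<and> Lp_norm p (\<lambda>x. F m x - f x) \<le> e"
    if M: "\<And>n. n \<ge> M \<Longrightarrow> Lp_norm p (\<lambda>x. F m x - F n x) \<le> e" for m M e
  proof -
    have "AE x in lborel. (\<lambda>n. F m x - F (r (n + M)) x) \<longlonglongrightarrow> F m x - f x"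
      using lim
    proof eventually_elim
      fix x assume "(\<lambda>k. F (r k) x) \<longlonglongrightarrow> f x"
      from LIMSEQ_ignore_initial_segment[OF this, of M]
      show "(\<lambda>n. F m x - F (r (n + M)) x) \<longlonglongrightarrow> F m x - f x" by (intro tendsto_intros)
    qed
    moreover have "Lp_norm p (\<lambda>x. F m x - F (r (n + M)) x) \<le> e" for n
      using seq_suble[OF mono, of "n + M"] by (intro M) auto
    moreover have "Lp p (\<lambda>x. F m x - F (r (n + M)) x)" for n using Lp_diff F p by auto
    ultimately show ?thesis
      using Lp_Fatou[of p "\<lambda>n x. F m x - F (r (n + M)) x" e "\<lambda>x. F m x - f x"] p by auto
  qed
  have lim0: "(\<lambda>n. Lp_norm p (\<lambda>x. F n x - f x)) \<longlonglongrightarrow> 0"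
  proof (rule LIMSEQ_I)
    fix e :: real assume e: "e > 0"
    then obtain M where M: "\<forall>m\<ge>M. \<forall>n\<ge>M. Lp_norm p (\<lambda>x. F m x - F n x) < e/2"
      using Cauchy[of "e/2"] by auto
    have "Lp_norm p (\<lambda>x. F m x - f x) \<le> e/2" if "m \<ge> M" for m
      using diff[of M m "e/2"] M that by (auto simp: less_imp_le)
    then show "\<exists>no. \<forall>n\<ge>no. norm (Lp_norm p (\<lambda>x. F n x - f x) - 0) < e"
      using e by (intro exI[of _ M]) (fastforce intro: le_less_trans[of _ "e/2"])
  qed
  obtain M where M: "\<forall>m\<ge>M. \<forall>n\<ge>M. Lp_norm p (\<lambda>x. F m x - F n x) < 1" using Cauchy[of 1] by auto
  have "Lp p (\<lambda>x. F M x - f x)" using diff[of M M 1] M by (auto simp: less_imp_le)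
  from Lp_diff(1)[OF F[of M] this p] have "Lp p f" by simp
  then show ?thesis using lim0 that by blast
qed

section \<open>Convolution and density\<close>

text \<open>Packages Fubini so that only iterated integrals in one chosen order need to be checked;
  integrability in the swapped order comes out as a conclusion.\<close>

lemma Fubini_swap:
  fixes f :: "real \<Rightarrow> real \<Rightarrow> 'b :: {banach, second_countable_topology}"
  assumes [measurable]: "(\<lambda>(x, y). f x y) \<in> borel_measurable (lborel \<Otimes>\<^sub>M lborel)"
    and inner: "AE x in lborel. integrable lborel (f x)"
    and outer: "integrable lborel (\<lambda>x. LINT y|lborel. norm (f x y))"
  shows "AE y in lborel. integrable lborel (\<lambda>x. f x y)"
    and "integrable lborel (\<lambda>y. LINT x|lborel. f x y)"
    and "integrable lborel (\<lambda>x. LINT y|lborel. f x y)"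
    and "(LINT y|lborel. LINT x|lborel. f x y) = (LINT x|lborel. LINT y|lborel. f x y)"
proof -
  have int: "integrable (lborel \<Otimes>\<^sub>M lborel) (\<lambda>(x, y). f x y)"
    using inner outer by (intro lborel_pair.Fubini_integrable) auto
  from lborel_pair.integrable_product_swap[OF this]
  have int': "integrable (lborel \<Otimes>\<^sub>M lborel) (\<lambda>(y, x). f x y)" by simp
  show "AE y in lborel. integrable lborel (\<lambda>x. f x y)"
    using lborel_pair.AE_integrable_fst'[OF int'] by simp
  show "integrable lborel (\<lambda>y. LINT x|lborel. f x y)"
    using lborel_pair.integrable_fst'[OF int'] by simp
  show "integrable lborel (\<lambda>x. LINT y|lborel. f x y)"
    using lborel_pair.integrable_fst'[OF int] by simp
  show "(LINT y|lborel. LINT x|lborel. f x y) = (LINT x|lborel. LINT y|lborel. f x y)"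
    using lborel_pair.Fubini_integral[OF int] by simp
qed

lemma lborel_integral_shift:
  fixes u :: "real \<Rightarrow> 'b :: {banach, second_countable_topology}"
  shows "(LINT x|lborel. u (x - t)) = (LINT x|lborel. u x)"
    "(LINT x|lborel. u (x + t)) = (LINT x|lborel. u x)"
    "(LINT x|lborel. u (t - x)) = (LINT x|lborel. u x)"
    "(LINT x|lborel. u (- x)) = (LINT x|lborel. u x)"
  using lborel_integral_real_affine[of 1 u "-t"] lborel_integral_real_affine[of 1 u t]
    lborel_integral_real_affine[of "-1" u t] lborel_integral_real_affine[of "-1" u 0]
  by (auto simp: add.commute)

lemma lborel_integrable_shift:
  fixes u :: "real \<Rightarrow> 'b :: {banach, second_countable_topology}"
  shows "integrable lborel (\<lambda>x. u (x - t)) \<longleftrightarrow> integrable lborel u"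
    "integrable lborel (\<lambda>x. u (x + t)) \<longleftrightarrow> integrable lborel u"
    "integrable lborel (\<lambda>x. u (t - x)) \<longleftrightarrow> integrable lborel u"
    "integrable lborel (\<lambda>x. u (- x)) \<longleftrightarrow> integrable lborel u"
  using lborel_integrable_real_affine_iff[of 1 u "-t"] lborel_integrable_real_affine_iff[of 1 u t]
    lborel_integrable_real_affine_iff[of "-1" u t] lborel_integrable_real_affine_iff[of "-1" u 0]
  by (auto simp: add.commute)

section \<open>Convolution with integrable kernels\<close>

definition conv :: "(real \<Rightarrow> real) \<Rightarrow> (real \<Rightarrow> real) \<Rightarrow> real \<Rightarrow> real" where
  "conv k f x = (LINT t|lborel. k t * f (x - t))"

lemma conv_measurable [measurable]:
  assumes [measurable]: "k \<in> borel_measurable borel" "f \<in> borel_measurable borel"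
  shows "conv k f \<in> borel_measurable borel"
  unfolding conv_def by measurable

lemma conv_alt: "conv k f x = (LINT t|lborel. k (x - t) * f t)"
  unfolding conv_def using lborel_integral_shift(3)[of "\<lambda>t. k t * f (x - t)" x] by simp

lemma conv_L1:
  assumes k: "integrable lborel k" and u: "integrable lborel u"
  shows "AE x in lborel. integrable lborel (\<lambda>t. k t * u (x - t))"
    and "integrable lborel (conv k u)"
    and "(LINT x|lborel. conv k u x) = (LINT t|lborel. k t) * (LINT x|lborel. u x)"
proof -
  have [measurable]: "k \<in> borel_measurable borel" "u \<in> borel_measurable borel" using k u by auto
  have m: "(\<lambda>(t, x). k t * u (x - t)) \<in> borel_measurable (lborel \<Otimes>\<^sub>M lborel)" by measurable
  have 1: "AE t in lborel. integrable lborel (\<lambda>x. k t * u (x - t))"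
    using u lborel_integrable_shift(1)[of u] by auto
  have 2: "integrable lborel (\<lambda>t. LINT x|lborel. norm (k t * u (x - t)))"
    using k lborel_integral_shift(1)[of "\<lambda>x. \<bar>u x\<bar>"] by (simp add: abs_mult)
  note * = Fubini_swap[OF m 1 2]
  show "AE x in lborel. integrable lborel (\<lambda>t. k t * u (x - t))" by (rule *(1))
  show "integrable lborel (conv k u)" using *(2) by (simp add: conv_def[abs_def])
  show "(LINT x|lborel. conv k u x) = (LINT t|lborel. k t) * (LINT x|lborel. u x)"
    using *(4) lborel_integral_shift(1)[of u] k u by (simp add: conv_def)
qed

text \<open>Split |k| into |k|^(1/p) |k|^(1/q) and apply Hoelder in t: the p-th power of the
  convolution is at most \<kappa>^(p-1) times |k| convolved with |f|^p, an L_1 convolution whose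
  integral is \<kappa> times that of |f|^p.\<close>

lemma Young_convolution:
  assumes k: "integrable lborel k" and f: "Lp p f" and p: "p > 1"
  shows "AE x in lborel. integrable lborel (\<lambda>t. k t * f (x - t))"
    and "Lp p (conv k f)"
    and "Lp_norm p (conv k f) \<le> (LINT t|lborel. \<bar>k t\<bar>) * Lp_norm p f"
proof -
  define q where "q = p / (p - 1)"
  have q: "q > 1" "1/p + 1/q = 1" using p by (auto simp: q_def field_simps)
  have [measurable]: "k \<in> borel_measurable borel" "f \<in> borel_measurable borel"
    using k Lp_meas[OF f] by auto
  have k_abs: "integrable lborel (\<lambda>t. \<bar>k t\<bar>)" using k by auto
  define \<kappa> where "\<kappa> = (LINT t|lborel. \<bar>k t\<bar>)"
  have \<kappa>0: "\<kappa> \<ge> 0" unfolding \<kappa>_def by simp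
  define v where "v = (\<lambda>x. \<bar>f x\<bar> powr p)"
  have vi: "integrable lborel v" unfolding v_def by (rule Lp_int[OF f])
  note L1 = conv_L1[OF k_abs vi]
  have pw: "AE x in lborel. integrable lborel (\<lambda>t. k t * f (x - t)) \<and>
      \<bar>conv k f x\<bar> powr p \<le> \<kappa> powr (p - 1) * conv (\<lambda>t. \<bar>k t\<bar>) v x"
    using L1(1)
  proof eventually_elim
    fix x assume i: "integrable lborel (\<lambda>t. \<bar>k t\<bar> * v (x - t))"
    have A: "Lp p (\<lambda>t. \<bar>k t\<bar> powr (1/p) * f (x - t))"
      unfolding Lp_def using i p by (auto simp: v_def powr_mult abs_mult powr_powr)
    have B: "Lp q (\<lambda>t. \<bar>k t\<bar> powr (1/q))"
      unfolding Lp_def using k_abs q by (auto simp: powr_powr)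
    have Bn: "Lp_norm q (\<lambda>t. \<bar>k t\<bar> powr (1/q)) = \<kappa> powr (1/q)"
      unfolding Lp_norm_def using q by (auto simp: powr_powr \<kappa>_def)
    have An: "Lp_norm p (\<lambda>t. \<bar>k t\<bar> powr (1/p) * f (x - t)) = (conv (\<lambda>t. \<bar>k t\<bar>) v x) powr (1/p)"
      unfolding Lp_norm_def conv_def using p by (auto simp: v_def powr_mult abs_mult powr_powr)
    have eq: "\<bar>k t\<bar> powr (1/p) * f (x - t) * \<bar>k t\<bar> powr (1/q) = \<bar>k t\<bar> * f (x - t)" for t
      using q(2) by (cases "k t = 0") (simp_all add: powr_add[symmetric])
    note H = Hoelder[OF A B p q, unfolded An Bn eq]
    have i2: "integrable lborel (\<lambda>t. k t * f (x - t))"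
      by (rule Bochner_Integration.integrable_bound[OF H(1)]) (auto simp: abs_mult)
    have "\<bar>conv k f x\<bar> \<le> (LINT t|lborel. \<bar>k t * f (x - t)\<bar>)"
      unfolding conv_def by (rule integral_abs_bound)
    also have "\<dots> \<le> conv (\<lambda>t. \<bar>k t\<bar>) v x powr (1/p) * \<kappa> powr (1/q)"
      using H(2) by (simp add: abs_mult)
    finally have "\<bar>conv k f x\<bar> powr p \<le> (conv (\<lambda>t. \<bar>k t\<bar>) v x powr (1/p) * \<kappa> powr (1/q)) powr p"
      using p by (intro powr_mono2) auto
    also have "\<dots> = \<kappa> powr (p - 1) * conv (\<lambda>t. \<bar>k t\<bar>) v x"
    proof -
      have "conv (\<lambda>t. \<bar>k t\<bar>) v x \<ge> 0" unfolding conv_def v_def by simp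
      moreover have "1 / q * p = p - 1" using p by (simp add: q_def)
      ultimately show ?thesis using p \<kappa>0 by (simp add: powr_mult powr_powr)
    qed
    finally show "integrable lborel (\<lambda>t. k t * f (x - t)) \<and>
      \<bar>conv k f x\<bar> powr p \<le> \<kappa> powr (p - 1) * conv (\<lambda>t. \<bar>k t\<bar>) v x" using i2 by simp
  qed
  show "AE x in lborel. integrable lborel (\<lambda>t. k t * f (x - t))"
    using pw by eventually_elim auto
  have i: "integrable lborel (\<lambda>x. \<bar>conv k f x\<bar> powr p)"
  proof (rule Bochner_Integration.integrable_bound)
    show "integrable lborel (\<lambda>x. \<kappa> powr (p - 1) * conv (\<lambda>t. \<bar>k t\<bar>) v x)" using L1(2) by simp
    show "AE x in lborel. norm (\<bar>conv k f x\<bar> powr p) \<le> norm (\<kappa> powr (p - 1) * conv (\<lambda>t. \<bar>k t\<bar>) v x)"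
      using pw by eventually_elim auto
  qed auto
  then show Lp: "Lp p (conv k f)" by (auto simp: Lp_def)
  have "(LINT x|lborel. \<bar>conv k f x\<bar> powr p) \<le> (LINT x|lborel. \<kappa> powr (p - 1) * conv (\<lambda>t. \<bar>k t\<bar>) v x)"
    using i L1(2) pw by (intro integral_mono_AE) auto
  also have "\<dots> = \<kappa> powr (p - 1) * (\<kappa> * (LINT x|lborel. v x))"
    using L1(3) by (simp add: \<kappa>_def)
  also have "\<dots> = (\<kappa> powr (p - 1) * \<kappa> powr 1) * Lp_norm p f powr p"
    using p \<kappa>0 by (simp add: Lp_norm_powr v_def)
  also have "\<dots> = (\<kappa> * Lp_norm p f) powr p"
    using \<kappa>0 by (simp only: powr_add[symmetric]) (simp add: powr_mult)
  finally show "Lp_norm p (conv k f) \<le> (LINT t|lborel. \<bar>k t\<bar>) * Lp_norm p f"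
    using p \<kappa>0 by (simp add: Lp_norm_le_iff \<kappa>_def)
qed

text \<open>Fubini and the translation x -> x + t. Translates have the same norm, so Hoelder bounds
  the inner integral by |k t| times the two norms for every t, and the double integral converges
  absolutely.\<close>

lemma conv_transpose:
  assumes k: "integrable lborel k" and f: "Lp p f" and g: "Lp q g" and pq: "p > 1" "q > 1" "1/p + 1/q = 1"
  shows "(LINT x|lborel. conv k f x * g x) = (LINT x|lborel. f x * conv (\<lambda>t. k (- t)) g x)"
proof -
  have [measurable]: "k \<in> borel_measurable borel" "f \<in> borel_measurable borel" "g \<in> borel_measurable borel"
    using k Lp_meas[OF f] Lp_meas[OF g] by auto
  have ft: "Lp p (\<lambda>x. f (x - t))" "Lp_norm p (\<lambda>x. f (x - t)) = Lp_norm p f" for t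
    using f lborel_integrable_shift(1)[of "\<lambda>x. \<bar>f x\<bar> powr p" t] lborel_integral_shift(1)[of "\<lambda>x. \<bar>f x\<bar> powr p" t]
    by (auto simp: Lp_def Lp_norm_def)
  have m: "(\<lambda>(t, x). k t * f (x - t) * g x) \<in> borel_measurable (lborel \<Otimes>\<^sub>M lborel)" by measurable
  have 1: "AE t in lborel. integrable lborel (\<lambda>x. k t * f (x - t) * g x)"
    using Hoelder(1)[OF ft(1) g pq] by (auto simp: mult.assoc)
  have 2: "integrable lborel (\<lambda>t. LINT x|lborel. norm (k t * f (x - t) * g x))"
  proof (rule Bochner_Integration.integrable_bound[of _ "\<lambda>t. k t * (Lp_norm p f * Lp_norm q g)"])
    show "AE t in lborel. norm (LINT x|lborel. norm (k t * f (x - t) * g x)) \<le> norm (k t * (Lp_norm p f * Lp_norm q g))"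
    proof (rule AE_I2)
      fix t
      have "(LINT x|lborel. norm (k t * f (x - t) * g x)) = \<bar>k t\<bar> * (LINT x|lborel. \<bar>f (x - t) * g x\<bar>)"
        by (subst integral_mult_right_zero[symmetric]) (simp add: abs_mult mult_ac)
      also have "\<dots> \<le> \<bar>k t\<bar> * (Lp_norm p f * Lp_norm q g)"
        using Hoelder(2)[OF ft(1) g pq, of t] ft(2) by (intro mult_left_mono) auto
      finally show "norm (LINT x|lborel. norm (k t * f (x - t) * g x)) \<le> norm (k t * (Lp_norm p f * Lp_norm q g))"
        by (simp add: abs_mult)
    qed
  qed (use k in auto)
  note F = Fubini_swap[OF m 1 2]
  have "(LINT x|lborel. conv k f x * g x) = (LINT x|lborel. LINT t|lborel. k t * f (x - t) * g x)"
    by (simp add: conv_def)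
  also have "\<dots> = (LINT t|lborel. LINT x|lborel. k t * f (x - t) * g x)" by (rule F(4))
  also have "\<dots> = (LINT t|lborel. LINT x|lborel. k t * f x * g (x + t))"
  proof (rule Bochner_Integration.integral_cong[OF refl])
    fix t show "(LINT x|lborel. k t * f (x - t) * g x) = (LINT x|lborel. k t * f x * g (x + t))"
      using lborel_integral_shift(1)[of "\<lambda>x. k t * f x * g (x + t)" t] by simp
  qed
  also have "\<dots> = (LINT x|lborel. LINT t|lborel. k t * f x * g (x + t))"
  proof (rule Fubini_swap(4)[symmetric])
    have s: "integrable lborel (\<lambda>x. norm (k t * f (x - t) * g x)) \<longleftrightarrow> integrable lborel (\<lambda>x. norm (k t * f x * g (x + t)))"
      "(LINT x|lborel. norm (k t * f (x - t) * g x)) = (LINT x|lborel. norm (k t * f x * g (x + t)))" for t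
      using lborel_integrable_shift(1)[of "\<lambda>x. norm (k t * f x * g (x + t))" t]
        lborel_integral_shift(1)[of "\<lambda>x. norm (k t * f x * g (x + t))" t] by auto
    have s2: "integrable lborel (\<lambda>x. (k t * f x * g (x + t)))" if "integrable lborel (\<lambda>x. k t * f (x - t) * g x)" for t
    proof -
      have "integrable lborel (\<lambda>x. k t * f x * g (x + t))"
        by (subst integrable_norm_iff[symmetric]) (use s(1)[of t] integrable_norm[OF that] in auto)
      then show ?thesis .
    qed
    show "AE t in lborel. integrable lborel (\<lambda>x. k t * f x * g (x + t))"
      using 1 by eventually_elim (rule s2)
    show "integrable lborel (\<lambda>t. LINT x|lborel. norm (k t * f x * g (x + t)))"
      using 2 unfolding s(2) .
  qed measurable
  also have "\<dots> = (LINT x|lborel. f x * (LINT t|lborel. k t * g (x + t)))"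
    by (subst integral_mult_right_zero[symmetric]) (simp add: mult_ac)
  also have "\<dots> = (LINT x|lborel. f x * conv (\<lambda>t. k (- t)) g x)"
  proof (rule Bochner_Integration.integral_cong[OF refl])
    fix x show "f x * (LINT t|lborel. k t * g (x + t)) = f x * conv (\<lambda>t. k (- t)) g x"
      using lborel_integral_shift(4)[of "\<lambda>t. k t * g (x + t)"] by (simp add: conv_def)
  qed
  finally show ?thesis .
qed

text \<open>Tested on g = sgn f |f|^(p-1), for which |g|^q = |f|^p. As \<open>f\<close> is already
  known to lie in L_p, the power p - 1 of its norm is finite and can be cancelled.\<close>

lemma Lp_norm_le_dual:
  assumes f: "Lp p f" and pq: "p > 1" "q > 1" "1/p + 1/q = 1" and C: "C \<ge> 0"
    and le: "\<And>g. Lp q g \<Longrightarrow> (LINT x|lborel. f x * g x) \<le> C * Lp_norm q g"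
  shows "Lp_norm p f \<le> C"
proof -
  have [measurable]: "f \<in> borel_measurable borel" using Lp_meas[OF f] .
  define g where "g x = sgn (f x) * \<bar>f x\<bar> powr (p - 1)" for x
  have qp: "(p - 1) * q = p" using pq by (simp add: field_simps)
  have gq: "\<bar>g x\<bar> powr q = \<bar>f x\<bar> powr p" for x
    by (cases "f x = 0") (auto simp: g_def abs_mult powr_powr qp abs_sgn_eq)
  have fg: "f x * g x = \<bar>f x\<bar> powr p" for x
  proof (cases "f x = 0")
    case False
    have "f x * sgn (f x) = \<bar>f x\<bar>" by (simp add: sgn_if)
    then have "f x * g x = \<bar>f x\<bar> powr 1 * \<bar>f x\<bar> powr (p - 1)"
      using False by (simp add: g_def mult.assoc[symmetric])
    also have "\<dots> = \<bar>f x\<bar> powr p" by (simp only: powr_add[symmetric]) simp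
    finally show ?thesis .
  qed (simp add: g_def)
  have g: "Lp q g" using Lp_int[OF f] unfolding Lp_def gq by (simp add: g_def[abs_def])
  have gn: "Lp_norm q g = Lp_norm p f powr (p - 1)"
  proof -
    have "Lp_norm q g = (Lp_norm p f powr p) powr (1/q)"
      using pq by (simp add: Lp_norm_powr) (simp add: Lp_norm_def gq)
    moreover have "p * (1/q) = p - 1" using qp pq by (simp add: field_simps)
    ultimately show ?thesis by (simp add: powr_powr)
  qed
  have "Lp_norm p f powr p \<le> C * Lp_norm p f powr (p - 1)"
    using le[OF g] pq by (simp add: fg gn Lp_norm_powr)
  moreover have "Lp_norm p f powr p = Lp_norm p f * Lp_norm p f powr (p - 1)"
    using powr_add[of "Lp_norm p f" 1 "p - 1"] by simp
  ultimately show ?thesis using C by (cases "Lp_norm p f = 0") auto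
qed

text \<open>A dense class closed under positive parts, unlike smooth functions, and still regular
  enough to cancel a 1/x singularity. The first property reduces the strip estimate to nonnegative
  functions, the second yields the limit of the truncations.\<close>

definition lip_compact :: "(real \<Rightarrow> real) \<Rightarrow> bool" where
  "lip_compact g \<longleftrightarrow> (\<exists>L. L-lipschitz_on UNIV g) \<and> (\<exists>R. \<forall>x. \<bar>x\<bar> > R \<longrightarrow> g x = 0)"

lemma lip_compactE:
  assumes "lip_compact g"
  obtains L R M where "L \<ge> 0" "R \<ge> 0" "M \<ge> 0" "\<And>x y. \<bar>g x - g y\<bar> \<le> L * \<bar>x - y\<bar>"
    "\<And>x. \<bar>x\<bar> > R \<Longrightarrow> g x = 0" "\<And>x. \<bar>g x\<bar> \<le> M"
proof -
  obtain L R where L: "L-lipschitz_on UNIV g" and R: "\<And>x. \<bar>x\<bar> > R \<Longrightarrow> g x = 0"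
    using assms by (auto simp: lip_compact_def)
  have L0: "L \<ge> 0" using L by (rule lipschitz_on_nonneg)
  have LL: "\<bar>g x - g y\<bar> \<le> L * \<bar>x - y\<bar>" for x y
    using lipschitz_onD[OF L, of x y] by (simp add: dist_real_def)
  define R' where "R' = max R 0"
  have M: "\<bar>g x\<bar> \<le> L * (2 * R' + 1)" for x
  proof (cases "\<bar>x\<bar> > R")
    case True then show ?thesis using R L0 by (simp add: R'_def)
  next
    case False
    \<comment> \<open>A point outside the support from which the Lipschitz bound limits
      \<open>g\<close> on the whole of [-R', R'].\<close>
    have "g (R' + 1) = 0" by (rule R) (auto simp: R'_def)
    then have "\<bar>g x\<bar> \<le> L * \<bar>x - (R' + 1)\<bar>" using LL[of x "R' + 1"] by simp
    also have "\<dots> \<le> L * (2 * R' + 1)" using L0 False by (intro mult_left_mono) (auto simp: R'_def)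
    finally show ?thesis .
  qed
  show ?thesis by (rule that[OF L0 _ _ LL _ M, of R']) (use R L0 in \<open>auto simp: R'_def\<close>)
qed

lemma lip_compactI:
  assumes "\<And>x y. \<bar>g x - g y\<bar> \<le> L * \<bar>x - y\<bar>" "\<And>x. \<bar>x\<bar> > R \<Longrightarrow> g x = 0" "L \<ge> 0"
  shows "lip_compact g"
  unfolding lip_compact_def
  by (intro conjI exI[of _ L] exI[of _ R]) (use assms in \<open>auto simp: lipschitz_on_def dist_real_def\<close>)

lemma lip_compact_continuous: "lip_compact g \<Longrightarrow> continuous_on A g"
  unfolding lip_compact_def using lipschitz_on_continuous_on continuous_on_subset by blast

lemma lip_compact_measurable [measurable_dest]: "lip_compact g \<Longrightarrow> g \<in> borel_measurable borel"
  by (intro borel_measurable_continuous_onI lip_compact_continuous)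

lemma Lp_bounded_support:
  assumes "f \<in> borel_measurable borel" "\<And>x. \<bar>f x\<bar> \<le> M" "\<And>x. \<bar>x\<bar> > R \<Longrightarrow> f x = 0" "p > 0"
  shows "Lp p f"
proof -
  have M: "M \<ge> 0" using assms(2)[of 0] by linarith
  have "integrable lborel (\<lambda>x. indicator {-R..R} x * M powr p)"
    by (intro integrable_mult_left integrable_real_indicator) (auto simp: emeasure_lborel_Icc_eq)
  then have "integrable lborel (\<lambda>x. \<bar>f x\<bar> powr p)"
  proof (rule Bochner_Integration.integrable_bound)
    show "AE x in lborel. norm (\<bar>f x\<bar> powr p) \<le> norm (indicator {- R..R} x * M powr p)"
      using assms M by (intro AE_I2) (auto simp: indicator_def intro!: powr_mono2)
  qed (use assms in auto)
  then show ?thesis using assms by (auto simp: Lp_def)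
qed

lemma lip_compact_Lp: "lip_compact g \<Longrightarrow> p > 0 \<Longrightarrow> Lp p g"
proof -
  assume g: "lip_compact g" and p: "p > 0"
  from g obtain R M where "\<And>x. \<bar>x\<bar> > R \<Longrightarrow> g x = 0" "\<And>x. \<bar>g x\<bar> \<le> M"
    by (elim lip_compactE) blast
  with lip_compact_measurable[OF g] p show "Lp p g" by (intro Lp_bounded_support)
qed

definition lip_approx :: "real \<Rightarrow> (real \<Rightarrow> real) \<Rightarrow> bool" where
  "lip_approx p f \<longleftrightarrow> Lp p f \<and> (\<forall>e>0. \<exists>g. lip_compact g \<and> Lp_norm p (\<lambda>x. f x - g x) < e)"

lemma lip_approx_add:
  assumes "lip_approx p f" "lip_approx p g" "p \<ge> 1"
  shows "lip_approx p (\<lambda>x. f x + g x)"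
  unfolding lip_approx_def
proof (intro conjI allI impI)
  have fg: "Lp p f" "Lp p g" using assms by (auto simp: lip_approx_def)
  show "Lp p (\<lambda>x. f x + g x)" using fg assms by (intro Lp_add)
  fix e :: real assume "e > 0"
  then obtain u v where u: "lip_compact u" "Lp_norm p (\<lambda>x. f x - u x) < e/2"
    and v: "lip_compact v" "Lp_norm p (\<lambda>x. g x - v x) < e/2"
    using assms unfolding lip_approx_def by (meson half_gt_zero)
  obtain L1 R1 M1 where 1: "L1 \<ge> 0" "\<And>x y. \<bar>u x - u y\<bar> \<le> L1 * \<bar>x - y\<bar>" "\<And>x. \<bar>x\<bar> > R1 \<Longrightarrow> u x = 0"
    using u(1) by (elim lip_compactE) blast
  obtain L2 R2 M2 where 2: "L2 \<ge> 0" "\<And>x y. \<bar>v x - v y\<bar> \<le> L2 * \<bar>x - y\<bar>" "\<And>x. \<bar>x\<bar> > R2 \<Longrightarrow> v x = 0"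
    using v(1) by (elim lip_compactE) blast
  have "lip_compact (\<lambda>x. u x + v x)"
  proof (rule lip_compactI[of _ "L1 + L2" "max R1 R2"])
    show "\<bar>u x + v x - (u y + v y)\<bar> \<le> (L1 + L2) * \<bar>x - y\<bar>" for x y
      using 1(2)[of x y] 2(2)[of x y] by (simp add: distrib_right)
  qed (use 1 2 in auto)
  moreover have "Lp_norm p (\<lambda>x. (f x + g x) - (u x + v x)) < e"
  proof -
    have "Lp p (\<lambda>x. f x - u x)" "Lp p (\<lambda>x. g x - v x)"
      using fg u(1) v(1) lip_compact_Lp assms(3) by (auto intro!: Lp_diff)
    from Lp_norm_add[OF this assms(3)] u v show ?thesis by (simp add: algebra_simps)
  qed
  ultimately show "\<exists>w. lip_compact w \<and> Lp_norm p (\<lambda>x. (f x + g x) - w x) < e" by blast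
qed

lemma lip_approx_scale:
  assumes "lip_approx p f" "p \<ge> 1"
  shows "lip_approx p (\<lambda>x. c * f x)"
  unfolding lip_approx_def
proof (intro conjI allI impI)
  have f: "Lp p f" using assms by (auto simp: lip_approx_def)
  show "Lp p (\<lambda>x. c * f x)" using f assms by (intro Lp_scale) auto
  fix e :: real assume "e > 0"
  then obtain u where u: "lip_compact u" "Lp_norm p (\<lambda>x. f x - u x) < e / (\<bar>c\<bar> + 1)"
    using assms unfolding lip_approx_def by (metis abs_ge_zero add_nonneg_pos divide_pos_pos zero_less_one)
  obtain L R M where 1: "L \<ge> 0" "\<And>x y. \<bar>u x - u y\<bar> \<le> L * \<bar>x - y\<bar>" "\<And>x. \<bar>x\<bar> > R \<Longrightarrow> u x = 0"
    using u(1) by (elim lip_compactE) blast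
  have "lip_compact (\<lambda>x. c * u x)"
  proof (rule lip_compactI[of _ "\<bar>c\<bar> * L" R])
    show "\<bar>c * u x - c * u y\<bar> \<le> \<bar>c\<bar> * L * \<bar>x - y\<bar>" for x y
      using mult_left_mono[OF 1(2)[of x y], of "\<bar>c\<bar>"] by (simp add: abs_mult[symmetric] right_diff_distrib mult.assoc)
  qed (use 1 in auto)
  moreover have "Lp_norm p (\<lambda>x. c * f x - c * u x) < e"
  proof -
    have "Lp p (\<lambda>x. f x - u x)" using f u(1) lip_compact_Lp assms(2) by (auto intro!: Lp_diff)
    from Lp_scale(2)[OF this, of c] have "Lp_norm p (\<lambda>x. c * f x - c * u x) = \<bar>c\<bar> * Lp_norm p (\<lambda>x. f x - u x)"
      using assms by (simp add: right_diff_distrib)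
    also have "\<dots> \<le> (\<bar>c\<bar> + 1) * Lp_norm p (\<lambda>x. f x - u x)" by (intro mult_right_mono) auto
    also have "\<dots> < e" using u(2) by (simp add: pos_less_divide_eq mult.commute)
    finally show ?thesis .
  qed
  ultimately show "\<exists>w. lip_compact w \<and> Lp_norm p (\<lambda>x. c * f x - w x) < e" by blast
qed

lemma lip_approx_limit:
  assumes F: "\<And>n::nat. lip_approx p (F n)" and f: "Lp p f" and p: "p \<ge> 1"
    and lim: "(\<lambda>n. Lp_norm p (\<lambda>x. F n x - f x)) \<longlonglongrightarrow> 0"
  shows "lip_approx p f"
  unfolding lip_approx_def
proof (intro conjI allI impI)
  fix e :: real assume e: "e > 0"
  from order_tendstoD(2)[OF lim, of "e/2"] e obtain n where n: "Lp_norm p (\<lambda>x. F n x - f x) < e/2"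
    by (auto simp: eventually_sequentially)
  obtain g where g: "lip_compact g" "Lp_norm p (\<lambda>x. F n x - g x) < e/2"
    using F[of n] e unfolding lip_approx_def by (meson half_gt_zero)
  have "Lp_norm p (\<lambda>x. f x - g x) \<le> Lp_norm p (\<lambda>x. f x - F n x) + Lp_norm p (\<lambda>x. F n x - g x)"
    using F[of n] g(1) p lip_compact_Lp f by (intro Lp_norm_triangle3) (auto simp: lip_approx_def)
  then show "\<exists>g. lip_compact g \<and> Lp_norm p (\<lambda>x. f x - g x) < e"
    using n g Lp_norm_minus_commute[of p f "F n"] by (intro exI[of _ g]) auto
qed (rule f)

text \<open>The tents 1 - (n+1) dist (x, K), cut off at 0, are Lipschitz and decrease to the
  indicator because K is closed.\<close>

lemma lip_approx_compact:
  assumes K: "compact (K :: real set)" and p: "p \<ge> 1"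
  shows "lip_approx p (indicator K)"
proof (cases "K = {}")
  case True
  have "lip_compact (\<lambda>x. 0)" by (rule lip_compactI[of _ 0 0]) auto
  moreover have "(indicator {} :: real \<Rightarrow> real) = (\<lambda>x. 0)" by auto
  ultimately show ?thesis using True by (auto simp: lip_approx_def intro!: exI[of _ "\<lambda>x. 0"])
next
  case False
  obtain R where R: "\<And>x. x \<in> K \<Longrightarrow> \<bar>x\<bar> \<le> R"
    using compact_imp_bounded[OF K] by (auto simp: bounded_iff)
  define F where "F n x = max 0 (1 - real (Suc n) * infdist x K)" for n x
  have supp: "F n x = 0" if "\<bar>x\<bar> > R + 1" for n x
  proof -
    have "1 \<le> infdist x K"
      unfolding infdist_notempty[OF False]
    proof (rule cINF_greatest[OF False])
      fix a assume "a \<in> K"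
      then show "1 \<le> dist x a" using R[of a] that unfolding dist_real_def by linarith
    qed
    then have "1 * 1 \<le> real (Suc n) * infdist x K" by (intro mult_mono) auto
    then show ?thesis by (simp add: F_def)
  qed
  have lip: "lip_compact (F n)" for n
  proof (rule lip_compactI[of _ "real (Suc n)" "R + 1"])
    fix x y
    have 1: "\<bar>F n x - F n y\<bar> \<le> \<bar>real (Suc n) * infdist x K - real (Suc n) * infdist y K\<bar>"
      unfolding F_def by linarith
    have 2: "\<dots> = real (Suc n) * \<bar>infdist x K - infdist y K\<bar>"
      by (simp add: right_diff_distrib[symmetric] abs_mult del: of_nat_Suc)
    have 3: "\<dots> \<le> real (Suc n) * \<bar>x - y\<bar>"
      using infdist_triangle_abs[of x K y] by (intro mult_left_mono) (auto simp: dist_real_def)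
    show "\<bar>F n x - F n y\<bar> \<le> real (Suc n) * \<bar>x - y\<bar>" using 1 2 3 by linarith
  qed (use supp in auto)
  have pw: "(\<lambda>n. F n x) \<longlonglongrightarrow> indicator K x" for x
  proof (cases "x \<in> K")
    case True then show ?thesis by (simp add: F_def)
  next
    case False': False
    have pos: "infdist x K > 0"
      using False' False K by (metis compact_imp_closed in_closed_iff_infdist_zero infdist_nonneg less_eq_real_def)
    obtain N where N: "1 / infdist x K < real N" using reals_Archimedean2 by blast
    have "F n x = 0" if "n \<ge> N" for n
    proof -
      have "1 / infdist x K \<le> real (Suc n)" using N that by simp
      then have "1 \<le> real (Suc n) * infdist x K" using pos by (simp add: divide_le_eq)
      then show ?thesis by (simp add: F_def)
    qed
    then have "eventually (\<lambda>n. F n x = 0) sequentially" by (auto simp: eventually_sequentially)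
    then show ?thesis using False' by (simp add: tendsto_eventually)
  qed
  define G where "G x = (indicator {-(R+1)..R+1} x :: real)" for x
  have G: "Lp p G"     unfolding G_def by (rule Lp_bounded_support[of _ 1 "R+1"]) (use p in \<open>auto simp: indicator_def\<close>)
  have [measurable]: "K \<in> sets borel" using K by (simp add: borel_compact)
  have dom: "\<bar>F n x\<bar> \<le> \<bar>G x\<bar>" for n x
  proof (cases "\<bar>x\<bar> > R + 1")
    case False
    then have "x \<in> {-(R+1)..R+1}" by auto
    then have "G x = 1" by (simp add: G_def)
    moreover have "0 \<le> real (Suc n) * infdist x K" by (intro mult_nonneg_nonneg infdist_nonneg) simp
    then have "0 \<le> F n x" "F n x \<le> 1" unfolding F_def by auto
    ultimately show ?thesis by simp
  qed (use supp in simp)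
  have i: "(indicator K :: real \<Rightarrow> real) \<in> borel_measurable borel" by simp
  have p0: "p > 0" using p by simp
  note D = Lp_dominated_convergence[OF lip_compact_measurable[OF lip] i G p0 pw dom]
  have "lip_approx p (F n)" for n
    using lip[of n] lip_compact_Lp p by (auto simp: lip_approx_def intro!: exI[of _ "F n"])
  then show ?thesis by (rule lip_approx_limit[OF _ D(1) p D(2)])
qed

text \<open>Inner regularity: closed subsets of the bounded set E are compact and exhaust it up to
  measure 1/(n+1), whose p-th root bounds the L_p distance of the indicators.\<close>

lemma lip_approx_indicator:
  assumes E: "E \<in> sets borel" "\<And>x. x \<in> E \<Longrightarrow> \<bar>x\<bar> \<le> R" and p: "p \<ge> 1"
  shows "lip_approx p (indicator E)"
proof -
  have EL: "E \<in> sets lebesgue" using E(1) by auto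
  have "\<exists>T. closed T \<and> T \<subseteq> E \<and> emeasure lebesgue (E - T) < ennreal (1 / real (Suc n))" for n
    using sets_lebesgue_inner_closed[OF EL, of "1 / real (Suc n)"] by (metis of_nat_0_less_iff zero_less_Suc zero_less_divide_1_iff)
  then obtain T where T: "\<And>n. closed (T n)" "\<And>n. T n \<subseteq> E"
    "\<And>n. emeasure lebesgue (E - T n) < ennreal (1 / real (Suc n))" by metis
  have cT: "compact (T n)" for n
    using T(1)[of n] T(2)[of n] E(2) by (auto simp: compact_eq_bounded_closed bounded_iff)
  have [measurable]: "E \<in> sets borel" "\<And>n. T n \<in> sets borel" using E T by auto
  have Ei: "Lp p (indicator E)"
    by (rule Lp_bounded_support[of _ 1 R]) (use p E(2) in \<open>auto simp: indicator_def, force\<close>)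
  have T_le: "Lp_norm p (\<lambda>x. indicator (T n) x - indicator E x) \<le> (1 / real (Suc n)) powr (1/p)" for n
  proof -
    have "\<bar>indicator (T n) x - indicator E x :: real\<bar> powr p = indicator (E - T n) x" for x
      using T(2)[of n] p by (auto simp: indicator_def)
    then have "Lp_norm p (\<lambda>x. indicator (T n) x - indicator E x) = (measure lborel (E - T n)) powr (1/p)"
      by (simp add: Lp_norm_def)
    also have "measure lborel (E - T n) \<le> 1 / real (Suc n)"
    proof -
      have "emeasure lborel (E - T n) \<le> ennreal (1 / real (Suc n))"
        using T(3)[of n] by (auto simp: emeasure_completion less_imp_le)
      then show ?thesis unfolding measure_def by (intro enn2real_leI) auto
    qed
    then have "(measure lborel (E - T n)) powr (1/p) \<le> (1 / real (Suc n)) powr (1/p)"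
      using p by (intro powr_mono2) auto
    finally show ?thesis .
  qed
  have "(\<lambda>n. (1 / real (Suc n)) powr (1/p)) \<longlonglongrightarrow> 0 powr (1/p)"
    using p LIMSEQ_inverse_real_of_nat by (intro tendsto_powr') (auto simp: inverse_eq_divide)
  then have T_lim: "(\<lambda>n. (1 / real (Suc n)) powr (1/p)) \<longlonglongrightarrow> 0" by simp
  have "(\<lambda>n. Lp_norm p (\<lambda>x. indicator (T n) x - indicator E x)) \<longlonglongrightarrow> 0"
    by (rule tendsto_sandwich[OF _ _ tendsto_const T_lim])
      (intro always_eventually allI Lp_norm_nonneg, intro always_eventually allI T_le)
  then show ?thesis
    by (intro lip_approx_limit[OF lip_approx_compact[OF cT p] Ei p])
qed

text \<open>Reduction to indicators: truncation to [-R, R], then simple functions dominated by twice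
  the truncated function, then their level sets.\<close>

lemma lip_approx_Lp:
  assumes f: "Lp p f" and p: "p \<ge> 1"
  shows "lip_approx p f"
proof -
  have [measurable]: "f \<in> borel_measurable borel" using Lp_meas[OF f] .
  have zero: "lip_approx p (\<lambda>x. 0)"
  proof -
    have "lip_compact (\<lambda>x. 0)" by (rule lip_compactI[of _ 0 0]) auto
    then show ?thesis by (auto simp: lip_approx_def intro!: exI[of _ "\<lambda>x. 0"])
  qed
  have sum: "lip_approx p (\<lambda>x. \<Sum>i\<in>I. h i x)" if "finite I" "\<And>i. i \<in> I \<Longrightarrow> lip_approx p (h i)" for I :: "real set" and h
    using that by (induction I) (auto intro!: zero lip_approx_add p)
  have trunc: "lip_approx p (\<lambda>x. indicator {-R..R} x * f x)" for R :: real
  proof -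
    define u where "u x = indicator {-R..R} x * f x" for x
    have [measurable]: "u \<in> borel_measurable borel" unfolding u_def by measurable
    obtain s where s: "\<And>i. simple_function lborel (s i)" "\<And>x. (\<lambda>i. s i x) \<longlonglongrightarrow> u x"
      "\<And>i x. \<bar>s i x\<bar> \<le> 2 * \<bar>u x\<bar>"
      using borel_measurable_implies_sequence_metric[of u lborel 0] by (auto simp: dist_real_def)
    have [measurable]: "s i \<in> borel_measurable borel" for i
      using borel_measurable_simple_function[OF s(1)[of i]] by simp
    have u: "Lp p u" by (rule Lp_bound[OF f]) (use p in \<open>auto simp: u_def indicator_def\<close>)
    have s': "lip_approx p (s i)" for i
    proof -
      have fin: "finite (range (s i))" using simple_functionD(1)[OF s(1)[of i]] by simp
      have eq: "s i = (\<lambda>x. \<Sum>y\<in>range (s i). y * indicator (s i -` {y}) x)"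
      proof
        fix x
        have "(\<Sum>y\<in>range (s i). y * indicator (s i -` {y}) x) = (\<Sum>y\<in>range (s i). if y = s i x then y else 0)"
          by (intro sum.cong) (auto simp: indicator_def)
        then show "s i x = (\<Sum>y\<in>range (s i). y * indicator (s i -` {y}) x)"
          using fin by (simp add: sum.delta)
      qed
      have "lip_approx p (\<lambda>x. y * indicator (s i -` {y}) x)" for y
      proof (cases "y = 0")
        case False
        \<comment> \<open>Level sets of nonzero values are bounded: \<open>s i\<close> vanishes
          wherever \<open>u\<close> does, by the bound |s i| \<le> 2 |u|.\<close>
        have "\<bar>x\<bar> \<le> R" if "x \<in> s i -` {y}" for x
        proof (rule ccontr)
          assume "\<not> \<bar>x\<bar> \<le> R"
          then have "u x = 0" by (auto simp: u_def indicator_def)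
          then show False using s(3)[of i x] that False by auto
        qed
        moreover have "s i -` {y} \<in> sets borel" using measurable_sets_borel[of "s i" borel "{y}"] by simp
        ultimately show ?thesis using p by (intro lip_approx_scale lip_approx_indicator) auto
      qed (use zero in simp)
      then show ?thesis by (subst eq) (intro sum fin)
    qed
    have 2: "Lp p (\<lambda>x. 2 * u x)" using Lp_scale(1)[OF u] p by auto
    note D = Lp_dominated_convergence(2)[of s u, OF _ _ 2 _ s(2)]
    show ?thesis unfolding u_def[symmetric]
      by (rule lip_approx_limit[OF s' u p]) (use D s(3) p in \<open>auto simp: abs_mult\<close>)
  qed
  have pw: "(\<lambda>n. indicator {-real n..real n} x * f x) \<longlonglongrightarrow> f x" for x
  proof (rule tendsto_eventually)
    obtain N :: nat where "\<bar>x\<bar> \<le> real N" using real_arch_simple by blast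
    then show "\<forall>\<^sub>F n in sequentially. indicator {-real n..real n} x * f x = f x"
      unfolding eventually_sequentially by (intro exI[of _ N]) (auto simp: indicator_def)
  qed
  have "(\<lambda>n. Lp_norm p (\<lambda>x. indicator {-real n..real n} x * f x - f x)) \<longlonglongrightarrow> 0"
    by (rule Lp_dominated_convergence(2)[OF _ _ f _ pw]) (use p in \<open>auto simp: indicator_def\<close>)
  then show ?thesis by (rule lip_approx_limit[OF trunc f p])
qed

section \<open>The Riesz inequality in a strip\<close>

lemma integrable_exp_abs:
  fixes a :: real
  assumes "a > 0"
  shows "integrable lborel (\<lambda>x. exp (- (a * \<bar>x\<bar>)))"
proof -
  have "(\<lambda>x. exp (- a * x)) absolutely_integrable_on {0..}"
    using integrable_on_exp_minus_to_infinity[OF assms, of 0]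
    by (intro nonnegative_absolutely_integrable_1) auto
  then have 1: "integrable lborel (\<lambda>x. indicator {0..} x * exp (- a * x))"
    unfolding set_integrable_def by (subst (asm) integrable_completion) auto
  then have 2: "integrable lborel (\<lambda>x. indicator {0..} (- x) * exp (- a * (- x)))"
    using lborel_integrable_shift(4)[of "\<lambda>x. indicator {0..} x * exp (- a * x)"] by simp
  have "integrable lborel (\<lambda>x. indicator {0..} x * exp (- a * x) + indicator {0..} (- x) * exp (- a * (- x)))"
    using 1 2 by (rule Bochner_Integration.integrable_add)
  then show ?thesis
    by (rule Bochner_Integration.integrable_bound) (auto simp: indicator_def)
qed

section \<open>The kernel i/sinh in the strip 0 < Im z < \<pi>\<close>

lemma sinh_Complex: "sinh (Complex x y) = Complex (sinh x * cos y) (cosh x * sin y)"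
  by (simp add: complex_eq_iff sinh_def cosh_def Re_exp Im_exp algebra_simps add_divide_distrib diff_divide_distrib)

lemma sinh_sin_norm: "(sinh x * cos y)\<^sup>2 + (cosh x * sin y)\<^sup>2 = (sinh x)\<^sup>2 + (sin y)\<^sup>2" for x y :: real
  by (simp add: power_mult_distrib cosh_square_eq cos_squared_eq algebra_simps)

text \<open>Real part of \<open>\<i> / sinh z\<close> on the line Im z = y, see
  \<open>csch_Complex\<close>. For y in (0, \<pi>) it is positive, with mass \<pi> for every
  y.\<close>

definition poisson_ker :: "real \<Rightarrow> real \<Rightarrow> real" where
  "poisson_ker y x = cosh x * sin y / ((sinh x)\<^sup>2 + (sin y)\<^sup>2)"

text \<open>Imaginary part of \<open>\<i> / sinh z\<close> on the line Im z = y. It is odd, vanishes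
  for y = \<pi>/2 and tends to 1 / sinh x as y tends to 0, so small y regularise the singular
  kernel.\<close>

definition conj_ker :: "real \<Rightarrow> real \<Rightarrow> real" where
  "conj_ker y x = sinh x * cos y / ((sinh x)\<^sup>2 + (sin y)\<^sup>2)"

lemma csch_Complex: "\<i> / sinh (Complex x y) = Complex (poisson_ker y x) (conj_ker y x)"
proof -
  have s: "sinh (Complex x y) = Complex (sinh x * cos y) (cosh x * sin y)"
    by (rule sinh_Complex)
  have n: "(sinh x * cos y)\<^sup>2 + (cosh x * sin y)\<^sup>2 = (sinh x)\<^sup>2 + (sin y)\<^sup>2"
    by (rule sinh_sin_norm)
  show ?thesis unfolding s
    by (simp add: complex_eq_iff Re_divide Im_divide n poisson_ker_def conj_ker_def)
qed

text \<open>The right side is |sinh (x + i y)|^2, so this yields both the absence of zeros of sinh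
  in the open strip and the exponential decay of the kernels. It comes from exp |x| / 2 \<le> cosh
  x.\<close>

lemma sinh_sin_lower:
  assumes "0 < y" "y < pi"
  shows "(sin y / 2 * exp \<bar>x\<bar>)\<^sup>2 \<le> (sinh x)\<^sup>2 + (sin y)\<^sup>2"
proof -
  have "exp \<bar>x\<bar> / 2 \<le> cosh x" by (cases "x \<ge> 0") (auto simp: cosh_def)
  then have "(exp \<bar>x\<bar> / 2)\<^sup>2 \<le> (cosh x)\<^sup>2" by (intro power_mono) auto
  then have "(sin y)\<^sup>2 * (exp \<bar>x\<bar> / 2)\<^sup>2 \<le> (sin y)\<^sup>2 * (cosh x)\<^sup>2" by (intro mult_left_mono) auto
  also have "\<dots> = (sin y)\<^sup>2 * (sinh x)\<^sup>2 + (sin y)\<^sup>2" by (simp add: cosh_square_eq algebra_simps)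
  also have "\<dots> \<le> 1 * (sinh x)\<^sup>2 + (sin y)\<^sup>2"
    using abs_sin_le_one[of y] by (intro add_mono mult_right_mono) (auto simp: abs_square_le_1)
  finally show ?thesis by (simp add: power_mult_distrib power_divide)
qed

lemma csch_norm_le:
  assumes "0 < y" "y < pi"
  shows "cmod (\<i> / sinh (Complex x y)) \<le> 2 / sin y * exp (- \<bar>x\<bar>)"
proof -
  have sy: "sin y > 0" using assms by (intro sin_gt_zero)
  have n: "(cmod (sinh (Complex x y)))\<^sup>2 = (sinh x)\<^sup>2 + (sin y)\<^sup>2"
    by (simp add: sinh_Complex cmod_power2 sinh_sin_norm)
  have "sin y / 2 * exp \<bar>x\<bar> \<le> cmod (sinh (Complex x y))"
    using sinh_sin_lower[OF assms, of x] sy by (intro power2_le_imp_le[OF _ norm_ge_zero]) (simp add: n)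
  then have "1 / cmod (sinh (Complex x y)) \<le> 1 / (sin y / 2 * exp \<bar>x\<bar>)"
    using sy by (intro frac_le) auto
  then show ?thesis by (simp add: norm_divide exp_minus field_simps)
qed

lemma strip_ker_bounds:
  assumes "0 < y" "y < pi"
  shows "poisson_ker y x > 0" "\<bar>poisson_ker y x\<bar> \<le> 2 / sin y * exp (- \<bar>x\<bar>)" "\<bar>conj_ker y x\<bar> \<le> 2 / sin y * exp (- \<bar>x\<bar>)"
proof -
  have sy: "sin y > 0" using assms by (intro sin_gt_zero)
  show "poisson_ker y x > 0" unfolding poisson_ker_def using sy
    by (intro divide_pos_pos mult_pos_pos add_nonneg_pos) auto
  show "\<bar>poisson_ker y x\<bar> \<le> 2 / sin y * exp (- \<bar>x\<bar>)" "\<bar>conj_ker y x\<bar> \<le> 2 / sin y * exp (- \<bar>x\<bar>)"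
    using csch_norm_le[OF assms, of x] abs_Re_le_cmod[of "\<i> / sinh (Complex x y)"]
      abs_Im_le_cmod[of "\<i> / sinh (Complex x y)"]
    unfolding csch_Complex by auto
qed

lemma strip_ker_measurable [measurable]: "poisson_ker y \<in> borel_measurable borel" "conj_ker y \<in> borel_measurable borel"
proof -
  have [measurable]: "(sinh :: real \<Rightarrow> real) \<in> borel_measurable borel" "(cosh :: real \<Rightarrow> real) \<in> borel_measurable borel"
    by (auto intro!: borel_measurable_continuous_onI continuous_intros)
  show "poisson_ker y \<in> borel_measurable borel" "conj_ker y \<in> borel_measurable borel"
    unfolding poisson_ker_def[abs_def] conj_ker_def[abs_def] by measurable
qed

lemma strip_ker_integrable:
  assumes "0 < y" "y < pi"
  shows "integrable lborel (poisson_ker y)" "integrable lborel (conj_ker y)"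
proof -
  have i: "integrable lborel (\<lambda>x. 2 / sin y * exp (- \<bar>x\<bar>))"
    using integrable_exp_abs[of 1] by (intro integrable_mult_right) simp
  show "integrable lborel (poisson_ker y)" "integrable lborel (conj_ker y)"
    by (rule Bochner_Integration.integrable_bound[OF i], simp, rule AE_I2, unfold real_norm_def,
        rule order_trans[OF strip_ker_bounds(2)[OF assms] abs_ge_self])
      (rule Bochner_Integration.integrable_bound[OF i], simp, rule AE_I2, unfold real_norm_def,
        rule order_trans[OF strip_ker_bounds(3)[OF assms] abs_ge_self])
qed

lemma poisson_ker_integral:
  assumes "0 < y" "y < pi"
  shows "(LINT x|lborel. poisson_ker y x) = pi"
proof -
  have sy: "sin y > 0" using assms by (intro sin_gt_zero)
  \<comment> \<open>A primitive of \<open>poisson_ker y\<close>, rising from -\<pi>/2 to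
    \<pi>/2.\<close>
  define F where "F x = arctan (sinh x / sin y)" for x :: real
  have D: "DERIV F x :> poisson_ker y x" for x
  proof -
    have "DERIV F x :> cosh x / sin y * inverse (1 + (sinh x / sin y)\<^sup>2)"
      unfolding F_def using sy by (auto intro!: derivative_eq_intros)
    moreover have "cosh x / sin y * inverse (1 + (sinh x / sin y)\<^sup>2) = poisson_ker y x"
    proof -
      have "1 + (sinh x / sin y)\<^sup>2 = ((sinh x)\<^sup>2 + (sin y)\<^sup>2) / (sin y)\<^sup>2"
        using sy by (simp add: power_divide field_simps)
      then show ?thesis using sy by (simp add: poisson_ker_def power2_eq_square)
    qed
    ultimately show ?thesis by simp
  qed
  have c: "isCont (poisson_ker y) x" for x
  proof -
    have "(sinh x)\<^sup>2 + (sin y)\<^sup>2 > 0" using sy by (intro add_nonneg_pos) auto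
    then show ?thesis unfolding poisson_ker_def[abs_def] by (intro continuous_intros) auto
  qed
  have t: "(F \<longlongrightarrow> pi/2) at_top" unfolding F_def
    by (rule filterlim_compose[OF tendsto_arctan_at_top])
      (use sy filterlim_at_top_mult_tendsto_pos[OF tendsto_const[of "1 / sin y"] _ sinh_real_at_top] in simp)
  have t': "(F \<longlongrightarrow> -(pi/2)) at_bot"
  proof -
    have "F (- x) = - F x" for x by (simp add: F_def arctan_minus)
    then have "((\<lambda>x. F (- x)) \<longlongrightarrow> -(pi/2)) at_top" using tendsto_minus[OF t] by simp
    then show ?thesis by (simp add: filterlim_at_bot_mirror)
  qed
  have I: "(LBINT x=-\<infinity>..\<infinity>. poisson_ker y x) = pi/2 - -(pi/2)"
  proof (rule interval_integral_FTC_nonneg(2))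
    show "AE x in lborel. - \<infinity> < ereal x \<longrightarrow> ereal x < \<infinity> \<longrightarrow> 0 \<le> poisson_ker y x"
      using strip_ker_bounds(1)[OF assms] by (auto intro!: AE_I2 less_imp_le)
    show "((F \<circ> real_of_ereal) \<longlongrightarrow> - (pi / 2)) (at_right (-\<infinity>))"
      using t' by (simp add: ereal_tendsto_simps)
    show "((F \<circ> real_of_ereal) \<longlongrightarrow> pi / 2) (at_left \<infinity>)"
      using t by (simp add: ereal_tendsto_simps)
  qed (use D c in auto)
  then show ?thesis
    by (simp add: interval_lebesgue_integral_def set_lebesgue_integral_def)
qed

text \<open>Write z = r exp (i t) with |t| < \<pi>/2. For |t| near \<pi>/2 the angle p |t| lies
  beyond \<pi>/2, so Re z^p is at most -c0 r^p and pays for |Im z|^p; for the other t, Re z is at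
  least c1 r. The bound p \<le> 2 keeps p |t| \<le> \<pi>, where the cosine is decreasing.\<close>

lemma Riesz_pointwise:
  fixes p :: real
  assumes p: "1 < p" "p \<le> 2"
  obtains A B where "A \<ge> 0" "B \<ge> 0"
    "\<And>z. Re z > 0 \<Longrightarrow> \<bar>Im z\<bar> powr p \<le> A * Re z powr p - B * Re (z powr of_real p)"
proof -
  \<comment> \<open>The midpoint of \<pi>/(2p) and \<pi>/2: far enough from the imaginary axis for
    c1 > 0, close enough to it for cos (p t0) < 0.\<close>
  define t0 where "t0 = (pi / (2 * p) + pi / 2) / 2"
  have "pi / (2 * p) < pi / 2" using p by (intro divide_strict_left_mono) auto
  then have t0: "0 < t0" "t0 < pi / 2" using p by (auto simp: t0_def add_pos_pos)
  have pt0: "p * t0 = (pi / 2 + p * (pi / 2)) / 2" using p by (simp add: t0_def field_simps)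
  have pt1: "p * t0 > pi / 2" unfolding pt0 using p by (simp add: field_simps)
  have "p * t0 \<le> 2 * (pi / 2)" using p t0 by (intro mult_mono) auto
  then have pt2: "p * t0 \<le> pi" by simp
  define c0 where "c0 = - cos (p * t0)"
  have "cos (p * t0) < cos (pi / 2)" using pt1 pt2 by (intro cos_monotone_0_pi) auto
  then have c0: "c0 > 0" by (simp add: c0_def)
  define c1 where "c1 = cos t0"
  have c1: "c1 > 0" unfolding c1_def using t0 by (intro cos_gt_zero) auto
  define B where "B = 1 / c0"
  \<comment> \<open>The summand B compensates B Re z^p, which may be positive in the region |t| <
    t0.\<close>
  define A where "A = (1 + B) / c1 powr p"
  have B0: "B \<ge> 0" using c0 by (simp add: B_def)
  have A0: "A \<ge> 0" using B0 c1 by (simp add: A_def)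
  show ?thesis
  proof (rule that[OF A0 B0])
    fix z :: complex assume z: "Re z > 0"
    define r t where "r = cmod z" and "t = Im (Ln z)"
    have r: "r > 0" using z by (auto simp: r_def)
    have z0: "z \<noteq> 0" using z by auto
    have t: "\<bar>t\<bar> < pi / 2" unfolding t_def using Re_Ln_pos_lt[OF z0] z by auto
    have zexp: "z = exp (Ln z)" using z0 by simp
    have Rez: "Re z = r * cos t"
      by (subst zexp, subst Re_exp) (use z0 in \<open>simp add: r_def t_def\<close>)
    have pw: "Re (z powr of_real p) = r powr p * cos (p * t)"
      using z0 r by (simp add: powr_def Re_exp r_def t_def)
    have im: "\<bar>Im z\<bar> powr p \<le> r powr p" using abs_Im_le_cmod[of z] p by (intro powr_mono2) (auto simp: r_def)
    have cos_abs: "cos (p * t) = cos (p * \<bar>t\<bar>)" by (cases "t \<ge> 0") auto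
    show "\<bar>Im z\<bar> powr p \<le> A * Re z powr p - B * Re (z powr of_real p)"
    proof (cases "\<bar>t\<bar> \<ge> t0")
      case True
      have "p * \<bar>t\<bar> \<le> 2 * (pi / 2)" using p t by (intro mult_mono) auto
      then have "cos (p * \<bar>t\<bar>) \<le> cos (p * t0)"
        using True p t0 by (intro cos_monotone_0_pi_le) auto
      then have "c0 \<le> - cos (p * t)" unfolding cos_abs c0_def by simp
      then have "r powr p * 1 \<le> r powr p * (B * - cos (p * t))"
        using c0 by (intro mult_left_mono) (auto simp: B_def field_simps)
      also have "\<dots> = - (B * Re (z powr of_real p))" by (simp add: pw)
      finally have "r powr p \<le> - (B * Re (z powr of_real p))" by simp
      moreover have "0 \<le> A * Re z powr p" using A0 by simp
      ultimately show ?thesis using im by linarith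
    next
      case False
      have "c1 \<le> cos \<bar>t\<bar>" unfolding c1_def using False t0 by (intro cos_monotone_0_pi_le) auto
      then have "c1 \<le> cos t" by (cases "t \<ge> 0") auto
      then have "A * (r * c1) powr p \<le> A * Re z powr p"
        unfolding Rez using A0 c1 r p by (intro mult_left_mono powr_mono2) auto
      moreover have "A * (r * c1) powr p = (1 + B) * r powr p"
        using c1 r by (simp add: A_def powr_mult)
      moreover have "B * Re (z powr of_real p) \<le> B * r powr p"
        unfolding pw using B0 mult_left_le[OF cos_le_one[of "p * t"], of "r powr p"] by (intro mult_left_mono) auto
      ultimately show ?thesis using im by (simp add: distrib_right)
    qed
  qed
qed

text \<open>Compact support turns the integral into one over [-R, R], where differentiation under
  the integral sign is allowed because sinh has no zeros in the open strip.\<close>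

lemma csch_integral_holomorphic:
  assumes \<psi>: "lip_compact \<psi>"
  shows "(\<lambda>z. LINT t|lborel. of_real (\<psi> t) * (\<i> / sinh (z - of_real t))) holomorphic_on {z. 0 < Im z \<and> Im z < pi}"
proof -
  obtain R where R: "\<And>x. \<bar>x\<bar> > R \<Longrightarrow> \<psi> x = 0" using \<psi> by (elim lip_compactE) blast
  define S where "S = {z. 0 < Im z \<and> Im z < pi}"
  have nz: "sinh (z - of_real t) \<noteq> 0" if "z \<in> S" for z t
  proof -
    have "sin (Im z) > 0" using that by (intro sin_gt_zero) (auto simp: S_def)
    then have "0 < (sin (Im z) / 2 * exp \<bar>Re z - t\<bar>)\<^sup>2" by simp
    also have "\<dots> \<le> (sinh (Re z - t))\<^sup>2 + (sin (Im z))\<^sup>2"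
      using that by (intro sinh_sin_lower) (auto simp: S_def)
    also have "\<dots> = (cmod (sinh (Complex (Re z - t) (Im z))))\<^sup>2"
      by (simp add: sinh_Complex cmod_power2 sinh_sin_norm)
    also have "Complex (Re z - t) (Im z) = z - of_real t" by (simp add: complex_eq_iff)
    finally show ?thesis by auto
  qed
  have c\<psi>: "continuous_on A \<psi>" for A using \<psi> by (rule lip_compact_continuous)
  have cont: "continuous_on {-R..R} (\<lambda>t. of_real (\<psi> t) * (\<i> / sinh (z - of_real t)))" if "z \<in> S" for z
    using nz[OF that] by (intro continuous_intros c\<psi>) auto
  have eq: "(LINT t|lborel. of_real (\<psi> t) * (\<i> / sinh (z - of_real t)))
      = integral (cbox (-R) R) (\<lambda>t. of_real (\<psi> t) * (\<i> / sinh (z - of_real t)))" if "z \<in> S" for z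
  proof -
    have "(LINT t|lborel. of_real (\<psi> t) * (\<i> / sinh (z - of_real t)))
       = (LINT t:{-R..R}|lborel. of_real (\<psi> t) * (\<i> / sinh (z - of_real t)))"
      unfolding set_lebesgue_integral_def
      by (rule Bochner_Integration.integral_cong[OF refl]) (use R in \<open>force simp: indicator_def\<close>)
    also have "\<dots> = integral {-R..R} (\<lambda>t. of_real (\<psi> t) * (\<i> / sinh (z - of_real t)))"
      using cont[OF that] by (intro set_borel_integral_eq_integral(2) borel_integrable_atLeastAtMost')
    finally show ?thesis by simp
  qed
  have "(\<lambda>z. integral (cbox (-R) R) (\<lambda>t. of_real (\<psi> t) * (\<i> / sinh (z - of_real t)))) holomorphic_on S"
  proof (rule leibniz_rule_holomorphic)
    fix z and t :: real assume z: "z \<in> S"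
    show "((\<lambda>z. of_real (\<psi> t) * (\<i> / sinh (z - of_real t))) has_field_derivative
        of_real (\<psi> t) * (- (\<i> * cosh (z - of_real t)) / (sinh (z - of_real t))\<^sup>2)) (at z within S)"
      using nz[OF z, of t] by (auto intro!: derivative_eq_intros simp: power2_eq_square divide_simps)
  next
    fix z assume "z \<in> S"
    then show "(\<lambda>t. of_real (\<psi> t) * (\<i> / sinh (z - of_real t))) integrable_on cbox (-R) R"
      using cont by (intro integrable_continuous) auto
  next
    have 1: "continuous_on (S \<times> cbox (-R) R) (\<lambda>x. \<psi> (snd x))"
      by (rule continuous_on_compose2[OF c\<psi>[of UNIV]]) (auto intro!: continuous_intros)
    have 2: "continuous_on (S \<times> cbox (-R) R) (\<lambda>x. sinh (fst x - complex_of_real (snd x)))"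
      by (intro continuous_intros)
    have 3: "continuous_on (S \<times> cbox (-R) R) (\<lambda>x. cosh (fst x - complex_of_real (snd x)))"
      by (intro continuous_intros)
    show "continuous_on (S \<times> cbox (-R) R) (\<lambda>(z, t). of_real (\<psi> t) * (- (\<i> * cosh (z - of_real t)) / (sinh (z - of_real t))\<^sup>2))"
      unfolding case_prod_beta
      using nz by (intro continuous_intros 1 2 3) auto
  next
    have "S = {z. Im z > 0} \<inter> {z. Im z < pi}" by (auto simp: S_def)
    then show "convex S" by (simp add: convex_halfspace_Im_gt convex_halfspace_Im_lt convex_Int)
  qed
  then show ?thesis unfolding S_def[symmetric]
    by (rule holomorphic_transform) (rule eq[symmetric])
qed

text \<open>Cauchy's theorem for long rectangles, phrased through a primitive P on the convex strip:
  the integrals over [-n, n] are differences of values of P, and at abscissa x the values of P on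
  the two lines differ by at most a multiple of exp (- a |x|).\<close>

lemma contour_shift:
  assumes hol: "W holomorphic_on {z. 0 < Im z \<and> Im z < pi}" and y: "0 < y1" "y1 \<le> y2" "y2 < pi" and a: "a > 0"
    and le: "\<And>x y. y1 \<le> y \<Longrightarrow> y \<le> y2 \<Longrightarrow> cmod (W (Complex x y)) \<le> D * exp (- (a * \<bar>x\<bar>))"
  shows "(LINT x|lborel. W (Complex x y1)) = (LINT x|lborel. W (Complex x y2))"
proof -
  define S where "S = {z. 0 < Im z \<and> Im z < pi}"
  have S: "S = {z. Im z > 0} \<inter> {z. Im z < pi}" by (auto simp: S_def)
  have cS: "convex S" unfolding S by (simp add: convex_halfspace_Im_gt convex_halfspace_Im_lt convex_Int)
  have oS: "open S" unfolding S by (simp add: open_halfspace_Im_gt open_halfspace_Im_lt open_Int)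
  have D0: "D \<ge> 0" using order_trans[OF norm_ge_zero le[of y1 0]] y by simp
  obtain P where P: "\<And>z. z \<in> S \<Longrightarrow> (P has_field_derivative W z) (at z within S)"
    using holomorphic_convex_primitive'[OF cS oS] hol S_def by blast
  have inS: "Complex x y \<in> S" if "y1 \<le> y" "y \<le> y2" for x y
    using that assms by (auto simp: S_def)
  have contW: "continuous_on S W" using hol S_def holomorphic_on_imp_continuous_on by blast
  have cC: "continuous_on A (\<lambda>x. Complex x y)" for A y
    unfolding Complex_eq by (intro continuous_intros)
  have cont: "continuous_on A (\<lambda>x. W (Complex x y))" if "y1 \<le> y" "y \<le> y2" for y A
    by (rule continuous_on_compose2[OF contW cC]) (use inS that in auto)
  have hint: "((\<lambda>x. W (Complex x y)) has_integral (P (Complex (real n) y) - P (Complex (- real n) y))) {- real n..real n}"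
    if "y1 \<le> y" "y \<le> y2" for y and n :: nat
  proof (rule fundamental_theorem_of_calculus)
    fix x
    have "((\<lambda>x. Complex x y) has_vector_derivative 1) (at x within {- real n..real n})"
      unfolding Complex_eq by (auto intro!: derivative_eq_intros)
    moreover have "(P has_field_derivative W (Complex x y)) (at (Complex x y) within (\<lambda>x. Complex x y) ` {- real n..real n})"
      by (rule DERIV_subset[OF P]) (use inS that in auto)
    ultimately show "((\<lambda>x. P (Complex x y)) has_vector_derivative W (Complex x y)) (at x within {- real n..real n})"
      using field_vector_diff_chain_within[of "\<lambda>x. Complex x y" 1 x "{- real n..real n}" P "W (Complex x y)"]
      by (simp add: o_def)
  qed auto
  have expi: "integrable lborel (\<lambda>x. D * exp (- (a * \<bar>x\<bar>)))" using integrable_exp_abs[OF a] by simp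
  have lim: "(\<lambda>n. P (Complex (real n) y) - P (Complex (- real n) y)) \<longlonglongrightarrow> (LINT x|lborel. W (Complex x y))"
    if y': "y1 \<le> y" "y \<le> y2" for y
  proof -
    have meas: "(\<lambda>x. W (Complex x y)) \<in> borel_measurable borel"
      by (rule borel_measurable_continuous_onI[OF cont[OF y']])
    have "(\<lambda>n. LINT x|lborel. indicator {- real n..real n} x *\<^sub>R W (Complex x y)) \<longlonglongrightarrow> (LINT x|lborel. W (Complex x y))"
    proof (rule integral_dominated_convergence[OF _ _ expi])
      show "AE x in lborel. (\<lambda>n. indicator {- real n..real n} x *\<^sub>R W (Complex x y)) \<longlonglongrightarrow> W (Complex x y)"
      proof (intro AE_I2 tendsto_eventually)
        fix x :: real
        obtain N :: nat where "\<bar>x\<bar> \<le> real N" using real_arch_simple by blast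
        then show "\<forall>\<^sub>F n in sequentially. indicator {- real n..real n} x *\<^sub>R W (Complex x y) = W (Complex x y)"
          unfolding eventually_sequentially by (intro exI[of _ N]) (auto simp: indicator_def)
      qed
      show "AE x in lborel. norm (indicator {- real n..real n} x *\<^sub>R W (Complex x y)) \<le> D * exp (- (a * \<bar>x\<bar>))" for n
        using le[OF y'] D0 by (intro AE_I2) (auto simp: indicator_def)
    qed (use meas in measurable)
    moreover have "(LINT x|lborel. indicator {- real n..real n} x *\<^sub>R W (Complex x y)) = P (Complex (real n) y) - P (Complex (- real n) y)" for n
    proof -
      have "(LINT x:{- real n..real n}|lborel. W (Complex x y)) = integral {- real n..real n} (\<lambda>x. W (Complex x y))"
        by (intro set_borel_integral_eq_integral(2) borel_integrable_atLeastAtMost' cont y')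
      then show ?thesis using integral_unique[OF hint[OF y', of n]] by (simp add: set_lebesgue_integral_def)
    qed
    ultimately show ?thesis by simp
  qed
  have vert: "cmod (P (Complex x y1) - P (Complex x y2)) \<le> D * exp (- (a * \<bar>x\<bar>)) * \<bar>y2 - y1\<bar>" for x
  proof -
    have seg: "w \<in> S \<and> cmod (W w) \<le> D * exp (- (a * \<bar>x\<bar>))" if w: "w \<in> closed_segment (Complex x y1) (Complex x y2)" for w
    proof -
      obtain u where u: "0 \<le> u" "u \<le> 1" "w = (1 - u) *\<^sub>R Complex x y1 + u *\<^sub>R Complex x y2"
        using iffD1[OF in_segment(1) w] by blast
      have w': "w = Complex x ((1 - u) * y1 + u * y2)"
        unfolding u(3) by (simp add: complex_eq_iff algebra_simps)
      have "(1 - u) * y1 + u * y2 = y1 + u * (y2 - y1)" by (simp add: algebra_simps)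
      moreover have "0 \<le> u * (y2 - y1)" "u * (y2 - y1) \<le> 1 * (y2 - y1)"
        using u y by (intro mult_nonneg_nonneg mult_right_mono; simp)+
      ultimately have "y1 \<le> (1 - u) * y1 + u * y2" "(1 - u) * y1 + u * y2 \<le> y2" by auto
      then show ?thesis unfolding w' using inS le by auto
    qed
    have "cmod (P (Complex x y1) - P (Complex x y2)) \<le> D * exp (- (a * \<bar>x\<bar>)) * cmod (Complex x y1 - Complex x y2)"
    proof (rule field_differentiable_bound[OF convex_closed_segment])
      fix w assume w: "w \<in> closed_segment (Complex x y1) (Complex x y2)"
      show "(P has_field_derivative W w) (at w within closed_segment (Complex x y1) (Complex x y2))"
        by (rule DERIV_subset[OF P]) (use seg w in auto)
      show "cmod (W w) \<le> D * exp (- (a * \<bar>x\<bar>))" using seg w by auto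
    qed auto
    also have "cmod (Complex x y1 - Complex x y2) = \<bar>y2 - y1\<bar>" by (simp add: cmod_def)
    finally show ?thesis .
  qed
  have small: "(\<lambda>n. P (Complex (s * real n) y1) - P (Complex (s * real n) y2)) \<longlonglongrightarrow> 0" if s: "\<bar>s\<bar> = 1" for s
  proof (rule Lim_null_comparison)
    show "\<forall>\<^sub>F n in sequentially. norm (P (Complex (s * real n) y1) - P (Complex (s * real n) y2)) \<le> D * exp (- (a * real n)) * \<bar>y2 - y1\<bar>"
      using vert[of "s * real _"] s by (intro always_eventually allI) (simp add: abs_mult)
    have "(\<lambda>n. exp (- (a * real n))) \<longlonglongrightarrow> 0" using a
      by (intro filterlim_compose[OF exp_at_bot] filterlim_compose[OF filterlim_uminus_at_bot_at_top]
          filterlim_tendsto_pos_mult_at_top[OF tendsto_const] filterlim_real_sequentially)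
    then have "(\<lambda>n. D * exp (- (a * real n)) * \<bar>y2 - y1\<bar>) \<longlonglongrightarrow> D * 0 * \<bar>y2 - y1\<bar>"
      by (intro tendsto_intros)
    then show "(\<lambda>n. D * exp (- (a * real n)) * \<bar>y2 - y1\<bar>) \<longlonglongrightarrow> 0" by simp
  qed
  have "(\<lambda>n. (P (Complex (real n) y1) - P (Complex (- real n) y1)) - (P (Complex (real n) y2) - P (Complex (- real n) y2))) \<longlonglongrightarrow> 0 - 0"
    using tendsto_diff[OF small[of 1] small[of "-1"]] by (simp add: algebra_simps)
  moreover have "(\<lambda>n. (P (Complex (real n) y1) - P (Complex (- real n) y1)) - (P (Complex (real n) y2) - P (Complex (- real n) y2)))
     \<longlonglongrightarrow> (LINT x|lborel. W (Complex x y1)) - (LINT x|lborel. W (Complex x y2))"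
    using y by (intro tendsto_diff lim) auto
  ultimately show ?thesis using LIMSEQ_unique by fastforce
qed

text \<open>Let F be \<psi> convolved with \<open>\<i> / sinh\<close>; then Re F > 0 and F^p is
  holomorphic. Integrating the pointwise inequality over Im z = e leaves the integral of F^p, which
  does not change when the line moves to Im z = \<pi>/2, where F is real. Only the mass \<pi> of the
  positive kernel enters, so C does not depend on e.\<close>

lemma Riesz_strip_nonneg:
  fixes p :: real
  assumes p: "1 < p" "p \<le> 2"
  obtains C where "C \<ge> 0" "\<And>e \<psi>. 0 < e \<Longrightarrow> e \<le> pi / 2 \<Longrightarrow> lip_compact \<psi> \<Longrightarrow> (\<And>x. \<psi> x \<ge> 0) \<Longrightarrow>
     Lp_norm p (conv (conj_ker e) \<psi>) \<le> C * Lp_norm p \<psi>"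
proof -
  obtain A B where AB: "A \<ge> 0" "B \<ge> 0"
    "\<And>z. Re z > 0 \<Longrightarrow> \<bar>Im z\<bar> powr p \<le> A * Re z powr p - B * Re (z powr of_real p)"
    using Riesz_pointwise[OF p] by blast
  \<comment> \<open>A belongs to the real part on the line Im z = e and B to the line Im z =
    \<pi>/2; on both, Young's inequality contributes the mass \<pi>.\<close>
  define C where "C = (A + B) powr (1/p) * pi"
  have C0: "C \<ge> 0" by (simp add: C_def)
  show ?thesis
  proof (rule that[OF C0])
    fix e :: real and \<psi> assume e: "0 < e" "e \<le> pi / 2" and \<psi>: "lip_compact \<psi>" and pos: "\<And>x. \<psi> x \<ge> 0"
    have [measurable]: "\<psi> \<in> borel_measurable borel" using \<psi> by (rule lip_compact_measurable)
    have \<psi>p: "Lp p \<psi>" using \<psi> p by (intro lip_compact_Lp) auto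
    obtain R M where R: "R \<ge> 0" "\<And>x. \<bar>x\<bar> > R \<Longrightarrow> \<psi> x = 0" and M: "M \<ge> 0" "\<And>x. \<bar>\<psi> x\<bar> \<le> M"
      using \<psi> by (elim lip_compactE) blast
    have \<psi>i: "integrable lborel \<psi>" using lip_compact_Lp[OF \<psi>, of 1] pos by (simp add: Lp_def)
    show "Lp_norm p (conv (conj_ker e) \<psi>) \<le> C * Lp_norm p \<psi>"
    \<comment> \<open>If \<psi> vanishes almost everywhere, so does F, and the strict positivity of
      Re F behind the principal power is lost.\<close>
    proof (cases "AE x in lborel. \<psi> x = 0")
      case True
      have "conv (conj_ker e) \<psi> x = 0" for x
        unfolding conv_alt by (rule integral_eq_zero_AE, use True in eventually_elim) simp
      then have "conv (conj_ker e) \<psi> = (\<lambda>x. 0)" by auto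
      then show ?thesis using C0 by simp
    next
      case False
      define F where "F z = (LINT t|lborel. of_real (\<psi> t) * (\<i> / sinh (z - of_real t)))" for z
      have kern: "\<i> / sinh (Complex x y - of_real t) = Complex (poisson_ker y (x - t)) (conj_ker y (x - t))" for x y t
      proof -
        have "Complex x y - of_real t = Complex (x - t) y" by (simp add: complex_eq_iff)
        then show ?thesis by (simp add: csch_Complex)
      qed
      have int: "integrable lborel (\<lambda>t. poisson_ker y (x - t) * \<psi> t)" "integrable lborel (\<lambda>t. conj_ker y (x - t) * \<psi> t)"
        if y: "0 < y" "y < pi" for x y
        by (rule Bochner_Integration.integrable_bound[where f = "\<lambda>t. M * poisson_ker y (x - t)"];
            use strip_ker_integrable[OF y] lborel_integrable_shift(3)[of "poisson_ker y" x] M in \<open>auto simp: abs_mult mult.commute intro!: mult_right_mono\<close>)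
          (rule Bochner_Integration.integrable_bound[where f = "\<lambda>t. M * conj_ker y (x - t)"];
            use strip_ker_integrable[OF y] lborel_integrable_shift(3)[of "conj_ker y" x] M in \<open>auto simp: abs_mult mult.commute intro!: mult_right_mono\<close>)
      have F: "F (Complex x y) = Complex (conv (poisson_ker y) \<psi> x) (conv (conj_ker y) \<psi> x)" if y: "0 < y" "y < pi" for x y
      proof -
        have eq: "of_real (\<psi> t) * (\<i> / sinh (Complex x y - of_real t))
          = of_real (poisson_ker y (x - t) * \<psi> t) + \<i> * of_real (conj_ker y (x - t) * \<psi> t)" for t
          unfolding kern by (simp add: complex_eq_iff mult.commute)
        have "F (Complex x y) = (LINT t|lborel. complex_of_real (poisson_ker y (x - t) * \<psi> t)) + (LINT t|lborel. \<i> * of_real (conj_ker y (x - t) * \<psi> t))"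
          unfolding F_def eq by (intro Bochner_Integration.integral_add integrable_mult_right integrable_of_real int[OF y])
        also have "\<dots> = Complex (conv (poisson_ker y) \<psi> x) (conv (conj_ker y) \<psi> x)"
          using int[OF y, of x] by (simp only: integral_mult_right_zero integral_complex_of_real conv_alt) (simp add: complex_eq_iff)
        finally show ?thesis .
      qed
      have upos: "conv (poisson_ker y) \<psi> x > 0" if y: "0 < y" "y < pi" for x y
      proof -
        have nn: "AE t in lborel. 0 \<le> poisson_ker y (x - t) * \<psi> t"
          using pos strip_ker_bounds(1)[OF y] by (intro AE_I2 mult_nonneg_nonneg) (auto intro: less_imp_le)
        have "conv (poisson_ker y) \<psi> x \<noteq> 0"
        proof
          assume "conv (poisson_ker y) \<psi> x = 0"
          then have "AE t in lborel. poisson_ker y (x - t) * \<psi> t = 0"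
            using integral_nonneg_eq_0_iff_AE[OF int(1)[OF y] nn] by (simp add: conv_alt)
          then have "AE t in lborel. \<psi> t = 0"
          proof eventually_elim
            fix t assume "poisson_ker y (x - t) * \<psi> t = 0"
            then show "\<psi> t = 0" using strip_ker_bounds(1)[OF y, of "x - t"] by simp
          qed
          then show False using False by simp
        qed
        moreover have "conv (poisson_ker y) \<psi> x \<ge> 0" unfolding conv_alt using nn by (rule integral_nonneg_AE)
        ultimately show ?thesis by simp
      qed
      define S where "S = {z. 0 < Im z \<and> Im z < pi}"
      have Fhol: "F holomorphic_on S" unfolding F_def S_def by (rule csch_integral_holomorphic[OF \<psi>])
      have Fpos: "Re (F z) > 0" if "z \<in> S" for z
        using F[of "Im z" "Re z"] upos[of "Im z" "Re z"] that by (simp add: S_def)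
      define W where "W z = F z powr of_real p" for z
      have Whol: "W holomorphic_on S" unfolding W_def[abs_def]
        by (intro holomorphic_intros Fhol) (use Fpos complex_nonpos_Reals_iff in \<open>fastforce dest: Fpos\<close>)
      have Wn: "cmod (W z) = cmod (F z) powr p" for z
        by (simp add: W_def norm_powr_real_powr')
      \<comment> \<open>For |t| \<le> R the decay exp (- |x - t|) costs a factor exp R relative to
        exp (- |x|), and sin y \<ge> sin e for heights between e and \<pi>/2.\<close>
      define D where "D = 2 / sin e * (exp R * (LINT t|lborel. \<psi> t))"
      have se: "sin e > 0" using e by (intro sin_gt_zero) auto
      have ee: "e < pi" using e pi_gt_zero by linarith
      have D0: "D \<ge> 0" unfolding D_def using se pos by (auto intro!: mult_nonneg_nonneg integral_nonneg)
      have Fb: "cmod (F (Complex x y)) \<le> D * exp (- \<bar>x\<bar>)" if y: "e \<le> y" "y \<le> pi / 2" for x y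
      proof -
        have y': "0 < y" "y < pi" using y e pi_gt_zero by linarith+
        have sy: "sin e \<le> sin y" using y e by (intro sin_monotone_2pi_le) auto
        have "cmod (F (Complex x y)) \<le> (LINT t|lborel. 2 / sin e * (exp R * exp (- \<bar>x\<bar>)) * \<psi> t)"
          unfolding F_def
        proof (rule order_trans[OF integral_norm_bound], rule integral_mono)
          have 0: "integrable lborel (\<lambda>t. complex_of_real (poisson_ker y (x - t) * \<psi> t) + \<i> * of_real (conj_ker y (x - t) * \<psi> t))"
            by (intro Bochner_Integration.integrable_add integrable_mult_right integrable_of_real int[OF y'])
          have "integrable lborel (\<lambda>t. complex_of_real (\<psi> t) * (\<i> / sinh (Complex x y - complex_of_real t)))"
            by (rule back_subst[where P = "integrable lborel", OF 0])
              (unfold kern, simp add: fun_eq_iff complex_eq_iff mult.commute)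
          then show "integrable lborel (\<lambda>t. cmod (complex_of_real (\<psi> t) * (\<i> / sinh (Complex x y - complex_of_real t))))"
            by (rule integrable_norm)
          show "integrable lborel (\<lambda>t. 2 / sin e * (exp R * exp (- \<bar>x\<bar>)) * \<psi> t)" using \<psi>i by simp
          fix t
          show "norm (complex_of_real (\<psi> t) * (\<i> / sinh (Complex x y - complex_of_real t))) \<le> 2 / sin e * (exp R * exp (- \<bar>x\<bar>)) * \<psi> t"
          proof (cases "\<bar>t\<bar> > R")
            case False
            have "Complex x y - complex_of_real t = Complex (x - t) y" by (simp add: complex_eq_iff)
            then have "cmod (\<i> / sinh (Complex x y - complex_of_real t)) \<le> 2 / sin y * exp (- \<bar>x - t\<bar>)"
              using csch_norm_le[OF y', of "x - t"] by simp
            also have "\<dots> \<le> 2 / sin e * exp (R - \<bar>x\<bar>)"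
              using sy se False by (intro mult_mono divide_left_mono) auto
            also have "\<dots> = 2 / sin e * (exp R * exp (- \<bar>x\<bar>))" by (simp add: exp_diff exp_minus divide_inverse)
            finally have "cmod (\<i> / sinh (Complex x y - complex_of_real t)) * \<psi> t \<le> 2 / sin e * (exp R * exp (- \<bar>x\<bar>)) * \<psi> t"
              using pos by (intro mult_right_mono)
            then show ?thesis unfolding norm_mult norm_of_real abs_of_nonneg[OF pos] by (subst mult.commute)
          qed (use R in simp)
        qed
        also have "\<dots> = D * exp (- \<bar>x\<bar>)" by (simp add: D_def)
        finally show ?thesis .
      qed
      have Wb: "cmod (W (Complex x y)) \<le> D powr p * exp (- (p * \<bar>x\<bar>))" if y: "e \<le> y" "y \<le> pi / 2" for x y
      proof -
        have "cmod (W (Complex x y)) \<le> (D * exp (- \<bar>x\<bar>)) powr p"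
          unfolding Wn using Fb[OF y] p by (intro powr_mono2) auto
        also have "\<dots> = D powr p * exp (- (p * \<bar>x\<bar>))"
          using D0 by (simp add: powr_mult exp_powr_real mult.commute)
        finally show ?thesis .
      qed
      have shift: "(LINT x|lborel. W (Complex x e)) = (LINT x|lborel. W (Complex x (pi/2)))"
        by (rule contour_shift[of _ _ _ p "D powr p"]) (use Whol e p Wb in \<open>auto simp: S_def\<close>)
      have meas: "(\<lambda>x. W (Complex x y)) \<in> borel_measurable borel" if "0 < y" "y < pi" for y
      proof (rule borel_measurable_continuous_onI)
        have "continuous_on S W" using Whol holomorphic_on_imp_continuous_on by blast
        moreover have "continuous_on UNIV (\<lambda>x. Complex x y)" unfolding Complex_eq by (intro continuous_intros)
        ultimately show "continuous_on UNIV (\<lambda>x. W (Complex x y))"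
          by (rule continuous_on_compose2) (use that in \<open>auto simp: S_def\<close>)
      qed
      have Wi: "integrable lborel (\<lambda>x. W (Complex x y))" if y: "e \<le> y" "y \<le> pi / 2" for y
      proof (rule Bochner_Integration.integrable_bound)
        show "integrable lborel (\<lambda>x. D powr p * exp (- (p * \<bar>x\<bar>)))" using integrable_exp_abs[of p] p by simp
        show "(\<lambda>x. W (Complex x y)) \<in> borel_measurable lborel" using meas[of y] y e pi_gt_zero by simp
      qed (use Wb[OF y] in \<open>auto intro!: AE_I2\<close>)
      have u: "Lp p (conv (poisson_ker y) \<psi>)" "Lp_norm p (conv (poisson_ker y) \<psi>) \<le> pi * Lp_norm p \<psi>" if y: "0 < y" "y < pi" for y
      proof -
        have "(LINT t|lborel. \<bar>poisson_ker y t\<bar>) = pi"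
          using poisson_ker_integral[OF y] strip_ker_bounds(1)[OF y] by (simp add: abs_of_pos)
        then show "Lp p (conv (poisson_ker y) \<psi>)" "Lp_norm p (conv (poisson_ker y) \<psi>) \<le> pi * Lp_norm p \<psi>"
          using Young_convolution(2,3)[OF strip_ker_integrable(1)[OF y] \<psi>p p(1)] by auto
      qed
      have uI: "(LINT x|lborel. \<bar>conv (poisson_ker y) \<psi> x\<bar> powr p) \<le> (pi * Lp_norm p \<psi>) powr p" if "0 < y" "y < pi" for y
        using u(2)[OF that] p by (subst (asm) Lp_norm_le_iff) auto
      have v: "Lp p (conv (conj_ker e) \<psi>)"
        by (rule Young_convolution(2)[OF strip_ker_integrable(2)[OF e(1) ee] \<psi>p p(1)])
      have pw: "\<bar>conv (conj_ker e) \<psi> x\<bar> powr p \<le> A * \<bar>conv (poisson_ker e) \<psi> x\<bar> powr p - B * Re (W (Complex x e))" for x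
        using AB(3)[of "F (Complex x e)"] upos[OF e(1) ee, of x] by (simp add: F[OF e(1) ee] W_def)
      have "(LINT x|lborel. \<bar>conv (conj_ker e) \<psi> x\<bar> powr p) \<le> (LINT x|lborel. A * \<bar>conv (poisson_ker e) \<psi> x\<bar> powr p - B * Re (W (Complex x e)))"
        using pw Lp_int[OF v] Lp_int[OF u(1)[OF e(1) ee]] Wi[of e] e
        by (intro integral_mono) auto
      also have "\<dots> = A * (LINT x|lborel. \<bar>conv (poisson_ker e) \<psi> x\<bar> powr p) - B * Re (LINT x|lborel. W (Complex x e))"
        using Lp_int[OF u(1)[OF e(1) ee]] Wi[of e] e by simp
      also have "\<dots> \<le> A * (pi * Lp_norm p \<psi>) powr p + B * (pi * Lp_norm p \<psi>) powr p"
      proof -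
        have "- Re (LINT x|lborel. W (Complex x e)) \<le> cmod (LINT x|lborel. W (Complex x (pi/2)))"
          using abs_Re_le_cmod[of "LINT x|lborel. W (Complex x e)"] by (simp add: shift)
        also have "\<dots> \<le> (LINT x|lborel. cmod (W (Complex x (pi/2))))"
          by (rule integral_norm_bound)
        also have "\<dots> = (LINT x|lborel. \<bar>conv (poisson_ker (pi/2)) \<psi> x\<bar> powr p)"
        proof (rule Bochner_Integration.integral_cong[OF refl])
          fix x
          \<comment> \<open>cos (\<pi>/2) = 0 removes the conjugate kernel, so F is real on the
            middle line.\<close>
          have "conv (conj_ker (pi/2)) \<psi> x = 0" unfolding conv_def conj_ker_def by simp
          then show "cmod (W (Complex x (pi/2))) = \<bar>conv (poisson_ker (pi/2)) \<psi> x\<bar> powr p"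
            by (simp add: Wn F complex_norm)
        qed
        also have "\<dots> \<le> (pi * Lp_norm p \<psi>) powr p" by (rule uI) auto
        finally have "B * (- Re (LINT x|lborel. W (Complex x e))) \<le> B * (pi * Lp_norm p \<psi>) powr p"
          using AB by (intro mult_left_mono)
        moreover have "A * (LINT x|lborel. \<bar>conv (poisson_ker e) \<psi> x\<bar> powr p) \<le> A * (pi * Lp_norm p \<psi>) powr p"
          using AB uI[OF e(1) ee] by (intro mult_left_mono)
        ultimately show ?thesis by simp
      qed
      also have "\<dots> = (C * Lp_norm p \<psi>) powr p"
        using AB p by (simp add: C_def powr_mult powr_powr distrib_right)
      finally show ?thesis using p C0 by (subst Lp_norm_le_iff) auto
    qed
  qed
qed

section \<open>Uniformly bounded truncations of the logarithm of the phase operator\<close>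

text \<open>With E = exp (- 2 x), 1 / sinh x is exp (- x) times 2 / (1 - E), and 1/x \<le> 2 / (1 -
  E) \<le> 1/x + 2. Both inequalities come from 1 + u \<le> exp u.\<close>

lemma inverse_sinh_bounds:
  fixes x :: real
  assumes "x > 0"
  shows "exp (- x) / x \<le> 1 / sinh x" "1 / sinh x \<le> exp (- x) / x + 2 * exp (- x)"
proof -
  define E where "E = exp (- (2 * x))"
  have E: "0 < E" "E < 1" using assms by (auto simp: E_def)
  have s: "1 / sinh x = exp (- x) * (2 / (1 - E))"
  proof -
    have "exp x * (1 - E) = exp x - exp (-x)" by (simp add: E_def algebra_simps exp_add[symmetric])
    then have "sinh x = exp x * (1 - E) / 2" by (simp add: sinh_def)
    then have "1 / sinh x = 2 / (exp x * (1 - E))" by (simp only: divide_divide_eq_right mult_1)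
    then show ?thesis by (simp add: exp_minus inverse_eq_divide)
  qed
  have "1 - E \<le> 2 * x" using exp_ge_add_one_self[of "- (2 * x)"] by (simp add: E_def)
  then have "1 / x \<le> 2 / (1 - E)" using E assms by (simp add: field_simps)
  then show "exp (- x) / x \<le> 1 / sinh x"
    using mult_left_mono[of "1 / x" "2 / (1 - E)" "exp (- x)"] by (simp add: s)
  have "E * (1 + 2 * x) \<le> E * exp (2 * x)" using E exp_ge_add_one_self[of "2 * x"] by (intro mult_left_mono) auto
  also have "\<dots> = 1" by (simp add: E_def exp_add[symmetric])
  finally have "E * (1 + 2 * x) \<le> 1" .
  then have "2 / (1 - E) \<le> 1 / x + 2" using E assms by (simp add: field_simps)
  then show "1 / sinh x \<le> exp (- x) / x + 2 * exp (- x)"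
    using mult_left_mono[of "2 / (1 - E)" "1 / x + 2" "exp (- x)"] by (simp add: s distrib_left mult.commute)
qed

text \<open>Dominates 1 / sinh multiplied by a factor of order |t|, such as a Lipschitz difference
  or a sine. At t = 0 the quotient is 0 by the convention for division.\<close>

lemma abs_div_sinh_le: "\<bar>t\<bar> / \<bar>sinh t\<bar> \<le> 4 * exp (- (\<bar>t\<bar> / 2))" for t :: real
proof -
  have pos: "t / sinh t \<le> 4 * exp (- (t / 2))" if "t > 0" for t :: real
  proof -
    have "t * (1 / sinh t) \<le> t * (exp (- t) / t + 2 * exp (- t))"
      using that inverse_sinh_bounds(2)[OF that] by (intro mult_left_mono) auto
    also have "\<dots> = exp (- t) * (1 + 2 * t)" using that by (simp add: field_simps)
    also have "\<dots> \<le> exp (- t) * (4 * exp (t / 2))"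
    proof (rule mult_left_mono)
      show "1 + 2 * t \<le> 4 * exp (t / 2)" using exp_ge_add_one_self[of "t / 2"] by linarith
    qed simp
    also have "\<dots> = 4 * exp (- (t / 2))" by (simp add: exp_add[symmetric])
    finally show ?thesis by simp
  qed
  show ?thesis
    using pos[of "\<bar>t\<bar>"] by (cases "t = 0") (auto simp: abs_if)
qed

text \<open>The poles at 0 cancel; what remains is integrable and is handled by Young's inequality
  alone.\<close>

definition csch_rem :: "real \<Rightarrow> real" where
  "csch_rem x = exp (- \<bar>x\<bar>) / x - 1 / sinh x"

lemma csch_rem_measurable [measurable]: "csch_rem \<in> borel_measurable borel"
proof -
  have [measurable]: "(sinh :: real \<Rightarrow> real) \<in> borel_measurable borel"
    by (auto intro!: borel_measurable_continuous_onI continuous_intros)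
  show ?thesis unfolding csch_rem_def[abs_def] by measurable
qed

lemma csch_rem_bound: "\<bar>csch_rem x\<bar> \<le> 2 * exp (- \<bar>x\<bar>)"
proof -
  have pos: "\<bar>csch_rem x\<bar> \<le> 2 * exp (- \<bar>x\<bar>)" if "x > 0" for x
    using inverse_sinh_bounds[OF that] that unfolding csch_rem_def by (simp add: abs_if)
  have odd: "csch_rem (- x) = - csch_rem x" by (simp add: csch_rem_def)
  consider "x > 0" | "x = 0" | "- x > 0" by linarith
  then show ?thesis
  proof cases
    case 3 then show ?thesis using pos[of "- x"] odd by simp
  qed (use pos in \<open>auto simp: csch_rem_def\<close>)
qed

lemma csch_rem_integrable: "integrable lborel csch_rem"
proof -
  have i: "integrable lborel (\<lambda>x. 2 * exp (- \<bar>x\<bar>) :: real)"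
    using integrable_exp_abs[of 1] by simp
  show ?thesis
    by (rule Bochner_Integration.integrable_bound[OF i], simp, rule AE_I2, unfold real_norm_def,
        rule order_trans[OF csch_rem_bound abs_ge_self])
qed

text \<open>Heights of lines approaching the real axis; the summand 1 makes the first height 1,
  below \<pi>/2. The same null sequence serves as Abel parameter in the inversion formula.\<close>

definition cutoff :: "nat \<Rightarrow> real" where "cutoff m = 1 / (real m + 1)"

lemma cutoff_bounds: "0 < cutoff m" "cutoff m \<le> pi / 2" "cutoff m < pi" "cutoff m < pi / 2"
proof -
  show "0 < cutoff m" by (simp add: cutoff_def)
  have "cutoff m \<le> 1" by (simp add: cutoff_def)
  then show "cutoff m \<le> pi / 2" "cutoff m < pi" "cutoff m < pi / 2" using pi_gt3 by linarith+
qed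

lemma cutoff_tendsto: "cutoff \<longlonglongrightarrow> 0"
  using LIMSEQ_inverse_real_of_nat by (simp add: cutoff_def[abs_def] inverse_eq_divide add.commute)

text \<open>These kernels converge to the kernel \<open>e\<^bsup>-|x|\<^esup> / (2 x)\<close>, whose principal value convolution has Fourier
  multiplier \<open>- i arctan \<xi>\<close>.\<close>

definition phase_ker :: "nat \<Rightarrow> real \<Rightarrow> real" where
  "phase_ker m x = 1/2 * (conj_ker (cutoff m) x + csch_rem x)"

lemma phase_ker_odd: "phase_ker m (- x) = - phase_ker m x"
proof -
  have "conj_ker (cutoff m) (- x) = - conj_ker (cutoff m) x" "csch_rem (- x) = - csch_rem x" by (simp_all add: conj_ker_def csch_rem_def)
  then show ?thesis unfolding phase_ker_def by (simp only: minus_add_distrib[symmetric] mult_minus_right)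
qed

lemma phase_ker_integrable: "integrable lborel (phase_ker m)"
  unfolding phase_ker_def[abs_def]
  by (intro integrable_mult_right Bochner_Integration.integrable_add strip_ker_integrable csch_rem_integrable cutoff_bounds)

lemma phase_ker_measurable [measurable]: "phase_ker m \<in> borel_measurable borel"
  using phase_ker_integrable[of m] by auto

text \<open>Only almost everywhere: where one of the integrals diverges, \<open>conv\<close> takes
  the default value 0 and additivity may fail.\<close>

lemma conv_lin_right:
  assumes k: "integrable lborel k" and f: "Lp p f" and g: "Lp p g" and p: "p > 1"
  shows "AE x in lborel. conv k (\<lambda>x. a * f x + b * g x) x = a * conv k f x + b * conv k g x"
  using Young_convolution(1)[OF k f p] Young_convolution(1)[OF k g p]
proof eventually_elim
  fix x assume 1: "integrable lborel (\<lambda>t. k t * f (x - t))" and 2: "integrable lborel (\<lambda>t. k t * g (x - t))"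
  have "conv k (\<lambda>x. a * f x + b * g x) x = (LINT t|lborel. a * (k t * f (x - t)) + b * (k t * g (x - t)))"
    unfolding conv_def by (simp add: algebra_simps)
  also have "\<dots> = a * conv k f x + b * conv k g x" using 1 2 by (simp add: conv_def)
  finally show "conv k (\<lambda>x. a * f x + b * g x) x = a * conv k f x + b * conv k g x" .
qed

lemma conv_lin_left:
  assumes k: "integrable lborel k" and l: "integrable lborel l" and f: "Lp p f" and p: "p > 1"
  shows "AE x in lborel. conv (\<lambda>x. a * (k x + l x)) f x = a * (conv k f x + conv l f x)"
  using Young_convolution(1)[OF k f p] Young_convolution(1)[OF l f p]
proof eventually_elim
  fix x assume 1: "integrable lborel (\<lambda>t. k t * f (x - t))" and 2: "integrable lborel (\<lambda>t. l t * f (x - t))"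
  have "conv (\<lambda>x. a * (k x + l x)) f x = (LINT t|lborel. a * (k t * f (x - t) + l t * f (x - t)))"
    unfolding conv_def by (simp add: algebra_simps)
  also have "\<dots> = a * (conv k f x + conv l f x)" using 1 2 by (simp add: conv_def)
  finally show "conv (\<lambda>x. a * (k x + l x)) f x = a * (conv k f x + conv l f x)" .
qed

section \<open>Uniform bounds for the truncated operators\<close>

lemma conv_diff_norm:
  assumes k: "integrable lborel k" and f: "Lp p f" and g: "Lp p g" and p: "p > 1"
  shows "Lp_norm p (\<lambda>x. conv k f x - conv k g x) = Lp_norm p (conv k (\<lambda>x. f x - g x))"
proof (rule Lp_norm_cong_AE)
  have [measurable]: "k \<in> borel_measurable borel" "f \<in> borel_measurable borel" "g \<in> borel_measurable borel"
    using k Lp_meas f g by auto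
  show "AE x in lborel. conv k f x - conv k g x = conv k (\<lambda>x. f x - g x) x"
    using conv_lin_right[OF k f g p, of 1 "-1"] by eventually_elim simp
qed (use k Lp_meas[OF f] Lp_meas[OF g] in measurable)

text \<open>Positive and negative parts of a compactly supported Lipschitz function are again of
  this kind and have no larger norm; hence the factor 2.\<close>

lemma conj_ker_bounded_lip_compact:
  fixes p :: real
  assumes p: "1 < p" "p \<le> 2"
  obtains C where "C \<ge> 0" "\<And>e \<psi>. 0 < e \<Longrightarrow> e \<le> pi / 2 \<Longrightarrow> lip_compact \<psi> \<Longrightarrow>
     Lp_norm p (conv (conj_ker e) \<psi>) \<le> C * Lp_norm p \<psi>"
proof -
  obtain C where C: "C \<ge> 0" "\<And>e \<psi>. 0 < e \<Longrightarrow> e \<le> pi / 2 \<Longrightarrow> lip_compact \<psi> \<Longrightarrow> (\<And>x. \<psi> x \<ge> 0) \<Longrightarrow>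
     Lp_norm p (conv (conj_ker e) \<psi>) \<le> C * Lp_norm p \<psi>"
    using Riesz_strip_nonneg[OF p] by blast
  have C2: "2 * C \<ge> 0" using C by simp
  show ?thesis
  proof (rule that[OF C2])
    fix e :: real and \<psi> assume e: "0 < e" "e \<le> pi / 2" and \<psi>: "lip_compact \<psi>"
    obtain L R where L: "L \<ge> 0" "\<And>x y. \<bar>\<psi> x - \<psi> y\<bar> \<le> L * \<bar>x - y\<bar>" and R: "\<And>x. \<bar>x\<bar> > R \<Longrightarrow> \<psi> x = 0"
      using \<psi> by (elim lip_compactE) blast
    define P Q where "P x = max 0 (\<psi> x)" and "Q x = max 0 (- \<psi> x)" for x
    have PQ: "\<psi> = (\<lambda>x. P x - Q x)" by (auto simp: P_def Q_def)
    have lP: "lip_compact P"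
    proof (rule lip_compactI[of _ L R])
      show "\<bar>P x - P y\<bar> \<le> L * \<bar>x - y\<bar>" for x y using L(2)[of x y] unfolding P_def by linarith
    qed (use R L in \<open>auto simp: P_def\<close>)
    have lQ: "lip_compact Q"
    proof (rule lip_compactI[of _ L R])
      show "\<bar>Q x - Q y\<bar> \<le> L * \<bar>x - y\<bar>" for x y using L(2)[of x y] unfolding Q_def by linarith
    qed (use R L in \<open>auto simp: Q_def\<close>)
    have Lp: "Lp p P" "Lp p Q" "Lp p \<psi>" using lP lQ \<psi> p by (auto intro: lip_compact_Lp)
    have m: "P \<in> borel_measurable borel" "Q \<in> borel_measurable borel" using Lp by (auto dest: Lp_meas)
    have nP: "Lp_norm p P \<le> Lp_norm p \<psi>"
      by (rule Lp_bound(2)[OF Lp(3) m(1)]) (use p in \<open>auto simp: P_def\<close>)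
    have nQ: "Lp_norm p Q \<le> Lp_norm p \<psi>"
      by (rule Lp_bound(2)[OF Lp(3) m(2)]) (use p in \<open>auto simp: Q_def\<close>)
    have k: "integrable lborel (conj_ker e)" using e pi_gt_zero by (intro strip_ker_integrable(2)) linarith+
    have "Lp_norm p (conv (conj_ker e) \<psi>) = Lp_norm p (\<lambda>x. conv (conj_ker e) P x - conv (conj_ker e) Q x)"
      using conv_diff_norm[OF k Lp(1,2) p(1)] by (simp add: PQ[symmetric])
    also have "\<dots> \<le> Lp_norm p (conv (conj_ker e) P) + Lp_norm p (conv (conj_ker e) Q)"
      using Young_convolution(2)[OF k _ p(1)] Lp p by (intro Lp_diff(2)) auto
    also have "\<dots> \<le> C * Lp_norm p P + C * Lp_norm p Q"
      using C(2)[OF e lP] C(2)[OF e lQ] by (intro add_mono) (auto simp: P_def Q_def)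
    also have "\<dots> \<le> C * Lp_norm p \<psi> + C * Lp_norm p \<psi>"
      using nP nQ C(1) by (intro add_mono mult_left_mono)
    finally show "Lp_norm p (conv (conj_ker e) \<psi>) \<le> 2 * C * Lp_norm p \<psi>" by simp
  qed
qed

text \<open>The point is the constant. Young's inequality alone would give the L_1 norm \<kappa> of
  the kernel, which blows up when a truncation is removed; here \<kappa> only multiplies the
  approximation error and disappears as that error tends to 0.\<close>

lemma conv_bounded_extend:
  assumes k: "integrable lborel k" and p: "p > 1" and C: "C \<ge> 0"
    and le: "\<And>\<psi>. lip_compact \<psi> \<Longrightarrow> Lp_norm p (conv k \<psi>) \<le> C * Lp_norm p \<psi>" and f: "Lp p f"
  shows "Lp_norm p (conv k f) \<le> C * Lp_norm p f"
proof (rule field_le_epsilon)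
  fix d :: real assume d: "d > 0"
  define \<kappa> where "\<kappa> = (LINT t|lborel. \<bar>k t\<bar>)"
  have \<kappa>0: "\<kappa> \<ge> 0" unfolding \<kappa>_def by simp
  define e where "e = d / (C + \<kappa> + 1)"
  have e: "e > 0" using d C \<kappa>0 by (simp add: e_def)
  obtain g where g: "lip_compact g" "Lp_norm p (\<lambda>x. f x - g x) < e"
    using lip_approx_Lp[OF f] p e unfolding lip_approx_def by auto
  have gp: "Lp p g" using g p by (intro lip_compact_Lp) auto
  have fg: "Lp p (\<lambda>x. f x - g x)" using f gp p by (intro Lp_diff) auto
  have cf: "Lp p (conv k f)" and cg: "Lp p (conv k g)" using Young_convolution(2)[OF k _ p] f gp by auto
  have "Lp_norm p g \<le> Lp_norm p f + e"
    using Lp_diff(2)[OF f fg] p g(2) by simp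
  have "Lp_norm p (conv k f) \<le> Lp_norm p (\<lambda>x. conv k f x - conv k g x) + Lp_norm p (conv k g)"
    using Lp_norm_add[OF Lp_diff(1)[OF cf cg] cg] p by simp
  also have "\<dots> = Lp_norm p (conv k (\<lambda>x. f x - g x)) + Lp_norm p (conv k g)"
    by (simp add: conv_diff_norm[OF k f gp p])
  also have "\<dots> \<le> \<kappa> * Lp_norm p (\<lambda>x. f x - g x) + C * Lp_norm p g"
    unfolding \<kappa>_def using Young_convolution(3)[OF k fg p] le[OF g(1)] by (intro add_mono)
  also have "\<dots> \<le> \<kappa> * e + C * (Lp_norm p f + e)"
    using g(2) \<open>Lp_norm p g \<le> _\<close> \<kappa>0 C by (intro add_mono mult_left_mono) auto
  also have "\<dots> \<le> C * Lp_norm p f + (C + \<kappa> + 1) * e" using e by (simp add: algebra_simps)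
  also have "(C + \<kappa> + 1) * e = d" using C \<kappa>0 by (simp add: e_def)
  finally show "Lp_norm p (conv k f) \<le> C * Lp_norm p f + d" .
qed

lemma phase_ker_bounded_small:
  fixes p :: real
  assumes p: "1 < p" "p \<le> 2"
  obtains C where "C \<ge> 0" "\<And>m f. Lp p f \<Longrightarrow> Lp_norm p (conv (phase_ker m) f) \<le> C * Lp_norm p f"
proof -
  obtain C where C: "C \<ge> 0" "\<And>e \<psi>. 0 < e \<Longrightarrow> e \<le> pi / 2 \<Longrightarrow> lip_compact \<psi> \<Longrightarrow>
     Lp_norm p (conv (conj_ker e) \<psi>) \<le> C * Lp_norm p \<psi>"
    using conj_ker_bounded_lip_compact[OF p] by blast
  define \<rho> where "\<rho> = (LINT t|lborel. \<bar>csch_rem t\<bar>)"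
  have \<rho>: "\<rho> \<ge> 0" by (simp add: \<rho>_def)
  have C': "1/2 * (C + \<rho>) \<ge> 0" using C \<rho> by simp
  show ?thesis
  proof (rule that[OF C'])
    fix m f assume f: "Lp p f"
    have [measurable]: "f \<in> borel_measurable borel" using Lp_meas[OF f] .
    have k: "integrable lborel (conj_ker (cutoff m))" by (intro strip_ker_integrable cutoff_bounds)
    have 1: "Lp_norm p (conv (conj_ker (cutoff m)) f) \<le> C * Lp_norm p f"
      by (rule conv_bounded_extend[OF k p(1) C(1) C(2)[OF cutoff_bounds(1,2)] f])
    have 2: "Lp_norm p (conv csch_rem f) \<le> \<rho> * Lp_norm p f"
      unfolding \<rho>_def by (rule Young_convolution(3)[OF csch_rem_integrable f p(1)])
    have i: "Lp p (conv (conj_ker (cutoff m)) f)" "Lp p (conv csch_rem f)"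
      using Young_convolution(2)[OF k f p(1)] Young_convolution(2)[OF csch_rem_integrable f p(1)] by auto
    have s: "Lp p (\<lambda>x. conv (conj_ker (cutoff m)) f x + conv csch_rem f x)" using i p by (intro Lp_add) auto
    have "Lp_norm p (conv (phase_ker m) f) = Lp_norm p (\<lambda>x. 1/2 * (conv (conj_ker (cutoff m)) f x + conv csch_rem f x))"
      using conv_lin_left[OF k csch_rem_integrable f p(1), of "1/2"]
      by (intro Lp_norm_cong_AE) (auto simp: phase_ker_def[abs_def])
    also have "\<dots> = 1/2 * Lp_norm p (\<lambda>x. conv (conj_ker (cutoff m)) f x + conv csch_rem f x)"
      using Lp_scale(2)[OF s, of "1/2"] p by simp
    also have "\<dots> \<le> 1/2 * (C * Lp_norm p f + \<rho> * Lp_norm p f)"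
      using Lp_norm_add[OF i] p 1 2 by simp
    finally show "Lp_norm p (conv (phase_ker m) f) \<le> 1/2 * (C + \<rho>) * Lp_norm p f" by (simp add: algebra_simps)
  qed
qed

text \<open>The kernel is odd, so transposition changes the sign. This serves the duality for p > 2
  and later determines the sign of the exponent on the test side.\<close>

lemma phase_ker_antisym:
  assumes f: "Lp p f" and g: "Lp q g" and pq: "p > 1" "q > 1" "1/p + 1/q = 1"
  shows "(LINT x|lborel. conv (phase_ker m) f x * g x) = - (LINT x|lborel. f x * conv (phase_ker m) g x)"
proof -
  have "conv (\<lambda>t. phase_ker m (- t)) g = (\<lambda>x. - conv (phase_ker m) g x)"
    by (simp add: conv_def phase_ker_odd fun_eq_iff)
  then show ?thesis using conv_transpose[OF phase_ker_integrable f g pq] by simp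
qed

lemma phase_ker_bounded:
  fixes p :: real
  assumes p: "1 < p"
  obtains C where "C \<ge> 0" "\<And>m f. Lp p f \<Longrightarrow> Lp_norm p (conv (phase_ker m) f) \<le> C * Lp_norm p f"
proof (cases "p \<le> 2")
  case True
  then show ?thesis using phase_ker_bounded_small[OF p] that by blast
next
  case False
  define q where "q = p / (p - 1)"
  have q: "1 < q" "q \<le> 2" "1/p + 1/q = 1" using p False by (auto simp: q_def field_simps)
  obtain C where C: "C \<ge> 0" "\<And>m f. Lp q f \<Longrightarrow> Lp_norm q (conv (phase_ker m) f) \<le> C * Lp_norm q f"
    using phase_ker_bounded_small[OF q(1,2)] by blast
  show ?thesis
  proof (rule that[OF C(1)])
    fix m f assume f: "Lp p f"
    have c: "Lp p (conv (phase_ker m) f)" by (rule Young_convolution(2)[OF phase_ker_integrable f p])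
    show "Lp_norm p (conv (phase_ker m) f) \<le> C * Lp_norm p f"
    proof (rule Lp_norm_le_dual[OF c p q(1,3)])
      fix g assume g: "Lp q g"
      have cg: "Lp q (conv (phase_ker m) g)" by (rule Young_convolution(2)[OF phase_ker_integrable g q(1)])
      have "(LINT x|lborel. conv (phase_ker m) f x * g x) = - (LINT x|lborel. f x * conv (phase_ker m) g x)"
        by (rule phase_ker_antisym[OF f g p q(1,3)])
      also have "\<dots> \<le> Lp_norm p f * Lp_norm q (conv (phase_ker m) g)"
        using Hoelder(3)[OF f cg p q(1,3)] by linarith
      also have "\<dots> \<le> Lp_norm p f * (C * Lp_norm q g)"
        using C(2)[OF g] by (intro mult_left_mono) auto
      finally show "(LINT x|lborel. conv (phase_ker m) f x * g x) \<le> C * Lp_norm p f * Lp_norm q g"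
        by (simp add: mult_ac)
    qed (use C in simp)
  qed
qed

section \<open>Strong convergence of the truncations\<close>

lemma conj_ker_le_inverse_sinh: "\<bar>conj_ker y t\<bar> \<le> 1 / \<bar>sinh t\<bar>"
proof (cases "sinh t = 0")
  case False
  then have s: "(sinh t)\<^sup>2 > 0" by simp
  have "\<bar>conj_ker y t\<bar> = \<bar>sinh t\<bar> * \<bar>cos y\<bar> / ((sinh t)\<^sup>2 + (sin y)\<^sup>2)"
    by (simp add: conj_ker_def abs_mult abs_divide)
  also have "\<dots> \<le> \<bar>sinh t\<bar> * 1 / (sinh t)\<^sup>2"
    using s by (intro frac_le mult_left_mono) auto
  also have "\<dots> = 1 / \<bar>sinh t\<bar>" using False by (simp add: power2_eq_square abs_if)
  finally show ?thesis .
qed (simp add: conj_ker_def)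

lemma conj_ker_tendsto: "(\<lambda>m. conj_ker (cutoff m) t) \<longlonglongrightarrow> 1 / sinh t"
proof (cases "sinh t = 0")
  case False
  then have s: "(sinh t)\<^sup>2 + (sin 0)\<^sup>2 \<noteq> 0" by simp
  have "(\<lambda>m. conj_ker (cutoff m) t) \<longlonglongrightarrow> sinh t * cos 0 / ((sinh t)\<^sup>2 + (sin 0)\<^sup>2)"
    unfolding conj_ker_def using s by (intro tendsto_intros cutoff_tendsto)
  then show ?thesis using False by (simp add: power2_eq_square)
qed (simp add: conj_ker_def)

text \<open>The kernels are odd, so for Lipschitz functions the singularity at the origin cancels.\<close>

lemma conj_ker_conv_lip_compact_limit:
  assumes \<psi>: "lip_compact \<psi>" and p: "p > 1"
  obtains h where "Lp p h" "(\<lambda>m. Lp_norm p (\<lambda>x. conv (conj_ker (cutoff m)) \<psi> x - h x)) \<longlonglongrightarrow> 0"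
proof -
  obtain L R M where L: "L \<ge> 0" "\<And>x y. \<bar>\<psi> x - \<psi> y\<bar> \<le> L * \<bar>x - y\<bar>"
    and R: "R \<ge> 0" "\<And>x. \<bar>x\<bar> > R \<Longrightarrow> \<psi> x = 0" and M: "M \<ge> 0" "\<And>x. \<bar>\<psi> x\<bar> \<le> M"
    using \<psi> by (elim lip_compactE) blast
  have [measurable]: "\<psi> \<in> borel_measurable borel" using \<psi> by (rule lip_compact_measurable)
  have [measurable]: "(sinh :: real \<Rightarrow> real) \<in> borel_measurable borel"
    by (auto intro!: borel_measurable_continuous_onI continuous_intros)
  \<comment> \<open>As the kernel is odd, only the odd part of t -> \<psi> (x - t) contributes to
    the integral, and that part is of order |t|.\<close>
  define w where "w x t = (\<psi> (x - t) - \<psi> (x + t)) / 2" for x t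
  have wL: "\<bar>w x t\<bar> \<le> L * \<bar>t\<bar>" for x t
  proof -
    have "\<bar>\<psi> (x - t) - \<psi> (x + t)\<bar> \<le> L * (2 * \<bar>t\<bar>)" using L(2)[of "x - t" "x + t"] by (simp add: abs_mult)
    then show ?thesis by (simp add: w_def)
  qed
  have w0: "w x t = 0" if "\<bar>t\<bar> < \<bar>x\<bar> - R" for x t
  proof -
    have "\<bar>x - t\<bar> > R" "\<bar>x + t\<bar> > R" using that by linarith+
    then show ?thesis using R by (simp add: w_def)
  qed
  have sym: "conv (conj_ker (cutoff m)) \<psi> x = (LINT t|lborel. conj_ker (cutoff m) t * w x t)" for m x
  proof -
    have i: "integrable lborel (\<lambda>t. conj_ker (cutoff m) t * \<psi> (x - t))"
    proof (rule Bochner_Integration.integrable_bound[where f = "\<lambda>t. conj_ker (cutoff m) t * M"])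
      show "integrable lborel (\<lambda>t. conj_ker (cutoff m) t * M)"
        using strip_ker_integrable(2)[OF cutoff_bounds(1,3)] by (rule integrable_mult_left)
      show "AE t in lborel. norm (conj_ker (cutoff m) t * \<psi> (x - t)) \<le> norm (conj_ker (cutoff m) t * M)"
        using M by (intro AE_I2) (auto simp: abs_mult intro!: mult_left_mono)
    qed simp
    have odd: "conj_ker (cutoff m) (- t) = - conj_ker (cutoff m) t" for t by (simp add: conj_ker_def)
    have i2: "integrable lborel (\<lambda>t. - (conj_ker (cutoff m) t * \<psi> (x + t)))"
      and e2: "conv (conj_ker (cutoff m)) \<psi> x = (LINT t|lborel. - (conj_ker (cutoff m) t * \<psi> (x + t)))"
      using i lborel_integrable_shift(4)[of "\<lambda>t. conj_ker (cutoff m) t * \<psi> (x - t)"]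
        lborel_integral_shift(4)[of "\<lambda>t. conj_ker (cutoff m) t * \<psi> (x - t)"] by (auto simp: odd conv_def)
    have "conv (conj_ker (cutoff m)) \<psi> x + conv (conj_ker (cutoff m)) \<psi> x
        = (LINT t|lborel. conj_ker (cutoff m) t * \<psi> (x - t) + - (conj_ker (cutoff m) t * \<psi> (x + t)))"
      unfolding Bochner_Integration.integral_add[OF i i2] using e2 by (simp only: conv_def)
    also have "\<dots> = (LINT t|lborel. 2 * (conj_ker (cutoff m) t * w x t))"
      by (rule Bochner_Integration.integral_cong[OF refl]) (simp add: w_def right_diff_distrib)
    also have "\<dots> = 2 * (LINT t|lborel. conj_ker (cutoff m) t * w x t)" by simp
    finally show ?thesis by simp
  qed
  \<comment> \<open>The principal value of \<psi> against 1 / sinh, written as an absolutely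
    convergent integral.\<close>
  define h where "h x = (LINT t|lborel. 1 / sinh t * w x t)" for x
  have hm: "h \<in> borel_measurable borel" unfolding h_def w_def by measurable
  have dom: "\<bar>conj_ker (cutoff m) t * w x t\<bar> \<le> 4 * L * exp (- (1/2 * \<bar>t\<bar>))" for m t x
  proof -
    have "\<bar>conj_ker (cutoff m) t * w x t\<bar> \<le> 1 / \<bar>sinh t\<bar> * (L * \<bar>t\<bar>)"
      unfolding abs_mult using conj_ker_le_inverse_sinh wL by (intro mult_mono) auto
    also have "\<dots> = L * (\<bar>t\<bar> / \<bar>sinh t\<bar>)" by simp
    also have "\<dots> \<le> L * (4 * exp (- (\<bar>t\<bar> / 2)))" using abs_div_sinh_le L by (intro mult_left_mono)
    finally show ?thesis by simp
  qed
  \<comment> \<open>\<open>w x t\<close> vanishes unless |t| \<ge> |x| - R. On that range half of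
    the decay in t is traded for decay in x at the cost of exp (R/4), which produces a dominating
    function in L_p.\<close>
  have dom2: "\<bar>conj_ker (cutoff m) t * w x t\<bar> \<le> 4 * L * exp (R / 4) * exp (- (1/4 * \<bar>x\<bar>)) * exp (- (1/4 * \<bar>t\<bar>))" for m t x
  proof (cases "\<bar>t\<bar> < \<bar>x\<bar> - R")
    case False
    have "4 * L * exp (- (1/2 * \<bar>t\<bar>)) \<le> 4 * L * exp (R / 4 + - (1/4 * \<bar>x\<bar>) + - (1/4 * \<bar>t\<bar>))"
      using False L by (intro mult_left_mono) auto
    then show ?thesis using dom[of m t x] by (simp only: exp_add mult.assoc)
  qed (use w0 L in simp)
  define G where "G x = 4 * L * exp (R / 4) * (LINT t|lborel. exp (- (1/4 * \<bar>t\<bar>))) * exp (- (1/4 * \<bar>x\<bar>))" for x :: real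
  have i4: "integrable lborel (\<lambda>t::real. exp (- (1/4 * \<bar>t\<bar>)))" by (rule integrable_exp_abs) simp
  have Gb: "\<bar>conv (conj_ker (cutoff m)) \<psi> x\<bar> \<le> \<bar>G x\<bar>" for m x
  proof -
    have "\<bar>conv (conj_ker (cutoff m)) \<psi> x\<bar> \<le> (LINT t|lborel. \<bar>conj_ker (cutoff m) t * w x t\<bar>)"
      unfolding sym by (rule integral_abs_bound)
    also have "\<dots> \<le> (LINT t|lborel. 4 * L * exp (R / 4) * exp (- (1/4 * \<bar>x\<bar>)) * exp (- (1/4 * \<bar>t\<bar>)))"
    proof (rule integral_mono)
      show 1: "integrable lborel (\<lambda>t. 4 * L * exp (R / 4) * exp (- (1/4 * \<bar>x\<bar>)) * exp (- (1/4 * \<bar>t\<bar>)))"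
        using i4 by (rule integrable_mult_right)
      show "integrable lborel (\<lambda>t. \<bar>conj_ker (cutoff m) t * w x t\<bar>)"
        by (rule Bochner_Integration.integrable_bound[OF 1])
          (use dom2 L in \<open>auto simp: w_def abs_mult\<close>)
    qed (rule dom2)
    also have "\<dots> = G x" unfolding G_def by simp
    finally show ?thesis by simp
  qed
  have Gp: "Lp p G"
  proof -
    have "integrable lborel (\<lambda>x::real. \<bar>4 * L * exp (R / 4) * (LINT t|lborel. exp (- (1/4 * \<bar>t\<bar>)))\<bar> powr p * exp (- (p/4 * \<bar>x\<bar>)))"
      using integrable_exp_abs[of "p/4"] p by simp
    moreover have "\<bar>G x\<bar> powr p = \<bar>4 * L * exp (R / 4) * (LINT t|lborel. exp (- (1/4 * \<bar>t\<bar>)))\<bar> powr p * exp (- (p/4 * \<bar>x\<bar>))" for x :: real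
      unfolding G_def abs_mult[of _ "exp (- (1/4 * \<bar>x\<bar>))"] by (subst powr_mult) (auto simp: exp_powr_real mult.commute)
    moreover have "G \<in> borel_measurable borel" unfolding G_def by measurable
    ultimately show ?thesis by (simp add: Lp_def)
  qed
  have pw: "(\<lambda>m. conv (conj_ker (cutoff m)) \<psi> x) \<longlonglongrightarrow> h x" for x
    unfolding sym h_def
  proof (rule integral_dominated_convergence)
    show "integrable lborel (\<lambda>t::real. 4 * L * exp (- (1/2 * \<bar>t\<bar>)))"
      using integrable_exp_abs[of "1/2"] by simp
    show "AE t in lborel. (\<lambda>m. conj_ker (cutoff m) t * w x t) \<longlonglongrightarrow> 1 / sinh t * w x t"
      by (intro AE_I2 tendsto_intros conj_ker_tendsto)
    show "AE t in lborel. norm (conj_ker (cutoff m) t * w x t) \<le> 4 * L * exp (- (1/2 * \<bar>t\<bar>))" for m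
      using dom by (intro AE_I2) simp
  qed (simp_all add: w_def)
  have p0: "p > 0" using p by simp
  have cm: "conv (conj_ker (cutoff m)) \<psi> \<in> borel_measurable borel" for m by measurable
  show ?thesis
    by (rule that[OF Lp_dominated_convergence[OF cm hm Gp p0 pw Gb]])
qed

text \<open>Uniform boundedness together with convergence on a dense class: replacing f by a
  Lipschitz u costs less than e/4 for each of the two operators, and the Cauchy property on u costs
  another e/4.\<close>

lemma phase_ker_conv_limit:
  assumes f: "Lp p f" and p: "p > 1"
  obtains g where "Lp p g" "(\<lambda>m. Lp_norm p (\<lambda>x. conv (phase_ker m) f x - g x)) \<longlonglongrightarrow> 0"
proof -
  have p1: "p \<ge> 1" using p by simp
  obtain C where C: "C \<ge> 0" "\<And>m f. Lp p f \<Longrightarrow> Lp_norm p (conv (phase_ker m) f) \<le> C * Lp_norm p f"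
    using phase_ker_bounded[OF p] by blast
  have cLp: "Lp p (conv (phase_ker m) u)" if "Lp p u" for m u by (rule Young_convolution(2)[OF phase_ker_integrable that p])
  show ?thesis
  proof (rule Lp_complete[OF cLp[OF f] p1])
    fix e :: real assume e: "e > 0"
    define d where "d = e / (4 * (C + 1))"
    have d: "d > 0" using e C by (simp add: d_def)
    have Cd: "C * d < e / 4"
    proof -
      have "C * d < (C + 1) * d" using d by simp
      also have "\<dots> = e / 4" using C by (simp add: d_def field_simps)
      finally show ?thesis .
    qed
    obtain u where u: "lip_compact u" "Lp_norm p (\<lambda>x. f x - u x) < d"
      using lip_approx_Lp[OF f p1] d unfolding lip_approx_def by blast
    have up: "Lp p u" using u p by (intro lip_compact_Lp) auto
    have fu: "Lp p (\<lambda>x. f x - u x)" using Lp_diff(1)[OF f up p1] .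
    have 1: "Lp_norm p (\<lambda>x. conv (phase_ker m) f x - conv (phase_ker m) u x) < e / 4" for m
    proof -
      have "Lp_norm p (\<lambda>x. conv (phase_ker m) f x - conv (phase_ker m) u x) \<le> C * Lp_norm p (\<lambda>x. f x - u x)"
        using C(2)[OF fu, of m] by (simp add: conv_diff_norm[OF phase_ker_integrable f up p])
      also have "\<dots> \<le> C * d" using u C by (intro mult_left_mono) auto
      finally show ?thesis using Cd by simp
    qed
    obtain h where h: "Lp p h" "(\<lambda>m. Lp_norm p (\<lambda>x. conv (conj_ker (cutoff m)) u x - h x)) \<longlonglongrightarrow> 0"
      using conj_ker_conv_lip_compact_limit[OF u(1) p] by blast
    from order_tendstoD(2)[OF h(2), of "e / 4"] e obtain M where
      M: "\<And>m. m \<ge> M \<Longrightarrow> Lp_norm p (\<lambda>x. conv (conj_ker (cutoff m)) u x - h x) < e / 4"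
      by (auto simp: eventually_sequentially)
    have k: "integrable lborel (conj_ker (cutoff m))" for m by (intro strip_ker_integrable cutoff_bounds)
    have kLp: "Lp p (conv (conj_ker (cutoff m)) u)" for m by (rule Young_convolution(2)[OF k up p])
    have um: "u \<in> borel_measurable borel" using Lp_meas[OF up] .
    \<comment> \<open>The \<open>csch_rem\<close> part does not depend on m and cancels in the
      difference.\<close>
    have 2: "Lp_norm p (\<lambda>x. conv (phase_ker m) u x - conv (phase_ker n) u x) < e / 4" if "m \<ge> M" "n \<ge> M" for m n
    proof -
      have "AE x in lborel. conv (phase_ker m) u x - conv (phase_ker n) u x = 1/2 * (conv (conj_ker (cutoff m)) u x - conv (conj_ker (cutoff n)) u x)"
        using conv_lin_left[OF k[of m] csch_rem_integrable up p, of "1/2"] conv_lin_left[OF k[of n] csch_rem_integrable up p, of "1/2"]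
        unfolding phase_ker_def[abs_def] by eventually_elim simp
      then have "Lp_norm p (\<lambda>x. conv (phase_ker m) u x - conv (phase_ker n) u x) = Lp_norm p (\<lambda>x. 1/2 * (conv (conj_ker (cutoff m)) u x - conv (conj_ker (cutoff n)) u x))"
        using um by (intro Lp_norm_cong_AE) auto
      also have "\<dots> = 1/2 * Lp_norm p (\<lambda>x. conv (conj_ker (cutoff m)) u x - conv (conj_ker (cutoff n)) u x)"
        using Lp_scale(2)[OF Lp_diff(1)[OF kLp[of m] kLp[of n] p1], of "1/2"] p by simp
      also have "\<dots> \<le> 1/2 * (Lp_norm p (\<lambda>x. conv (conj_ker (cutoff m)) u x - h x) + Lp_norm p (\<lambda>x. h x - conv (conj_ker (cutoff n)) u x))"
        using Lp_norm_triangle3[OF kLp[of m] h(1) kLp[of n] p1] by simp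
      also have "\<dots> < 1/2 * (e / 4 + e / 4)"
        using M[OF that(1)] M[OF that(2)] Lp_norm_minus_commute[of p h "conv (conj_ker (cutoff n)) u"] by simp
      finally show ?thesis by simp
    qed
    have "Lp_norm p (\<lambda>x. conv (phase_ker m) f x - conv (phase_ker n) f x) < e" if "m \<ge> M" "n \<ge> M" for m n
      using Lp_norm_triangle3[OF cLp[OF f, of m] cLp[OF up, of m] cLp[OF f, of n] p1]
        Lp_norm_triangle3[OF cLp[OF up, of m] cLp[OF up, of n] cLp[OF f, of n] p1]
        1[of m] 1[of n] 2[OF that] Lp_norm_minus_commute[of p "conv (phase_ker n) u" "conv (phase_ker n) f"] e by linarith
    then show "\<exists>M. \<forall>m\<ge>M. \<forall>n\<ge>M. Lp_norm p (\<lambda>x. conv (phase_ker m) f x - conv (phase_ker n) f x) < e" by blast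
  qed (use that in blast)
qed

section \<open>The phase operator on the Fourier side\<close>

lemma interval_integral_0_infinity_eq:
  fixes f :: "real \<Rightarrow> complex"
  shows "(CLBINT x=0..\<infinity>. f x) = (LINT x|lborel. indicator {0<..} x *\<^sub>R f x)"
proof -
  have "einterval 0 \<infinity> = {0<..}" by (auto simp: einterval_def zero_ereal_def)
  then show ?thesis by (simp add: interval_lebesgue_integral_def set_lebesgue_integral_def zero_ereal_def)
qed

lemma exp_half_line:
  fixes z :: complex
  assumes z: "Re z > 0"
  shows "integrable lborel (\<lambda>x. indicator {0<..} x *\<^sub>R exp (- (z * of_real x)))"
    and "(LINT x|lborel. indicator {0<..} x *\<^sub>R exp (- (z * of_real x))) = 1 / z"
proof -
  show i: "integrable lborel (\<lambda>x. indicator {0<..} x *\<^sub>R exp (- (z * of_real x)))"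
  proof (rule Bochner_Integration.integrable_bound[OF integrable_exp_abs[OF z]])
    show "AE x in lborel. norm (indicat_real {0<..} x *\<^sub>R exp (- (z * of_real x))) \<le> norm (exp (- (Re z * \<bar>x\<bar>)))"
      by (intro AE_I2) (auto simp: indicator_def)
    have "continuous_on UNIV (\<lambda>x. exp (- (z * complex_of_real x)))" by (intro continuous_intros)
    then show "(\<lambda>x. indicat_real {0<..} x *\<^sub>R exp (- (z * of_real x))) \<in> borel_measurable lborel"
      by (auto intro!: borel_measurable_scaleR borel_measurable_continuous_onI)
  qed
  have z0: "z \<noteq> 0" using z by auto
  define F where "F x = - exp (- (z * complex_of_real x)) / z" for x :: real
  have D: "(F has_vector_derivative exp (- (z * of_real x))) (at x)" for x
  proof -
    have "((\<lambda>x. - exp (- (z * x)) / z) has_field_derivative exp (- (z * of_real x))) (at (of_real x))"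
      using z0 by (auto intro!: derivative_eq_intros)
    then show ?thesis unfolding F_def by (rule has_vector_derivative_real_field)
  qed
  have ei: "einterval 0 \<infinity> = {0<..}" by (auto simp: einterval_def zero_ereal_def)
  have "(CLBINT x=0..\<infinity>. exp (- (z * of_real x))) = 0 - (- 1 / z)"
  proof (rule interval_integral_FTC_integrable)
    show "(F has_vector_derivative exp (- (z * of_real x))) (at x)" for x by (rule D)
    show "isCont (\<lambda>x. exp (- (z * complex_of_real x))) x" for x by (intro continuous_intros)
    show "set_integrable lborel (einterval 0 \<infinity>) (\<lambda>x. exp (- (z * complex_of_real x)))"
      using i by (simp add: ei set_integrable_def)
    have "isCont F 0" unfolding F_def using z0 by (intro continuous_intros) auto
    then have "(F \<longlongrightarrow> - 1 / z) (at_right 0)"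
      by (auto simp: isCont_def F_def intro: filterlim_at_split[THEN iffD1, THEN conjunct2])
    then show "((F \<circ> real_of_ereal) \<longlongrightarrow> - 1 / z) (at_right 0)"
      by (simp add: ereal_tendsto_simps zero_ereal_def)
    have "(F \<longlongrightarrow> 0) at_top"
    proof (rule Lim_null_comparison)
      show "\<forall>\<^sub>F x in at_top. norm (F x) \<le> exp (- (Re z * x)) / cmod z"
        by (intro always_eventually allI) (simp add: F_def norm_divide)
      have "((\<lambda>x. exp (- (Re z * x))) \<longlongrightarrow> 0) at_top" using z
        by (intro filterlim_compose[OF exp_at_bot] filterlim_compose[OF filterlim_uminus_at_bot_at_top]
          filterlim_tendsto_pos_mult_at_top[OF tendsto_const] filterlim_ident)
      then show "((\<lambda>x. exp (- (Re z * x)) / cmod z) \<longlongrightarrow> 0) at_top"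
        using tendsto_divide_zero by blast
    qed
    then show "((F \<circ> real_of_ereal) \<longlongrightarrow> 0) (at_left \<infinity>)" by (simp add: ereal_tendsto_simps)
  qed simp
  then show "(LINT x|lborel. indicator {0<..} x *\<^sub>R exp (- (z * of_real x))) = 1 / z"
    by (simp add: interval_integral_0_infinity_eq)
qed

lemma integrable_cis_mult:
  fixes w :: "real \<Rightarrow> complex"
  assumes "integrable lborel w"
  shows "integrable lborel (\<lambda>\<xi>. w \<xi> * cis (x * \<xi>))"
proof -
  have "continuous_on UNIV (\<lambda>\<xi>. cis (x * \<xi>))" by (intro continuous_intros)
  then have [measurable]: "(\<lambda>\<xi>. cis (x * \<xi>)) \<in> borel_measurable borel" by (rule borel_measurable_continuous_onI)
  show ?thesis
    by (rule Bochner_Integration.integrable_bound[OF assms])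
      (use assms in \<open>auto simp: norm_mult intro!: AE_I2\<close>)
qed

text \<open>The two half-lines contribute 1 / z and 1 / cnj z. Used with a = 1 to obtain the
  arctangent and with small a as the Poisson kernel of the inversion formula.\<close>

lemma exp_abs_cis:
  assumes a: "a > 0"
  shows "(LINT x|lborel. complex_of_real (exp (- (a * \<bar>x\<bar>))) * cis (s * x)) = complex_of_real (2 * a / (a\<^sup>2 + s\<^sup>2))"
proof -
  define z where "z = Complex a (- s)"
  define g where "g x = complex_of_real (exp (- (a * \<bar>x\<bar>))) * cis (s * x)" for x
  have gi: "integrable lborel g"
    unfolding g_def by (rule integrable_cis_mult) (use integrable_exp_abs[OF a] in \<open>simp add: integrable_of_real\<close>)
  have z: "Re z > 0" "Re (cnj z) > 0" using a by (auto simp: z_def)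
  have e1: "indicator {0<..} x *\<^sub>R exp (- (z * of_real x)) = indicator {0<..} x *\<^sub>R g x" for x
    by (auto simp: indicator_def g_def z_def exp_eq_polar complex_eq_iff)
  have e2: "indicator {0<..} x *\<^sub>R exp (- (cnj z * of_real x)) = indicator {0<..} x *\<^sub>R g (- x)" for x
    by (auto simp: indicator_def g_def z_def exp_eq_polar complex_eq_iff)
  note I1 = exp_half_line[OF z(1), unfolded e1] and I2 = exp_half_line[OF z(2), unfolded e2]
  have I3: "integrable lborel (\<lambda>x. indicator {0<..} (- x) *\<^sub>R g x)"
      "(LINT x|lborel. indicator {0<..} (- x) *\<^sub>R g x) = 1 / cnj z"
    using I2 lborel_integrable_shift(4)[of "\<lambda>x. indicator {0<..} x *\<^sub>R g (- x)"]
      lborel_integral_shift(4)[of "\<lambda>x. indicator {0<..} x *\<^sub>R g (- x)"] by auto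
  have [measurable]: "g \<in> borel_measurable borel" using gi by auto
  have "(LINT x|lborel. g x) = (LINT x|lborel. indicator {0<..} x *\<^sub>R g x + indicator {0<..} (- x) *\<^sub>R g x)"
  proof (rule integral_cong_AE)
    show "AE x in lborel. g x = indicator {0<..} x *\<^sub>R g x + indicator {0<..} (- x) *\<^sub>R g x"
      using AE_lborel_singleton[of 0] by eventually_elim (auto simp: indicator_def)
  qed measurable
  also have "\<dots> = 1 / z + 1 / cnj z"
    using I1 I3 by (simp add: Bochner_Integration.integral_add)
  also have "\<dots> = (cnj z + z) / (z * cnj z)"
  proof -
    have "z \<noteq> 0" "cnj z \<noteq> 0" using z by auto
    then show ?thesis by (simp add: add_frac_eq)
  qed
  also have "\<dots> = complex_of_real (2 * a / (a\<^sup>2 + s\<^sup>2))"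
    unfolding complex_mult_cnj by (simp add: z_def complex_eq_iff Re_divide_of_real Im_divide_of_real)
  finally show ?thesis by (simp add: g_def)
qed

lemma exp_abs_cos: "(LINT x|lborel. exp (- \<bar>x\<bar>) * cos (s * x)) = 2 / (1 + s\<^sup>2)" for s :: real
proof -
  have i: "integrable lborel (\<lambda>x. complex_of_real (exp (- (1 * \<bar>x\<bar>))) * cis (s * x))"
    by (rule integrable_cis_mult) (use integrable_exp_abs[of 1] in \<open>simp add: integrable_of_real\<close>)
  have "(LINT x|lborel. exp (- \<bar>x\<bar>) * cos (s * x)) = (LINT x|lborel. Re (complex_of_real (exp (- (1 * \<bar>x\<bar>))) * cis (s * x)))"
    by simp
  also have "\<dots> = Re (LINT x|lborel. complex_of_real (exp (- (1 * \<bar>x\<bar>))) * cis (s * x))"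
    by (rule integral_Re[OF i])
  also have "\<dots> = Re (complex_of_real (2 * 1 / (1\<^sup>2 + s\<^sup>2)))" by (subst exp_abs_cis) simp_all
  finally show ?thesis by simp
qed

text \<open>For x \<noteq> 0, sin (x s) / x is the integral of cos (t x) over t in [0, s]; after the
  interchange the inner integral is 2 / (1 + t^2). Negative s follow by oddness.\<close>

lemma exp_abs_sin_over_x: "(LINT x|lborel. exp (- \<bar>x\<bar>) * (sin (x * s) / x)) = 2 * arctan s" for s :: real
proof -
  have pos: "(LINT x|lborel. exp (- \<bar>x\<bar>) * (sin (x * s) / x)) = 2 * arctan s" if s: "s \<ge> 0" for s
  proof -
    have in1: "(LINT t|lborel. indicator {0..s} t * cos (t * x)) = sin (x * s) / x" if "x \<noteq> 0" for x
    proof -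
      have "(LINT t|lborel. indicator {0..s} t *\<^sub>R cos (t * x)) = sin (s * x) / x - sin (0 * x) / x"
        using s that
        by (intro integral_FTC_Icc) (auto intro!: derivative_eq_intros continuous_intros simp: has_real_derivative_iff_has_vector_derivative[symmetric])
      then show ?thesis by (simp add: mult.commute)
    qed
    have "(LINT x|lborel. exp (- \<bar>x\<bar>) * (sin (x * s) / x)) = (LINT x|lborel. LINT t|lborel. exp (- \<bar>x\<bar>) * (indicator {0..s} t * cos (t * x)))"
    proof (rule integral_cong_AE)
      show "AE x in lborel. exp (- \<bar>x\<bar>) * (sin (x * s) / x) = (LINT t|lborel. exp (- \<bar>x\<bar>) * (indicator {0..s} t * cos (t * x)))"
        using AE_lborel_singleton[of 0] by eventually_elim (simp add: in1)
    qed measurable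
    also have "\<dots> = (LINT t|lborel. LINT x|lborel. exp (- \<bar>x\<bar>) * (indicator {0..s} t * cos (t * x)))"
    proof (rule Fubini_swap(4))
      have i1: "integrable lborel (\<lambda>x. exp (- \<bar>x\<bar>) * \<bar>cos (t * x)\<bar>)" for t :: real
        by (rule Bochner_Integration.integrable_bound[OF integrable_exp_abs[of 1]]) (auto simp: abs_mult mult_left_le intro!: AE_I2)
      show "AE t in lborel. integrable lborel (\<lambda>x. exp (- \<bar>x\<bar>) * (indicator {0..s} t * cos (t * x)))"
        by (intro AE_I2, rule Bochner_Integration.integrable_bound[OF i1]) (auto simp: abs_mult indicator_def intro!: AE_I2)
      define c where "c = (LINT x::real|lborel. exp (- \<bar>x\<bar>))"
      have ie: "integrable lborel (\<lambda>x::real. exp (- \<bar>x\<bar>))" using integrable_exp_abs[of 1] by simp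
      have c: "(LINT x|lborel. exp (- \<bar>x\<bar>) * \<bar>cos (t * x)\<bar>) \<le> c" for t :: real
        unfolding c_def using i1 ie by (intro integral_mono) (auto simp: mult_left_le)
      have "integrable lborel (\<lambda>t. indicator {0..s} t * c)"
        by (intro integrable_mult_left integrable_real_indicator) (auto simp: emeasure_lborel_Icc_eq)
      then show "integrable lborel (\<lambda>t. LINT x|lborel. norm (exp (- \<bar>x\<bar>) * (indicator {0..s} t * cos (t * x))))"
      proof (rule Bochner_Integration.integrable_bound)
        show "AE t in lborel. norm (LINT x|lborel. norm (exp (- \<bar>x\<bar>) * (indicator {0..s} t * cos (t * x)))) \<le> norm (indicator {0..s} t * c)"
        proof (rule AE_I2)
          fix t :: real
          have "0 \<le> (LINT x|lborel. exp (- \<bar>x\<bar>) * \<bar>cos (t * x)\<bar>)" by (intro integral_nonneg_AE AE_I2) auto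
          then show "norm (LINT x|lborel. norm (exp (- \<bar>x\<bar>) * (indicator {0..s} t * cos (t * x)))) \<le> norm (indicator {0..s} t * c)"
            using order_trans[OF c[of t] abs_ge_self] by (simp add: indicator_def abs_mult)
        qed
      qed measurable
    qed measurable
    also have "\<dots> = (LINT t|lborel. indicator {0..s} t *\<^sub>R (2 / (1 + t\<^sup>2)))"
    proof (rule Bochner_Integration.integral_cong[OF refl])
      fix t
      have "(LINT x|lborel. exp (- \<bar>x\<bar>) * (indicator {0..s} t * cos (t * x))) = indicator {0..s} t * (LINT x|lborel. exp (- \<bar>x\<bar>) * cos (t * x))"
        by (subst integral_mult_right_zero[symmetric]) (simp add: mult_ac)
      then show "(LINT x|lborel. exp (- \<bar>x\<bar>) * (indicator {0..s} t * cos (t * x))) = indicator {0..s} t *\<^sub>R (2 / (1 + t\<^sup>2))"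
        by (simp add: exp_abs_cos)
    qed
    also have "\<dots> = 2 * arctan s - 2 * arctan 0"
    proof (rule integral_FTC_Icc[OF s])
      have nz: "1 + t\<^sup>2 \<noteq> 0" for t :: real using zero_le_power2[of t] by linarith
      show "((\<lambda>t. 2 * arctan t) has_vector_derivative 2 / (1 + t\<^sup>2)) (at t within {0..s})" for t
        unfolding has_real_derivative_iff_has_vector_derivative[symmetric]
        by (auto intro!: derivative_eq_intros simp: divide_inverse)
      show "continuous_on {0..s} (\<lambda>t. 2 / (1 + t\<^sup>2))" using nz by (intro continuous_intros) auto
    qed
    finally show ?thesis by simp
  qed
  show ?thesis
  proof (cases "s \<ge> 0")
    case False
    have "(LINT x|lborel. exp (- \<bar>x\<bar>) * (sin (x * s) / x)) = - (LINT x|lborel. exp (- \<bar>x\<bar>) * (sin (x * (- s)) / x))"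
      by simp
    also have "\<dots> = 2 * arctan s" using pos[of "- s"] False by (simp only: arctan_minus)
    finally show ?thesis .
  qed (rule pos)
qed

section \<open>Multipliers of the truncated kernels\<close>

definition kernel_fourier :: "(real \<Rightarrow> real) \<Rightarrow> real \<Rightarrow> complex" where
  "kernel_fourier k \<xi> = (LINT t|lborel. of_real (k t) * cis (- \<xi> * t))"

definition phase_mult :: "real \<Rightarrow> complex" where "phase_mult \<xi> = - \<i> * of_real (arctan \<xi>)"

lemma phase_mult_measurable [measurable]: "phase_mult \<in> borel_measurable borel"
  unfolding phase_mult_def[abs_def] by (intro borel_measurable_continuous_onI continuous_intros)

lemma phase_mult_bound: "cmod (phase_mult \<xi>) \<le> 2"
  using arctan_bounded[of \<xi>] pi_less_4 by (simp add: phase_mult_def norm_mult abs_le_iff)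

lemma cis_measurable [measurable (raw)]:
  "f \<in> borel_measurable M \<Longrightarrow> (\<lambda>x. cis (f x)) \<in> borel_measurable M"
  by (rule measurable_compose[of f M borel]) (auto intro!: borel_measurable_continuous_onI continuous_intros)

lemma kernel_fourier_odd:
  assumes k: "integrable lborel k" and odd: "\<And>t. k (- t) = - k t"
  shows "kernel_fourier k \<xi> = - \<i> * of_real (LINT t|lborel. k t * sin (t * \<xi>))"
proof -
  have [measurable]: "k \<in> borel_measurable borel" using k by auto
  have ik: "integrable lborel (\<lambda>t. complex_of_real (k t) * cis (- \<xi> * t))"
    by (rule integrable_cis_mult) (use k in \<open>simp add: integrable_of_real\<close>)
  have ic: "integrable lborel (\<lambda>t. k t * cos (\<xi> * t))"
    by (rule Bochner_Integration.integrable_bound[OF k]) (auto simp: abs_mult mult_left_le intro!: AE_I2)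
  have "(LINT t|lborel. k t * cos (\<xi> * t)) = - (LINT t|lborel. k t * cos (\<xi> * t))"
    using lborel_integral_shift(4)[of "\<lambda>t. k t * cos (\<xi> * t)"] by (simp add: odd)
  then have c0: "(LINT t|lborel. k t * cos (\<xi> * t)) = 0" by simp
  have Re: "Re (kernel_fourier k \<xi>) = 0"
    unfolding kernel_fourier_def integral_Re[OF ik, symmetric] using c0 by simp
  have Im: "Im (kernel_fourier k \<xi>) = - (LINT t|lborel. k t * sin (t * \<xi>))"
    unfolding kernel_fourier_def integral_Im[OF ik, symmetric] by (simp add: mult.commute)
  show ?thesis by (simp add: complex_eq_iff Re Im)
qed

text \<open>Uniform in m: the sine supplies the factor |t| that the limit kernel lacks for
  integrability, at the price of a factor |\<xi>|. That factor is the reason for the weight in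
  \<open>decaying\<close>.\<close>

lemma phase_ker_sin_bound: "\<bar>phase_ker m t * sin (t * \<xi>)\<bar> \<le> \<bar>\<xi>\<bar> * (4 * exp (- (1/2 * \<bar>t\<bar>)))"
proof -
  have "\<bar>phase_ker m t\<bar> \<le> 1/2 * (1 / \<bar>sinh t\<bar> + 2 * exp (- \<bar>t\<bar>))"
    unfolding phase_ker_def abs_mult using conj_ker_le_inverse_sinh[of "cutoff m" t] csch_rem_bound[of t] by simp
  then have "\<bar>phase_ker m t * sin (t * \<xi>)\<bar> \<le> 1/2 * (1 / \<bar>sinh t\<bar> + 2 * exp (- \<bar>t\<bar>)) * (\<bar>t\<bar> * \<bar>\<xi>\<bar>)"
    unfolding abs_mult using abs_sin_x_le_abs_x[of "t * \<xi>"] by (intro mult_mono) (auto simp: abs_mult)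
  also have "\<dots> = \<bar>\<xi>\<bar> * (1/2 * (\<bar>t\<bar> / \<bar>sinh t\<bar>) + \<bar>t\<bar> * exp (- \<bar>t\<bar>))" by (simp add: algebra_simps)
  also have "\<dots> \<le> \<bar>\<xi>\<bar> * (2 * exp (- (1/2 * \<bar>t\<bar>)) + 2 * exp (- (1/2 * \<bar>t\<bar>)))"
  proof (intro mult_left_mono add_mono)
    show "1/2 * (\<bar>t\<bar> / \<bar>sinh t\<bar>) \<le> 2 * exp (- (1/2 * \<bar>t\<bar>))" using abs_div_sinh_le[of t] by simp
    have "\<bar>t\<bar> * exp (- \<bar>t\<bar>) \<le> 2 * exp (1/2 * \<bar>t\<bar>) * exp (- \<bar>t\<bar>)"
    proof (rule mult_right_mono)
      show "\<bar>t\<bar> \<le> 2 * exp (1/2 * \<bar>t\<bar>)" using exp_ge_add_one_self[of "1/2 * \<bar>t\<bar>"] by linarith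
    qed simp
    also have "\<dots> = 2 * exp (- (1/2 * \<bar>t\<bar>))" by (simp add: mult.assoc exp_add[symmetric])
    finally show "\<bar>t\<bar> * exp (- \<bar>t\<bar>) \<le> 2 * exp (- (1/2 * \<bar>t\<bar>))" .
  qed auto
  finally show ?thesis by simp
qed

lemma phase_ker_kernel_fourier_tendsto: "(\<lambda>m. kernel_fourier (phase_ker m) \<xi>) \<longlonglongrightarrow> phase_mult \<xi>"
proof -
  have "(\<lambda>m. LINT t|lborel. phase_ker m t * sin (t * \<xi>)) \<longlonglongrightarrow> (LINT t|lborel. 1/2 * (exp (- \<bar>t\<bar>) * (sin (t * \<xi>) / t)))"
  proof (rule integral_dominated_convergence)
    show "integrable lborel (\<lambda>t. \<bar>\<xi>\<bar> * (4 * exp (- (1/2 * \<bar>t\<bar>))))"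
      by (intro integrable_mult_right integrable_exp_abs) simp
    show "AE t in lborel. (\<lambda>m. phase_ker m t * sin (t * \<xi>)) \<longlonglongrightarrow> 1/2 * (exp (- \<bar>t\<bar>) * (sin (t * \<xi>) / t))"
    proof (rule AE_I2)
      fix t :: real
      have "(\<lambda>m. phase_ker m t * sin (t * \<xi>)) \<longlonglongrightarrow> 1/2 * (1 / sinh t + csch_rem t) * sin (t * \<xi>)"
        unfolding phase_ker_def by (intro tendsto_intros conj_ker_tendsto)
      then show "(\<lambda>m. phase_ker m t * sin (t * \<xi>)) \<longlonglongrightarrow> 1/2 * (exp (- \<bar>t\<bar>) * (sin (t * \<xi>) / t))"
        by (simp add: csch_rem_def)
    qed
    show "AE t in lborel. norm (phase_ker m t * sin (t * \<xi>)) \<le> \<bar>\<xi>\<bar> * (4 * exp (- (1/2 * \<bar>t\<bar>)))" for m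
      using phase_ker_sin_bound by (intro AE_I2) simp
  qed measurable
  moreover have "(LINT t|lborel. 1/2 * (exp (- \<bar>t\<bar>) * (sin (t * \<xi>) / t))) = arctan \<xi>"
    unfolding integral_mult_right_zero exp_abs_sin_over_x by simp
  ultimately have "(\<lambda>m. LINT t|lborel. phase_ker m t * sin (t * \<xi>)) \<longlonglongrightarrow> arctan \<xi>" by simp
  then show ?thesis unfolding phase_mult_def kernel_fourier_odd[OF phase_ker_integrable phase_ker_odd] by (intro tendsto_intros)
qed

lemma phase_ker_kernel_fourier_bound: "cmod (kernel_fourier (phase_ker m) \<xi>) \<le> (LINT t|lborel. 4 * exp (- (1/2 * \<bar>t\<bar>))) * \<bar>\<xi>\<bar>"
proof -
  have i: "integrable lborel (\<lambda>t. \<bar>\<xi>\<bar> * (4 * exp (- (1/2 * \<bar>t\<bar>))))"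
    by (intro integrable_mult_right integrable_exp_abs) simp
  have "cmod (kernel_fourier (phase_ker m) \<xi>) = \<bar>LINT t|lborel. phase_ker m t * sin (t * \<xi>)\<bar>"
    unfolding kernel_fourier_odd[OF phase_ker_integrable phase_ker_odd] by (simp add: norm_mult)
  also have "\<dots> \<le> (LINT t|lborel. \<bar>phase_ker m t * sin (t * \<xi>)\<bar>)" by (rule integral_abs_bound)
  also have "\<dots> \<le> (LINT t|lborel. \<bar>\<xi>\<bar> * (4 * exp (- (1/2 * \<bar>t\<bar>))))"
  proof (rule integral_mono[OF _ i phase_ker_sin_bound])
    show "integrable lborel (\<lambda>t. \<bar>phase_ker m t * sin (t * \<xi>)\<bar>)"
      by (rule Bochner_Integration.integrable_bound[OF i])
        (use phase_ker_sin_bound[of m _ \<xi>] in \<open>auto intro!: AE_I2 order_trans[OF _ abs_ge_self]\<close>)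
  qed
  finally show ?thesis by (simp add: mult.commute)
qed

lemma kernel_fourier_measurable [measurable]:
  assumes [measurable]: "k \<in> borel_measurable borel"
  shows "kernel_fourier k \<in> borel_measurable borel"
  unfolding kernel_fourier_def[abs_def] by measurable

text \<open>The factor 1/(2 \<pi>) is left to \<open>w\<close>. Taking the real part commutes with
  convolution by real kernels, so only real functions occur on the space side.\<close>

definition Finv :: "(real \<Rightarrow> complex) \<Rightarrow> real \<Rightarrow> real" where
  "Finv w x = Re (LINT \<xi>|lborel. w \<xi> * cis (x * \<xi>))"

lemma Finv_measurable [measurable]:
  assumes [measurable]: "w \<in> borel_measurable borel"
  shows "Finv w \<in> borel_measurable borel"
  unfolding Finv_def[abs_def] by measurable

lemma Finv_bound:
  assumes "integrable lborel w"
  shows "\<bar>Finv w x\<bar> \<le> (LINT \<xi>|lborel. cmod (w \<xi>))"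
proof -
  have "\<bar>Finv w x\<bar> \<le> cmod (LINT \<xi>|lborel. w \<xi> * cis (x * \<xi>))" unfolding Finv_def by (rule abs_Re_le_cmod)
  also have "\<dots> \<le> (LINT \<xi>|lborel. cmod (w \<xi> * cis (x * \<xi>)))" by (rule integral_norm_bound)
  finally show ?thesis by (simp add: norm_mult)
qed

lemma Finv_conv:
  assumes k: "integrable lborel k" and w: "integrable lborel w"
  shows "conv k (Finv w) x = Finv (\<lambda>\<xi>. kernel_fourier k \<xi> * w \<xi>) x"
proof -
  have [measurable]: "k \<in> borel_measurable borel" "w \<in> borel_measurable borel" using k w by auto
  define f where "f t \<xi> = complex_of_real (k t) * (w \<xi> * cis ((x - t) * \<xi>))" for t \<xi>
  have m: "(\<lambda>(t, \<xi>). f t \<xi>) \<in> borel_measurable (lborel \<Otimes>\<^sub>M lborel)" unfolding f_def by measurable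
  have 1: "AE t in lborel. integrable lborel (f t)"
    unfolding f_def by (intro AE_I2 integrable_mult_right integrable_cis_mult w)
  have 2: "integrable lborel (\<lambda>t. LINT \<xi>|lborel. norm (f t \<xi>))"
    using k by (simp add: f_def norm_mult)
  note F = Fubini_swap[OF m 1 2]
  have e1: "(LINT \<xi>|lborel. f t \<xi>) = of_real (k t) * (LINT \<xi>|lborel. w \<xi> * cis ((x - t) * \<xi>))" for t
    unfolding f_def by simp
  have e2: "(LINT t|lborel. f t \<xi>) = kernel_fourier k \<xi> * w \<xi> * cis (x * \<xi>)" for \<xi>
  proof -
    have "f t \<xi> = (complex_of_real (k t) * cis (- \<xi> * t)) * (w \<xi> * cis (x * \<xi>))" for t
    proof -
      have "cis ((x - t) * \<xi>) = cis (- \<xi> * t) * cis (x * \<xi>)" by (simp add: cis_mult algebra_simps)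
      then show ?thesis unfolding f_def by (simp only: mult.assoc mult.left_commute)
    qed
    then show ?thesis by (simp add: kernel_fourier_def)
  qed
  have "conv k (Finv w) x = (LINT t|lborel. Re (LINT \<xi>|lborel. f t \<xi>))"
    unfolding conv_def Finv_def e1 by simp
  also have "\<dots> = Re (LINT t|lborel. LINT \<xi>|lborel. f t \<xi>)" by (rule integral_Re[OF F(3)])
  also have "\<dots> = Re (LINT \<xi>|lborel. LINT t|lborel. f t \<xi>)" using F(4) by simp
  also have "\<dots> = Finv (\<lambda>\<xi>. kernel_fourier k \<xi> * w \<xi>) x" unfolding e2 Finv_def ..
  finally show ?thesis .
qed

text \<open>The weight dominates the truncated multipliers, which are bounded by a fixed multiple of
  |\<xi>| for all m. The class is stable under bounded measurable factors, hence under the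
  phase.\<close>

definition decaying :: "(real \<Rightarrow> complex) \<Rightarrow> bool" where
  "decaying w \<longleftrightarrow> integrable lborel w \<and> integrable lborel (\<lambda>\<xi>. \<bar>\<xi>\<bar> * cmod (w \<xi>))"

lemma decaying_mult:
  assumes w: "decaying w" and [measurable]: "u \<in> borel_measurable borel" and B: "\<And>\<xi>. cmod (u \<xi>) \<le> B"
  shows "decaying (\<lambda>\<xi>. u \<xi> * w \<xi>)"
proof -
  have B0: "B \<ge> 0" using order_trans[OF norm_ge_zero B] .
  have w': "integrable lborel w" "integrable lborel (\<lambda>\<xi>. \<bar>\<xi>\<bar> * cmod (w \<xi>))" using w by (auto simp: decaying_def)
  have [measurable]: "w \<in> borel_measurable borel" using w' by auto
  have "integrable lborel (\<lambda>\<xi>. u \<xi> * w \<xi>)"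
  proof (rule Bochner_Integration.integrable_bound)
    show "integrable lborel (\<lambda>\<xi>. of_real B * w \<xi>)" using w'(1) by (rule integrable_mult_right)
    show "AE \<xi> in lborel. norm (u \<xi> * w \<xi>) \<le> norm (of_real B * w \<xi>)"
      using B B0 by (intro AE_I2) (auto simp: norm_mult intro!: mult_right_mono)
  qed measurable
  moreover have "integrable lborel (\<lambda>\<xi>. \<bar>\<xi>\<bar> * cmod (u \<xi> * w \<xi>))"
  proof (rule Bochner_Integration.integrable_bound)
    show "integrable lborel (\<lambda>\<xi>. B * (\<bar>\<xi>\<bar> * cmod (w \<xi>)))" using w'(2) by (rule integrable_mult_right)
    show "AE \<xi> in lborel. norm (\<bar>\<xi>\<bar> * cmod (u \<xi> * w \<xi>)) \<le> norm (B * (\<bar>\<xi>\<bar> * cmod (w \<xi>)))"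
    proof (rule AE_I2)
      fix \<xi>
      have "\<bar>\<xi>\<bar> * (cmod (u \<xi>) * cmod (w \<xi>)) \<le> \<bar>\<xi>\<bar> * (B * cmod (w \<xi>))"
        using B by (intro mult_left_mono mult_right_mono) auto
      then show "norm (\<bar>\<xi>\<bar> * cmod (u \<xi> * w \<xi>)) \<le> norm (B * (\<bar>\<xi>\<bar> * cmod (w \<xi>)))"
        using B0 by (simp add: norm_mult abs_mult mult_ac)
    qed
  qed measurable
  ultimately show ?thesis by (simp add: decaying_def)
qed

lemma Finv_phase_ker_tendsto:
  assumes w: "decaying w"
  shows "(\<lambda>m. conv (phase_ker m) (Finv w) x) \<longlonglongrightarrow> Finv (\<lambda>\<xi>. phase_mult \<xi> * w \<xi>) x"
proof -
  have w': "integrable lborel w" "integrable lborel (\<lambda>\<xi>. \<bar>\<xi>\<bar> * cmod (w \<xi>))" using w by (auto simp: decaying_def)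
  have [measurable]: "w \<in> borel_measurable borel" using w' by auto
  define c where "c = (LINT t::real|lborel. 4 * exp (- (1/2 * \<bar>t\<bar>)))"
  have "(\<lambda>m. LINT \<xi>|lborel. kernel_fourier (phase_ker m) \<xi> * w \<xi> * cis (x * \<xi>)) \<longlonglongrightarrow> (LINT \<xi>|lborel. phase_mult \<xi> * w \<xi> * cis (x * \<xi>))"
  proof (rule integral_dominated_convergence)
    show "integrable lborel (\<lambda>\<xi>. c * (\<bar>\<xi>\<bar> * cmod (w \<xi>)))" using w'(2) by (rule integrable_mult_right)
    show "AE \<xi> in lborel. (\<lambda>m. kernel_fourier (phase_ker m) \<xi> * w \<xi> * cis (x * \<xi>)) \<longlonglongrightarrow> phase_mult \<xi> * w \<xi> * cis (x * \<xi>)"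
      by (intro AE_I2 tendsto_intros phase_ker_kernel_fourier_tendsto)
    show "AE \<xi> in lborel. norm (kernel_fourier (phase_ker m) \<xi> * w \<xi> * cis (x * \<xi>)) \<le> c * (\<bar>\<xi>\<bar> * cmod (w \<xi>))" for m
    proof (rule AE_I2)
      fix \<xi>
      have "cmod (kernel_fourier (phase_ker m) \<xi>) * cmod (w \<xi>) \<le> (c * \<bar>\<xi>\<bar>) * cmod (w \<xi>)"
        using phase_ker_kernel_fourier_bound[of m \<xi>] by (intro mult_right_mono) (auto simp: c_def)
      then show "norm (kernel_fourier (phase_ker m) \<xi> * w \<xi> * cis (x * \<xi>)) \<le> c * (\<bar>\<xi>\<bar> * cmod (w \<xi>))"
        by (simp add: norm_mult mult.assoc)
    qed
  qed measurable
  then show ?thesis unfolding Finv_conv[OF phase_ker_integrable w'(1)] Finv_def by (rule tendsto_Re)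
qed

text \<open>Identifies an abstract limit supplied by completeness with an explicit pointwise one:
  Fatou applied to the tails of F n - g.\<close>

lemma Lp_limit_pointwise:
  assumes F: "\<And>n::nat. Lp p (F n)" and g: "Lp p g" and p: "p \<ge> 1"
    and lim: "(\<lambda>n. Lp_norm p (\<lambda>x. F n x - g x)) \<longlonglongrightarrow> 0"
    and f: "f \<in> borel_measurable borel" and pw: "\<And>x. (\<lambda>n. F n x) \<longlonglongrightarrow> f x"
  shows "Lp p f" "Lp_norm p (\<lambda>x. f x - g x) = 0"
proof -
  have *: "Lp p (\<lambda>x. f x - g x) \<and> Lp_norm p (\<lambda>x. f x - g x) \<le> e" if e: "e > 0" for e
  proof -
    from order_tendstoD(2)[OF lim e] obtain M where
      M: "\<And>n. n \<ge> M \<Longrightarrow> Lp_norm p (\<lambda>x. F n x - g x) < e" by (auto simp: eventually_sequentially)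
    have 1: "Lp p (\<lambda>x. F (n + M) x - g x)" for n using F g p by (intro Lp_diff) auto
    have 2: "Lp_norm p (\<lambda>x. F (n + M) x - g x) \<le> e" for n using M[of "n + M"] by simp
    have 3: "AE x in lborel. (\<lambda>n. F (n + M) x - g x) \<longlonglongrightarrow> f x - g x"
      using LIMSEQ_ignore_initial_segment[OF pw] by (intro AE_I2 tendsto_diff tendsto_const)
    have 4: "(\<lambda>x. f x - g x) \<in> borel_measurable borel" using f Lp_meas[OF g] by measurable
    show ?thesis using Lp_Fatou[OF 1 2 _ 4 3] p by auto
  qed
  have 1: "Lp p (\<lambda>x. f x - g x)" using *[of 1] by simp
  show "Lp p f" using Lp_add[OF 1 g p] by simp
  show "Lp_norm p (\<lambda>x. f x - g x) = 0"
    by (rule antisym[OF _ Lp_norm_nonneg], rule field_le_epsilon) (use * in simp)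
qed

lemma Lp_pairing_tendsto:
  assumes F: "\<And>n::nat. Lp p (F n)" and g: "Lp p g" and u: "Lp q u"
    and pq: "p > 1" "q > 1" "1/p + 1/q = 1"
    and lim: "(\<lambda>n. Lp_norm p (\<lambda>x. F n x - g x)) \<longlonglongrightarrow> 0"
  shows "(\<lambda>n. LINT x|lborel. F n x * u x) \<longlonglongrightarrow> (LINT x|lborel. g x * u x)"
proof -
  have le: "norm ((LINT x|lborel. F n x * u x) - (LINT x|lborel. g x * u x)) \<le> Lp_norm p (\<lambda>x. F n x - g x) * Lp_norm q u" for n
  proof -
    have d: "Lp p (\<lambda>x. F n x - g x)" using F g pq by (intro Lp_diff) auto
    have "(LINT x|lborel. F n x * u x) - (LINT x|lborel. g x * u x) = (LINT x|lborel. (F n x - g x) * u x)"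
      using Hoelder(1)[OF F u pq, of n] Hoelder(1)[OF g u pq] by (simp add: left_diff_distrib)
    then show ?thesis using Hoelder(3)[OF d u pq] by simp
  qed
  have "(\<lambda>n. (LINT x|lborel. F n x * u x) - (LINT x|lborel. g x * u x)) \<longlonglongrightarrow> 0"
    by (rule Lim_null_comparison[OF always_eventually[rule_format, OF le]])
      (use tendsto_mult_left_zero[OF lim] in simp)
  then show ?thesis by (rule LIM_zero_cancel)
qed

text \<open>The graph of A on L_p; a relation, because g is determined only up to null sets.\<close>

definition phase_log :: "real \<Rightarrow> (real \<Rightarrow> real) \<Rightarrow> (real \<Rightarrow> real) \<Rightarrow> bool" where
  "phase_log p f g \<longleftrightarrow> Lp p f \<and> Lp p g \<and> (\<lambda>m. Lp_norm p (\<lambda>x. conv (phase_ker m) f x - g x)) \<longlonglongrightarrow> 0"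

lemma phase_log_norm:
  assumes C: "\<And>m f. Lp p f \<Longrightarrow> Lp_norm p (conv (phase_ker m) f) \<le> C * Lp_norm p f" and p: "p > 1"
    and fg: "phase_log p f g"
  shows "Lp_norm p g \<le> C * Lp_norm p f"
proof -
  have f: "Lp p f" and g: "Lp p g" and lim: "(\<lambda>m. Lp_norm p (\<lambda>x. conv (phase_ker m) f x - g x)) \<longlonglongrightarrow> 0"
    using fg by (auto simp: phase_log_def)
  have c: "Lp p (conv (phase_ker m) f)" for m by (rule Young_convolution(2)[OF phase_ker_integrable f p])
  have le: "Lp_norm p g \<le> C * Lp_norm p f + Lp_norm p (\<lambda>x. conv (phase_ker m) f x - g x)" for m
    using Lp_diff(2)[OF c[of m] Lp_diff(1)[OF c[of m] g]] C[OF f, of m] p by simp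
  have "(\<lambda>m. C * Lp_norm p f + Lp_norm p (\<lambda>x. conv (phase_ker m) f x - g x)) \<longlonglongrightarrow> C * Lp_norm p f + 0"
    by (intro tendsto_intros lim)
  then show ?thesis using tendsto_lowerbound[of _ "C * Lp_norm p f + 0" sequentially "Lp_norm p g"] le by auto
qed

text \<open>On functions with an explicit symbol the L_p limit and the pointwise limit agree, so A
  multiplies the symbol by \<open>phase_mult\<close>.\<close>

lemma phase_log_Finv:
  assumes w: "decaying w" and wp: "Lp p (Finv w)" and p: "p > 1"
  shows "phase_log p (Finv w) (Finv (\<lambda>\<xi>. phase_mult \<xi> * w \<xi>))"
proof -
  obtain g where g: "Lp p g" "(\<lambda>m. Lp_norm p (\<lambda>x. conv (phase_ker m) (Finv w) x - g x)) \<longlonglongrightarrow> 0"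
    using phase_ker_conv_limit[OF wp p] by blast
  have c: "Lp p (conv (phase_ker m) (Finv w))" for m by (rule Young_convolution(2)[OF phase_ker_integrable wp p])
  have p1: "p \<ge> 1" using p by simp
  have [measurable]: "w \<in> borel_measurable borel" using w by (auto simp: decaying_def)
  have m: "Finv (\<lambda>\<xi>. phase_mult \<xi> * w \<xi>) \<in> borel_measurable borel" by measurable
  note L = Lp_limit_pointwise[OF c g(1) p1 g(2) m Finv_phase_ker_tendsto[OF w]]
  let ?u = "Finv (\<lambda>\<xi>. phase_mult \<xi> * w \<xi>)"
  have "(\<lambda>m. Lp_norm p (\<lambda>x. conv (phase_ker m) (Finv w) x - ?u x)) \<longlonglongrightarrow> 0"
  proof (rule tendsto_sandwich[OF _ _ tendsto_const g(2)])
    show "\<forall>\<^sub>F m in sequentially. Lp_norm p (\<lambda>x. conv (phase_ker m) (Finv w) x - ?u x) \<le> Lp_norm p (\<lambda>x. conv (phase_ker m) (Finv w) x - g x)"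
      using Lp_norm_triangle3[OF c g(1) L(1) p1] L(2) Lp_norm_minus_commute[of p g ?u]
      by (intro always_eventually allI) simp
  qed auto
  then show ?thesis using wp L(1) by (simp add: phase_log_def)
qed

lemma phase_log_antisym:
  assumes fg: "phase_log p f g" and uv: "phase_log q u v" and pq: "p > 1" "q > 1" "1/p + 1/q = 1"
  shows "(LINT x|lborel. g x * u x) = - (LINT x|lborel. f x * v x)"
proof -
  have f: "Lp p f" and g: "Lp p g" and lim: "(\<lambda>m. Lp_norm p (\<lambda>x. conv (phase_ker m) f x - g x)) \<longlonglongrightarrow> 0"
    using fg by (auto simp: phase_log_def)
  have u: "Lp q u" and v: "Lp q v" and lim': "(\<lambda>m. Lp_norm q (\<lambda>x. conv (phase_ker m) u x - v x)) \<longlonglongrightarrow> 0"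
    using uv by (auto simp: phase_log_def)
  have qp: "1/q + 1/p = 1" using pq by simp
  have c: "Lp p (conv (phase_ker m) f)" "Lp q (conv (phase_ker m) u)" for m
    using Young_convolution(2)[OF phase_ker_integrable f pq(1)] Young_convolution(2)[OF phase_ker_integrable u pq(2)] by auto
  have 1: "(\<lambda>m. LINT x|lborel. conv (phase_ker m) f x * u x) \<longlonglongrightarrow> (LINT x|lborel. g x * u x)"
    by (rule Lp_pairing_tendsto[OF c(1) g u pq lim])
  have 2: "(\<lambda>m. LINT x|lborel. conv (phase_ker m) u x * f x) \<longlonglongrightarrow> (LINT x|lborel. v x * f x)"
    by (rule Lp_pairing_tendsto[OF c(2) v f pq(2,1) qp lim'])
  have 3: "(LINT x|lborel. conv (phase_ker m) f x * u x) = - (LINT x|lborel. conv (phase_ker m) u x * f x)" for m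
    using phase_ker_antisym[OF f u pq, of m] by (simp add: mult.commute)
  have "(LINT x|lborel. g x * u x) = - (LINT x|lborel. v x * f x)"
    using LIMSEQ_unique[OF 1[unfolded 3] tendsto_minus[OF 2]] .
  then show ?thesis by (simp add: mult.commute)
qed

lemma decaying_phase_mult_power: "decaying w \<Longrightarrow> decaying (\<lambda>\<xi>. phase_mult \<xi> ^ n * w \<xi>)"
  by (rule decaying_mult[of _ _ "2 ^ n"]) (auto simp: norm_power intro!: power_mono phase_mult_bound)

section \<open>The exponential series of A\<close>

lemma Finv_sum:
  assumes "decaying w"
  shows "Finv (\<lambda>\<xi>. (\<Sum>n<N. (of_real c * phase_mult \<xi>) ^ n / fact n) * w \<xi>) x
    = (\<Sum>n<N. c ^ n / fact n * Finv (\<lambda>\<xi>. phase_mult \<xi> ^ n * w \<xi>) x)"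
proof -
  have i: "integrable lborel (\<lambda>\<xi>. phase_mult \<xi> ^ n * w \<xi> * cis (x * \<xi>))" for n
    by (rule integrable_cis_mult) (use decaying_phase_mult_power[OF assms, of n] in \<open>simp add: decaying_def\<close>)
  have "(LINT \<xi>|lborel. (\<Sum>n<N. (of_real c * phase_mult \<xi>) ^ n / fact n) * w \<xi> * cis (x * \<xi>))
      = (LINT \<xi>|lborel. (\<Sum>n<N. complex_of_real (c ^ n / fact n) * (phase_mult \<xi> ^ n * w \<xi> * cis (x * \<xi>))))"
    unfolding sum_distrib_right
    by (intro Bochner_Integration.integral_cong sum.cong refl) (simp add: power_mult_distrib)
  also have "\<dots> = (\<Sum>n<N. complex_of_real (c ^ n / fact n) * (LINT \<xi>|lborel. phase_mult \<xi> ^ n * w \<xi> * cis (x * \<xi>)))"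
    using i by (subst Bochner_Integration.integral_sum) (auto simp del: of_real_divide of_real_power)
  finally show ?thesis by (simp add: Finv_def del: of_real_divide of_real_power)
qed

lemma exp_partial_sum_le:
  fixes x :: real
  assumes "x \<ge> 0"
  shows "(\<Sum>n<N. x ^ n / fact n) \<le> exp x"
proof -
  have s: "(\<lambda>n. x ^ n / fact n) sums exp x" using exp_converges[of x] by (simp add: divide_inverse mult.commute)
  show ?thesis using sum_le_suminf[OF sums_summable[OF s], of "{..<N}"] sums_unique[OF s] assms by simp
qed

lemma exp_partial_bound: "cmod (\<Sum>n<N. (of_real c * phase_mult \<xi>) ^ n / fact n) \<le> exp (2 * \<bar>c\<bar>)"
proof -
  have "cmod (\<Sum>n<N. (of_real c * phase_mult \<xi>) ^ n / fact n) \<le> (\<Sum>n<N. (2 * \<bar>c\<bar>) ^ n / fact n)"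
  proof (rule sum_norm_le)
    fix n
    have le: "cmod (of_real c * phase_mult \<xi>) \<le> 2 * \<bar>c\<bar>"
      using mult_left_mono[OF phase_mult_bound[of \<xi>], of "\<bar>c\<bar>"] by (simp add: norm_mult mult.commute)
    show "cmod ((of_real c * phase_mult \<xi>) ^ n / fact n) \<le> (2 * \<bar>c\<bar>) ^ n / fact n"
      unfolding norm_divide norm_power norm_fact
      using power_mono[OF le norm_ge_zero, of n] by (intro divide_right_mono) auto
  qed
  also have "\<dots> \<le> exp (2 * \<bar>c\<bar>)" by (rule exp_partial_sum_le) simp
  finally show ?thesis .
qed

lemma exp_partial_tendsto: "(\<lambda>N. \<Sum>n<N. (z :: complex) ^ n / fact n) \<longlonglongrightarrow> exp z"
  using exp_converges[of z] by (simp add: sums_def scaleR_conv_of_real divide_inverse mult.commute)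

lemma Finv_exp_tendsto:
  assumes w: "decaying w"
  shows "(\<lambda>N. Finv (\<lambda>\<xi>. (\<Sum>n<N. (of_real c * phase_mult \<xi>) ^ n / fact n) * w \<xi>) x) \<longlonglongrightarrow> Finv (\<lambda>\<xi>. exp (of_real c * phase_mult \<xi>) * w \<xi>) x"
proof -
  have w': "integrable lborel w" using w by (auto simp: decaying_def)
  have [measurable]: "w \<in> borel_measurable borel" using w' by auto
  have "(\<lambda>N. LINT \<xi>|lborel. (\<Sum>n<N. (of_real c * phase_mult \<xi>) ^ n / fact n) * w \<xi> * cis (x * \<xi>))
     \<longlonglongrightarrow> (LINT \<xi>|lborel. exp (of_real c * phase_mult \<xi>) * w \<xi> * cis (x * \<xi>))"
  proof (rule integral_dominated_convergence)
    show "integrable lborel (\<lambda>\<xi>. exp (2 * \<bar>c\<bar>) * cmod (w \<xi>))" using w' by simp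
    show "AE \<xi> in lborel. (\<lambda>N. (\<Sum>n<N. (of_real c * phase_mult \<xi>) ^ n / fact n) * w \<xi> * cis (x * \<xi>)) \<longlonglongrightarrow> exp (of_real c * phase_mult \<xi>) * w \<xi> * cis (x * \<xi>)"
      by (intro AE_I2 tendsto_intros exp_partial_tendsto)
    show "AE \<xi> in lborel. norm ((\<Sum>n<N. (of_real c * phase_mult \<xi>) ^ n / fact n) * w \<xi> * cis (x * \<xi>)) \<le> exp (2 * \<bar>c\<bar>) * cmod (w \<xi>)" for N
      unfolding norm_mult norm_cis mult_1_right
      by (intro AE_I2 mult_right_mono exp_partial_bound norm_ge_zero)
  qed measurable
  then show ?thesis unfolding Finv_def by (rule tendsto_Re)
qed

lemma phase_log_phase_mult_power:
  assumes w: "decaying w" and wp: "Lp p (Finv w)" and p: "p > 1"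
  shows "phase_log p (Finv (\<lambda>\<xi>. phase_mult \<xi> ^ n * w \<xi>)) (Finv (\<lambda>\<xi>. phase_mult \<xi> ^ Suc n * w \<xi>))"
proof (induction n)
  case 0
  show ?case using phase_log_Finv[OF w wp p] by simp
next
  case (Suc n)
  then have "Lp p (Finv (\<lambda>\<xi>. phase_mult \<xi> ^ Suc n * w \<xi>))" by (simp add: phase_log_def)
  from phase_log_Finv[OF decaying_phase_mult_power[OF w] this p] show ?case by (simp add: mult.assoc)
qed

lemma Lp_exp_sum:
  assumes b: "\<And>n. Lp p (b n)" "\<And>n::nat. Lp_norm p (b n) \<le> C ^ n * B" and p: "p \<ge> 1" and C: "C \<ge> 0" and B: "B \<ge> 0"
    and I: "finite I"
  shows "Lp p (\<lambda>x. \<Sum>n\<in>I. c ^ n / fact n * b n x)"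
    "Lp_norm p (\<lambda>x. \<Sum>n\<in>I. c ^ n / fact n * b n x) \<le> (\<Sum>n\<in>I. (\<bar>c\<bar> * C) ^ n / fact n) * B"
proof -
  have s: "Lp p (\<lambda>x. c ^ n / fact n * b n x)" "Lp_norm p (\<lambda>x. c ^ n / fact n * b n x) \<le> (\<bar>c\<bar> * C) ^ n / fact n * B" for n
  proof -
    show "Lp p (\<lambda>x. c ^ n / fact n * b n x)" by (rule Lp_scale(1)[OF b(1)]) (use p in simp)
    have "Lp_norm p (\<lambda>x. c ^ n / fact n * b n x) = \<bar>c\<bar> ^ n / fact n * Lp_norm p (b n)"
      using Lp_scale(2)[OF b(1)[of n], of "c ^ n / fact n"] p by (simp add: power_abs)
    also have "\<dots> \<le> \<bar>c\<bar> ^ n / fact n * (C ^ n * B)" using b(2) by (intro mult_left_mono) auto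
    finally show "Lp_norm p (\<lambda>x. c ^ n / fact n * b n x) \<le> (\<bar>c\<bar> * C) ^ n / fact n * B"
      by (simp add: power_mult_distrib)
  qed
  have *: "Lp p (\<lambda>x. \<Sum>n\<in>I. c ^ n / fact n * b n x) \<and> Lp_norm p (\<lambda>x. \<Sum>n\<in>I. c ^ n / fact n * b n x) \<le> (\<Sum>n\<in>I. Lp_norm p (\<lambda>x. c ^ n / fact n * b n x))"
    using s(1) p I by (intro Lp_sum) auto
  then show "Lp p (\<lambda>x. \<Sum>n\<in>I. c ^ n / fact n * b n x)" by simp
  have "(\<Sum>n\<in>I. Lp_norm p (\<lambda>x. c ^ n / fact n * b n x)) \<le> (\<Sum>n\<in>I. (\<bar>c\<bar> * C) ^ n / fact n * B)"
    using s(2) by (intro sum_mono)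
  with * show "Lp_norm p (\<lambda>x. \<Sum>n\<in>I. c ^ n / fact n * b n x) \<le> (\<Sum>n\<in>I. (\<bar>c\<bar> * C) ^ n / fact n) * B"
    by (simp add: sum_distrib_right)
qed

lemma phase_log_iterate_norm:
  assumes C: "C \<ge> 0" "\<And>m f. Lp p f \<Longrightarrow> Lp_norm p (conv (phase_ker m) f) \<le> C * Lp_norm p f" and p: "p > 1"
    and b: "\<And>n. phase_log p (b n) (b (Suc n))"
  shows "Lp_norm p (b n) \<le> C ^ n * Lp_norm p (b 0)"
proof (induction n)
  case (Suc n)
  have "Lp_norm p (b (Suc n)) \<le> C * Lp_norm p (b n)" by (rule phase_log_norm[OF C(2) p b])
  also have "\<dots> \<le> C * (C ^ n * Lp_norm p (b 0))" using Suc C by (intro mult_left_mono) auto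
  finally show ?case by (simp add: mult.assoc)
qed simp

text \<open>The partial sums of the exponential series are bounded in L_p by exp (|c| C) times the
  norm of \<open>Finv w\<close>, and they converge pointwise through their symbols, so Fatou
  suffices. This provides the L_q membership needed on the test side.\<close>

lemma Finv_exp_Lp:
  assumes w: "decaying w" and wp: "Lp p (Finv w)" and p: "p > 1"
  shows "Lp p (Finv (\<lambda>\<xi>. exp (of_real c * phase_mult \<xi>) * w \<xi>))"
proof -
  obtain C where C: "C \<ge> 0" "\<And>m f. Lp p f \<Longrightarrow> Lp_norm p (conv (phase_ker m) f) \<le> C * Lp_norm p f"
    using phase_ker_bounded[OF p] by blast
  define b where "b n = Finv (\<lambda>\<xi>. phase_mult \<xi> ^ n * w \<xi>)" for n
  have b: "phase_log p (b n) (b (Suc n))" for n unfolding b_def by (rule phase_log_phase_mult_power[OF w wp p])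
  have bL: "Lp p (b n)" for n using b[of n] by (simp add: phase_log_def)
  have bn: "Lp_norm p (b n) \<le> C ^ n * Lp_norm p (b 0)" for n by (rule phase_log_iterate_norm[where b = b, OF C p b])
  have p1: "p \<ge> 1" using p by simp
  define S where "S N x = (\<Sum>n<N. c ^ n / fact n * b n x)" for N x
  have S: "Lp p (S N)" "Lp_norm p (S N) \<le> exp (\<bar>c\<bar> * C) * Lp_norm p (b 0)" for N
  proof -
    note E = Lp_exp_sum[OF bL bn p1 C(1) Lp_norm_nonneg finite_lessThan, of c N]
    show "Lp p (S N)" using E(1) by (simp add: S_def[abs_def])
    have "(\<Sum>n<N. (\<bar>c\<bar> * C) ^ n / fact n) * Lp_norm p (b 0) \<le> exp (\<bar>c\<bar> * C) * Lp_norm p (b 0)"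
      using C by (intro mult_right_mono exp_partial_sum_le) auto
    with E(2) show "Lp_norm p (S N) \<le> exp (\<bar>c\<bar> * C) * Lp_norm p (b 0)" by (simp add: S_def[abs_def])
  qed
  have [measurable]: "w \<in> borel_measurable borel" using w by (auto simp: decaying_def)
  have m: "Finv (\<lambda>\<xi>. exp (of_real c * phase_mult \<xi>) * w \<xi>) \<in> borel_measurable borel" by measurable
  have "AE x in lborel. (\<lambda>N. S N x) \<longlonglongrightarrow> Finv (\<lambda>\<xi>. exp (of_real c * phase_mult \<xi>) * w \<xi>) x"
    unfolding S_def b_def Finv_sum[OF w, symmetric] by (intro AE_I2 Finv_exp_tendsto[OF w])
  from Lp_Fatou(1)[OF S _ m this] show ?thesis using p by simp
qed

text \<open>\<open>h\<close> is exp (c A) \<psi>, built as an L_p limit because no integrable symbol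
  of \<psi> is at hand, and described through its pairings. Antisymmetry moves the n-th power of A
  to the test side with a factor (-1)^n, which turns c into -c.\<close>

theorem phase_operator:
  fixes c :: real
  assumes pq: "p > 1" "q > 1" "1/p + 1/q = 1"
  obtains K where "K \<ge> 0" "\<And>\<psi>. Lp p \<psi> \<Longrightarrow> integrable lborel \<psi> \<Longrightarrow>
     \<exists>h. Lp p h \<and> Lp_norm p h \<le> K * Lp_norm p \<psi> \<and>
       (\<forall>w. decaying w \<longrightarrow> Lp q (Finv w) \<longrightarrow>
         (LINT x|lborel. h x * Finv w x) = (LINT x|lborel. \<psi> x * Finv (\<lambda>\<xi>. exp (of_real (- c) * phase_mult \<xi>) * w \<xi>) x))"
proof -
  have p: "p > 1" and p1: "p \<ge> 1" using pq by auto
  obtain C where C: "C \<ge> 0" "\<And>m f. Lp p f \<Longrightarrow> Lp_norm p (conv (phase_ker m) f) \<le> C * Lp_norm p f"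
    using phase_ker_bounded[OF p] by blast
  define K where "K = exp (\<bar>c\<bar> * C)"
  have K0: "K \<ge> 0" by (simp add: K_def)
  show ?thesis
  proof (rule that[OF K0])
    fix \<psi> assume \<psi>: "Lp p \<psi>" and \<psi>i: "integrable lborel \<psi>"
    have ex: "\<exists>g. phase_log p f g" if f: "Lp p f" for f
    proof -
      obtain g where "Lp p g" "(\<lambda>m. Lp_norm p (\<lambda>x. conv (phase_ker m) f x - g x)) \<longlonglongrightarrow> 0"
        using phase_ker_conv_limit[OF f p] by blast
      with f show ?thesis unfolding phase_log_def by blast
    qed
    have "\<exists>b. b 0 = \<psi> \<and> (\<forall>n. phase_log p (b n) (b (Suc n)))"
    proof -
      \<comment> \<open>Iterates of A on \<psi>, chosen one after another since
        \<open>phase_log\<close> is only a relation.\<close>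
      define b where "b = rec_nat \<psi> (\<lambda>n f. SOME g. phase_log p f g)"
      have bS: "b (Suc n) = (SOME g. phase_log p (b n) g)" for n by (simp add: b_def)
      have "Lp p (b n) \<and> phase_log p (b n) (b (Suc n))" for n
      proof (induction n)
        case 0
        have "b 0 = \<psi>" by (simp add: b_def)
        then show ?case using \<psi> someI_ex[OF ex[of "b 0"]] by (simp add: bS)
      next
        case (Suc n)
        then have "Lp p (b (Suc n))" by (simp add: phase_log_def)
        then show ?case using someI_ex[OF ex[of "b (Suc n)"]] by (simp add: bS[of "Suc n"])
      qed
      then show ?thesis by (intro exI[of _ b]) (simp add: b_def)
    qed
    then obtain b where b0: "b 0 = \<psi>" and b: "\<And>n. phase_log p (b n) (b (Suc n))" by blast
    have bL: "Lp p (b n)" for n using b[of n] by (simp add: phase_log_def)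
    have bn: "Lp_norm p (b n) \<le> C ^ n * Lp_norm p (b 0)" for n by (rule phase_log_iterate_norm[where b = b, OF C p b])
    define B where "B = Lp_norm p (b 0)"
    have B0: "B \<ge> 0" by (simp add: B_def)
    define S where "S N x = (\<Sum>n<N. c ^ n / fact n * b n x)" for N x
    define T where "T N = (\<Sum>n<N. (\<bar>c\<bar> * C) ^ n / fact n)" for N
    note E = Lp_exp_sum[OF bL bn p1 C(1) Lp_norm_nonneg]
    have S: "Lp p (S N)" for N using E(1)[OF finite_lessThan] by (simp add: S_def[abs_def])
    \<comment> \<open>Differences of partial sums are dominated by those of the scalar series T, so
      the Cauchy property is inherited from the real exponential series.\<close>
    have SM: "Lp_norm p (\<lambda>x. S M x - S N x) \<le> (T M - T N) * B" if "N \<le> M" for M N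
    proof -
      have "{..<M} = {..<N} \<union> {N..<M}" using that by auto
      then have u: "sum g {..<M} = sum g {..<N} + sum g {N..<M}" for g :: "nat \<Rightarrow> real"
        by (simp add: sum.union_disjoint ivl_disj_int)
      have "S M x - S N x = (\<Sum>n\<in>{N..<M}. c ^ n / fact n * b n x)" for x
        unfolding S_def u by simp
      moreover have "T M - T N = (\<Sum>n\<in>{N..<M}. (\<bar>c\<bar> * C) ^ n / fact n)"
        unfolding T_def u by simp
      ultimately show ?thesis using E(2)[of "{N..<M}" c] by (simp add: B_def)
    qed
    have Tlim: "T \<longlonglongrightarrow> exp (\<bar>c\<bar> * C)"
      unfolding T_def using exp_converges[of "\<bar>c\<bar> * C"] by (simp add: sums_def divide_inverse mult.commute)
    have Tmono: "T N \<le> T M" if "N \<le> M" for N M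
      unfolding T_def using that C by (intro sum_mono2) auto
    have TC: "Cauchy (\<lambda>N. T N * B)"
      using tendsto_mult[OF Tlim tendsto_const[of B]] by (rule LIMSEQ_imp_Cauchy)
    obtain h where h: "Lp p h" "(\<lambda>N. Lp_norm p (\<lambda>x. S N x - h x)) \<longlonglongrightarrow> 0"
    proof (rule Lp_complete[OF S p1])
      fix e :: real assume "e > 0"
      then obtain M where M: "\<And>m n. m \<ge> M \<Longrightarrow> n \<ge> M \<Longrightarrow> dist (T m * B) (T n * B) < e"
        using TC unfolding Cauchy_def by blast
      have "Lp_norm p (\<lambda>x. S m x - S n x) < e" if "m \<ge> M" "n \<ge> M" for m n
      proof (cases "n \<le> m")
        case True
        have "(T m - T n) * B \<le> dist (T m * B) (T n * B)" by (simp add: dist_real_def left_diff_distrib)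
        then show ?thesis using SM[OF True] M[OF that] by linarith
      next
        case False
        have "(T n - T m) * B \<le> dist (T m * B) (T n * B)" by (simp add: dist_real_def left_diff_distrib)
        then show ?thesis using SM[of m n] M[OF that] False Lp_norm_minus_commute[of p "S m" "S n"] by simp
      qed
      then show "\<exists>M. \<forall>m\<ge>M. \<forall>n\<ge>M. Lp_norm p (\<lambda>x. S m x - S n x) < e" by blast
    qed
    have hn: "Lp_norm p h \<le> K * B"
    proof -
      have le: "Lp_norm p h \<le> K * B + Lp_norm p (\<lambda>x. S N x - h x)" for N
      proof -
        have "Lp_norm p h \<le> Lp_norm p (S N) + Lp_norm p (\<lambda>x. S N x - h x)"
          using Lp_diff(2)[OF S[of N] Lp_diff(1)[OF S[of N] h(1) p1] p1] by simp
        moreover have "Lp_norm p (S N) \<le> T N * B" using SM[of 0 N] by (simp add: S_def[abs_def] T_def)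
        moreover have "T N * B \<le> K * B"
          unfolding T_def K_def using C B0 by (intro mult_right_mono exp_partial_sum_le) auto
        ultimately show ?thesis by linarith
      qed
      have "(\<lambda>N. K * B + Lp_norm p (\<lambda>x. S N x - h x)) \<longlonglongrightarrow> K * B + 0"
        by (intro tendsto_intros h)
      then show ?thesis using tendsto_lowerbound[of _ "K * B + 0" sequentially "Lp_norm p h"] le by auto
    qed
    have "(LINT x|lborel. h x * Finv w x) = (LINT x|lborel. \<psi> x * Finv (\<lambda>\<xi>. exp (of_real (- c) * phase_mult \<xi>) * w \<xi>) x)"
      if w: "decaying w" and wq: "Lp q (Finv w)" for w
    proof -
      have bw: "(LINT x|lborel. b n x * Finv w x) = (- 1) ^ n * (LINT x|lborel. \<psi> x * Finv (\<lambda>\<xi>. phase_mult \<xi> ^ n * w \<xi>) x)" for n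
      proof -
        \<comment> \<open>The shift k is general because each induction step raises the power on the
          test side by one.\<close>
        have "(LINT x|lborel. b n x * Finv (\<lambda>\<xi>. phase_mult \<xi> ^ k * w \<xi>) x) = (- 1) ^ n * (LINT x|lborel. \<psi> x * Finv (\<lambda>\<xi>. phase_mult \<xi> ^ (n + k) * w \<xi>) x)" for k
        proof (induction n arbitrary: k)
          case (Suc n)
          show ?case
            using phase_log_antisym[OF b[of n] phase_log_phase_mult_power[OF w wq pq(2), of k] pq] Suc[of "Suc k"] by simp
        qed (simp add: b0)
        from this[of 0] show ?thesis by simp
      qed
      have wi: "integrable lborel w" using w by (simp add: decaying_def)
      have [measurable]: "w \<in> borel_measurable borel" using wi by auto
      have [measurable]: "\<psi> \<in> borel_measurable borel" using \<psi>i by auto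
      define P where "P N \<xi> = (\<Sum>n<N. (of_real (- c) * phase_mult \<xi>) ^ n / fact n) * w \<xi>" for N \<xi>
      have Pm [measurable]: "P N \<in> borel_measurable borel" for N unfolding P_def by measurable
      \<comment> \<open>A bound uniform in N and x; with it, integrability of \<psi> is enough to
        pass to the limit on the right-hand side.\<close>
      define D where "D = exp (2 * \<bar>c\<bar>) * (LINT \<xi>|lborel. cmod (w \<xi>))"
      have Pb: "\<bar>Finv (P N) x\<bar> \<le> D" for N x
      proof -
        have le: "cmod (P N \<xi>) \<le> exp (2 * \<bar>c\<bar>) * cmod (w \<xi>)" for \<xi>
          unfolding P_def norm_mult using exp_partial_bound[where N = N and c = "- c" and \<xi> = \<xi>] by (intro mult_right_mono) auto
        have wi': "integrable lborel (\<lambda>\<xi>. exp (2 * \<bar>c\<bar>) * cmod (w \<xi>))" using wi by simp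
        have Pi: "integrable lborel (P N)"
          by (rule Bochner_Integration.integrable_bound[OF wi']) (use le in \<open>auto intro!: AE_I2\<close>)
        have "\<bar>Finv (P N) x\<bar> \<le> (LINT \<xi>|lborel. cmod (P N \<xi>))" by (rule Finv_bound[OF Pi])
        also have "\<dots> \<le> (LINT \<xi>|lborel. exp (2 * \<bar>c\<bar>) * cmod (w \<xi>))"
          using Pi wi' le by (intro integral_mono) auto
        finally show ?thesis by (simp add: D_def)
      qed
      have "(\<lambda>N. LINT x|lborel. S N x * Finv w x) \<longlonglongrightarrow> (LINT x|lborel. h x * Finv w x)"
        by (rule Lp_pairing_tendsto[OF S h(1) wq pq h(2)])
      moreover have "(LINT x|lborel. S N x * Finv w x) = (LINT x|lborel. \<psi> x * Finv (P N) x)" for N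
      proof -
        have i1: "integrable lborel (\<lambda>x. b n x * Finv w x)" for n by (rule Hoelder(1)[OF bL wq pq])
        have i2: "integrable lborel (\<lambda>x. \<psi> x * Finv (\<lambda>\<xi>. phase_mult \<xi> ^ n * w \<xi>) x)" for n
        proof -
          have "Lp q (Finv (\<lambda>\<xi>. phase_mult \<xi> ^ n * w \<xi>))"
            using phase_log_phase_mult_power[OF w wq pq(2), of n] by (simp add: phase_log_def)
          then show ?thesis by (rule Hoelder(1)[OF \<psi> _ pq])
        qed
        have "(LINT x|lborel. S N x * Finv w x) = (LINT x|lborel. (\<Sum>n<N. c ^ n / fact n * (b n x * Finv w x)))"
          by (simp add: S_def sum_distrib_right mult.assoc)
        also have "\<dots> = (\<Sum>n<N. c ^ n / fact n * (LINT x|lborel. b n x * Finv w x))"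
          using i1 by (subst Bochner_Integration.integral_sum) auto
        also have "\<dots> = (\<Sum>n<N. (- c) ^ n / fact n * (LINT x|lborel. \<psi> x * Finv (\<lambda>\<xi>. phase_mult \<xi> ^ n * w \<xi>) x))"
          unfolding bw by (intro sum.cong refl) (simp add: power_minus[of c])
        also have "\<dots> = (LINT x|lborel. (\<Sum>n<N. (- c) ^ n / fact n * (\<psi> x * Finv (\<lambda>\<xi>. phase_mult \<xi> ^ n * w \<xi>) x)))"
          using i2 by (subst Bochner_Integration.integral_sum) auto
        also have "\<dots> = (LINT x|lborel. \<psi> x * Finv (P N) x)"
          unfolding P_def Finv_sum[OF w] by (simp add: sum_distrib_left mult_ac)
        finally show ?thesis .
      qed
      moreover have "(\<lambda>N. LINT x|lborel. \<psi> x * Finv (P N) x) \<longlonglongrightarrow> (LINT x|lborel. \<psi> x * Finv (\<lambda>\<xi>. exp (of_real (- c) * phase_mult \<xi>) * w \<xi>) x)"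
      proof (rule integral_dominated_convergence)
        show "integrable lborel (\<lambda>x. \<bar>\<psi> x\<bar> * D)" using \<psi>i by simp
        show "AE x in lborel. (\<lambda>N. \<psi> x * Finv (P N) x) \<longlonglongrightarrow> \<psi> x * Finv (\<lambda>\<xi>. exp (of_real (- c) * phase_mult \<xi>) * w \<xi>) x"
          unfolding P_def by (intro AE_I2 tendsto_intros Finv_exp_tendsto[OF w])
        show "AE x in lborel. norm (\<psi> x * Finv (P N) x) \<le> \<bar>\<psi> x\<bar> * D" for N
          using Pb by (intro AE_I2) (auto simp: abs_mult intro!: mult_left_mono)
      qed measurable
      ultimately show ?thesis using LIMSEQ_unique by auto
    qed
    then show "\<exists>h. Lp p h \<and> Lp_norm p h \<le> K * Lp_norm p \<psi> \<and>
       (\<forall>w. decaying w \<longrightarrow> Lp q (Finv w) \<longrightarrow>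
         (LINT x|lborel. h x * Finv w x) = (LINT x|lborel. \<psi> x * Finv (\<lambda>\<xi>. exp (of_real (- c) * phase_mult \<xi>) * w \<xi>) x))"
      using h(1) hn by (intro exI[of _ h]) (simp add: B_def b0)
  qed
qed

section \<open>Test functions and Fourier inversion\<close>

lemma inverse_square_integral:
  "integrable lborel (\<lambda>x::real. 1 / (1 + x\<^sup>2))" "(LINT x::real|lborel. 1 / (1 + x\<^sup>2)) = pi"
proof -
  have nz: "1 + x\<^sup>2 \<noteq> 0" for x :: real using zero_le_power2[of x] by linarith
  have D: "DERIV arctan x :> 1 / (1 + x\<^sup>2)" for x :: real
    using DERIV_arctan[of x] by (simp add: divide_inverse)
  have c: "isCont (\<lambda>x::real. 1 / (1 + x\<^sup>2)) x" for x using nz by (intro continuous_intros) auto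
  have ei: "einterval (-\<infinity>) \<infinity> = UNIV" by (auto simp: einterval_def)
  have nn: "AE x in lborel. - \<infinity> < ereal x \<longrightarrow> ereal x < \<infinity> \<longrightarrow> 0 \<le> 1 / (1 + x\<^sup>2)"
    by (intro AE_I2) auto
  have l: "((arctan \<circ> real_of_ereal) \<longlongrightarrow> - (pi / 2)) (at_right (-\<infinity>))"
    using tendsto_arctan_at_bot by (simp add: ereal_tendsto_simps)
  have r: "((arctan \<circ> real_of_ereal) \<longlongrightarrow> pi / 2) (at_left \<infinity>)"
    using tendsto_arctan_at_top by (simp add: ereal_tendsto_simps)
  have "set_integrable lborel (einterval (-\<infinity>) \<infinity>) (\<lambda>x. 1 / (1 + x\<^sup>2))"
    "(LBINT x=-\<infinity>..\<infinity>. 1 / (1 + x\<^sup>2)) = pi / 2 - - (pi / 2)"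
    by (rule interval_integral_FTC_nonneg[OF _ D c nn l r]; simp)+
  then show "integrable lborel (\<lambda>x::real. 1 / (1 + x\<^sup>2))" "(LINT x::real|lborel. 1 / (1 + x\<^sup>2)) = pi"
    by (simp_all add: ei set_integrable_def interval_lebesgue_integral_def set_lebesgue_integral_def)
qed

section \<open>Fourier transforms of test functions\<close>

lemma test_fun_DERIV: "test_fun \<phi> \<Longrightarrow> DERIV \<phi> x :> deriv \<phi> x"
  unfolding test_fun_def by (metis DERIV_deriv_iff_real_differentiable funpow_0)

lemma test_fun_deriv:
  assumes "test_fun \<phi>"
  shows "test_fun (deriv \<phi>)"
proof -
  obtain R where R: "\<And>x. \<bar>x\<bar> > R \<Longrightarrow> \<phi> x = 0" using assms by (auto simp: test_fun_def)
  have "deriv \<phi> x = 0" if "\<bar>x\<bar> > R" for x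
  proof -
    have "open {x::real. \<bar>x\<bar> > R}" by (intro open_Collect_less continuous_intros)
    then have "eventually (\<lambda>y. y \<in> {x. \<bar>x\<bar> > R}) (nhds x)" using that by (intro eventually_nhds_in_open) auto
    then have "eventually (\<lambda>y. \<phi> y = 0) (nhds x)" by eventually_elim (use R in auto)
    then have "deriv \<phi> x = deriv (\<lambda>_. 0) x" by (intro deriv_cong_ev) auto
    then show ?thesis by simp
  qed
  moreover have "((deriv ^^ n) (deriv \<phi>)) differentiable (at x)" for n x
    using assms unfolding test_fun_def by (metis funpow_swap1 funpow.simps(2) comp_apply)
  ultimately show ?thesis unfolding test_fun_def by blast
qed

lemma test_fun_continuous: "test_fun \<phi> \<Longrightarrow> continuous_on A \<phi>"
  by (meson DERIV_isCont continuous_at_imp_continuous_on test_fun_DERIV)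

lemma test_fun_measurable: "test_fun \<phi> \<Longrightarrow> \<phi> \<in> borel_measurable borel"
  by (intro borel_measurable_continuous_onI test_fun_continuous)

lemma test_fun_bounded:
  assumes "test_fun \<phi>"
  obtains R M where "R > 0" "\<And>x. \<bar>x\<bar> \<ge> R \<Longrightarrow> \<phi> x = 0" "\<And>x. \<bar>\<phi> x\<bar> \<le> M" "M \<ge> 0"
proof -
  obtain R0 where R0: "\<And>x. \<bar>x\<bar> > R0 \<Longrightarrow> \<phi> x = 0" using assms by (auto simp: test_fun_def)
  define R where "R = \<bar>R0\<bar> + 1"
  have R: "R > 0" "\<And>x. \<bar>x\<bar> \<ge> R \<Longrightarrow> \<phi> x = 0" using R0 by (auto simp: R_def)
  have "compact (\<phi> ` {-R..R})" by (intro compact_continuous_image test_fun_continuous assms) auto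
  then obtain M where M: "\<And>x. x \<in> {-R..R} \<Longrightarrow> \<bar>\<phi> x\<bar> \<le> M"
    using compact_imp_bounded by (force simp: bounded_iff)
  have M0: "M \<ge> 0" using M[of 0] R by auto
  have "\<bar>\<phi> x\<bar> \<le> M" for x
  proof (cases "x \<in> {-R..R}")
    case False
    then have "\<bar>x\<bar> \<ge> R" by auto
    then show ?thesis using R(2) M0 by simp
  qed (use M in auto)
  then show ?thesis using that R M0 by blast
qed

lemma test_fun_Lp:
  assumes "test_fun \<phi>" "p > 0"
  shows "Lp p \<phi>"
proof -
  obtain R M where "R > 0" "\<And>x. \<bar>x\<bar> \<ge> R \<Longrightarrow> \<phi> x = 0" "\<And>x. \<bar>\<phi> x\<bar> \<le> M" "M \<ge> 0"
    using test_fun_bounded[OF assms(1)] by blast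
  then show ?thesis using assms test_fun_measurable by (intro Lp_bounded_support[of _ M R]) auto
qed

lemma test_fun_integrable: "test_fun \<phi> \<Longrightarrow> integrable lborel \<phi>"
  using test_fun_Lp[of \<phi> 1] test_fun_measurable[of \<phi>] by (simp add: Lp_def integrable_abs_iff)

lemma fourier_alt: "fourier \<phi> \<xi> = (LINT y|lborel. complex_of_real (\<phi> y) * cis (- \<xi> * y))"
  unfolding fourier_def by (simp add: mult.commute)

lemma fourier_measurable: "test_fun \<phi> \<Longrightarrow> fourier \<phi> \<in> borel_measurable borel"
  using kernel_fourier_measurable[OF test_fun_measurable] by (simp add: kernel_fourier_def[abs_def] fourier_alt[abs_def])

lemma fourier_norm_le:
  "cmod (fourier \<phi> \<xi>) \<le> (LINT y|lborel. \<bar>\<phi> y\<bar>)"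
proof -
  have "cmod (fourier \<phi> \<xi>) \<le> (LINT y|lborel. cmod (complex_of_real (\<phi> y) * cis (- \<xi> * y)))"
    unfolding fourier_alt by (rule integral_norm_bound)
  then show ?thesis by (simp add: norm_mult)
qed

lemma has_vector_derivative_cis: "((\<lambda>y. cis (a * y)) has_vector_derivative \<i> * of_real a * cis (a * y)) (at y within A)"
  by (auto simp: has_vector_derivative_complex_iff intro!: derivative_eq_intros)

lemma fourier_deriv:
  assumes \<phi>: "test_fun \<phi>"
  shows "fourier (deriv \<phi>) \<xi> = \<i> * of_real \<xi> * fourier \<phi> \<xi>"
proof -
  obtain R M where R: "R > 0" "\<And>x. \<bar>x\<bar> \<ge> R \<Longrightarrow> \<phi> x = 0" using test_fun_bounded[OF \<phi>] by metis
  obtain R' M' where R': "R' > 0" "\<And>x. \<bar>x\<bar> \<ge> R' \<Longrightarrow> deriv \<phi> x = 0"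
    using test_fun_bounded[OF test_fun_deriv[OF \<phi>]] by metis
  define S where "S = max R R'"
  define F where "F y = complex_of_real (\<phi> y) * cis (- \<xi> * y)" for y
  define f where "f y = complex_of_real (deriv \<phi> y) * cis (- \<xi> * y) - \<i> * of_real \<xi> * (complex_of_real (\<phi> y) * cis (- \<xi> * y))" for y
  have D: "(F has_vector_derivative f y) (at y within A)" for y A
  proof -
    have 1: "((\<lambda>y. complex_of_real (\<phi> y)) has_vector_derivative complex_of_real (deriv \<phi> y)) (at y within A)"
      by (rule has_vector_derivative_of_real, rule has_field_derivative_at_within, rule test_fun_DERIV[OF \<phi>])
    show ?thesis unfolding F_def
      by (rule has_vector_derivative_eq_rhs[OF has_vector_derivative_mult[OF 1 has_vector_derivative_cis]])
        (simp add: f_def algebra_simps)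
  qed
  have "(LINT y|lborel. indicator {-S..S} y *\<^sub>R f y) = F S - F (- S)"
  proof (rule integral_FTC_Icc)
    show "- S \<le> S" using R by (simp add: S_def)
    show "continuous_on {- S..S} f" unfolding f_def
      by (intro continuous_intros test_fun_continuous \<phi> test_fun_deriv)
  qed (rule D)
  also have "\<dots> = 0" using R by (simp add: F_def S_def)
  also have "(\<lambda>y. indicator {-S..S} y *\<^sub>R f y) = f"
  proof
    fix y show "indicator {-S..S} y *\<^sub>R f y = f y"
    proof (cases "y \<in> {-S..S}")
      case False
      then have "\<bar>y\<bar> \<ge> R" "\<bar>y\<bar> \<ge> R'" by (auto simp: S_def)
      then show ?thesis using R(2) R'(2) by (simp add: f_def)
    qed simp
  qed
  finally have "(LINT y|lborel. f y) = 0" .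
  moreover have "integrable lborel (\<lambda>y. complex_of_real (\<phi> y) * cis (- \<xi> * y))"
    "integrable lborel (\<lambda>y. complex_of_real (deriv \<phi> y) * cis (- \<xi> * y))"
    by (rule integrable_cis_mult, rule integrable_of_real, rule test_fun_integrable[OF \<phi>],
        rule integrable_cis_mult, rule integrable_of_real, rule test_fun_integrable[OF test_fun_deriv[OF \<phi>]])
  ultimately show ?thesis unfolding fourier_alt f_def by simp
qed

text \<open>Three derivatives make |\<xi>|^3 times the transform bounded; hence (1 + |\<xi>|) times
  the transform is at most a multiple of 1 / (1 + \<xi>^2).\<close>

lemma decaying_fourier:
  assumes \<phi>: "test_fun \<phi>"
  shows "decaying (fourier \<phi>)"
proof -
  define M0 M3 where "M0 = (LINT y|lborel. \<bar>\<phi> y\<bar>)" and "M3 = (LINT y|lborel. \<bar>deriv (deriv (deriv \<phi>)) y\<bar>)"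
  have nn: "M0 \<ge> 0" "M3 \<ge> 0" by (simp_all add: M0_def M3_def)
  have b: "(1 + \<bar>\<xi>\<bar>) * cmod (fourier \<phi> \<xi>) \<le> 4 * (M0 + M3) * (1 / (1 + \<xi>\<^sup>2))" for \<xi>
  proof -
    have 0: "cmod (fourier \<phi> \<xi>) \<le> M0" unfolding M0_def by (rule fourier_norm_le)
    have "cmod (fourier (deriv (deriv (deriv \<phi>))) \<xi>) = \<bar>\<xi>\<bar> ^ 3 * cmod (fourier \<phi> \<xi>)"
      using \<phi> by (simp add: fourier_deriv test_fun_deriv norm_mult power3_eq_cube)
    then have 3: "\<bar>\<xi>\<bar> ^ 3 * cmod (fourier \<phi> \<xi>) \<le> M3"
      using fourier_norm_le[of "deriv (deriv (deriv \<phi>))" \<xi>] by (simp add: M3_def)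
    have "(1 + \<bar>\<xi>\<bar>) * (1 + \<xi>\<^sup>2) \<le> 4 * (1 + \<bar>\<xi>\<bar> ^ 3)"
    proof -
      \<comment> \<open>Equivalent to a + a^2 \<le> 1 + a^3 with a = |\<xi>|, which absorbs the
        middle terms of (1 + a) (1 + a^2).\<close>
      have "0 \<le> (\<bar>\<xi>\<bar> + 1) * (\<bar>\<xi>\<bar> - 1)\<^sup>2" by (intro mult_nonneg_nonneg) auto
      moreover have "0 \<le> \<bar>\<xi>\<bar> ^ 3" by simp
      ultimately show ?thesis by (simp add: power2_eq_square power3_eq_cube algebra_simps)
    qed
    then have "(1 + \<bar>\<xi>\<bar>) * (1 + \<xi>\<^sup>2) * cmod (fourier \<phi> \<xi>) \<le> 4 * (1 + \<bar>\<xi>\<bar> ^ 3) * cmod (fourier \<phi> \<xi>)"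
      by (rule mult_right_mono) simp
    also have "\<dots> \<le> 4 * (M0 + M3)" using 0 3 by (simp add: algebra_simps)
    finally have "(1 + \<bar>\<xi>\<bar>) * cmod (fourier \<phi> \<xi>) * (1 + \<xi>\<^sup>2) \<le> 4 * (M0 + M3)" by (simp add: mult_ac)
    moreover have "1 + \<xi>\<^sup>2 > 0" by (intro add_pos_nonneg) auto
    ultimately show ?thesis by (simp add: pos_le_divide_eq)
  qed
  have i: "integrable lborel (\<lambda>\<xi>. 4 * (M0 + M3) * (1 / (1 + \<xi>\<^sup>2)))"
    using inverse_square_integral(1) by (rule integrable_mult_right)
  have m: "fourier \<phi> \<in> borel_measurable borel" by (rule fourier_measurable[OF \<phi>])
  have "integrable lborel (fourier \<phi>)"
  proof (rule Bochner_Integration.integrable_bound[OF i])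
    show "AE \<xi> in lborel. cmod (fourier \<phi> \<xi>) \<le> norm (4 * (M0 + M3) * (1 / (1 + \<xi>\<^sup>2)))"
    proof (rule AE_I2)
      fix \<xi>
      have "cmod (fourier \<phi> \<xi>) \<le> (1 + \<bar>\<xi>\<bar>) * cmod (fourier \<phi> \<xi>)"
        using mult_right_mono[of 1 "1 + \<bar>\<xi>\<bar>" "cmod (fourier \<phi> \<xi>)"] by simp
      then show "cmod (fourier \<phi> \<xi>) \<le> norm (4 * (M0 + M3) * (1 / (1 + \<xi>\<^sup>2)))"
        unfolding real_norm_def using b[of \<xi>] by linarith
    qed
  qed (use m in simp)
  moreover have "integrable lborel (\<lambda>\<xi>. \<bar>\<xi>\<bar> * cmod (fourier \<phi> \<xi>))"
  proof (rule Bochner_Integration.integrable_bound[OF i])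
    show "AE \<xi> in lborel. norm (\<bar>\<xi>\<bar> * cmod (fourier \<phi> \<xi>)) \<le> norm (4 * (M0 + M3) * (1 / (1 + \<xi>\<^sup>2)))"
    proof (rule AE_I2)
      fix \<xi>
      have "\<bar>\<xi>\<bar> * cmod (fourier \<phi> \<xi>) \<le> (1 + \<bar>\<xi>\<bar>) * cmod (fourier \<phi> \<xi>)"
        by (intro mult_right_mono) auto
      then have le: "\<bar>\<xi>\<bar> * cmod (fourier \<phi> \<xi>) \<le> 4 * (M0 + M3) * (1 / (1 + \<xi>\<^sup>2))"
        using b[of \<xi>] by linarith
      show "norm (\<bar>\<xi>\<bar> * cmod (fourier \<phi> \<xi>)) \<le> norm (4 * (M0 + M3) * (1 / (1 + \<xi>\<^sup>2)))"
        using order_trans[OF le abs_ge_self] by (simp only: real_norm_def abs_mult abs_abs abs_norm_cancel)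
    qed
  qed (use m in simp)
  ultimately show ?thesis by (simp add: decaying_def)
qed

text \<open>Inversion by Abel summation: inserting the factor \<open>exp (- d * \<bar>\<xi>\<bar>)\<close> turns the inverse transform
  into a Poisson integral.\<close>

lemma fourier_inversion:
  assumes \<phi>: "test_fun \<phi>"
  shows "(LINT \<xi>|lborel. fourier \<phi> \<xi> * cis (x * \<xi>)) = complex_of_real (2 * pi * \<phi> x)"
proof -
  obtain R M where M: "\<And>x. \<bar>\<phi> x\<bar> \<le> M" "M \<ge> 0" using test_fun_bounded[OF \<phi>] by metis
  have [measurable]: "\<phi> \<in> borel_measurable borel" "fourier \<phi> \<in> borel_measurable borel"
    using \<phi> test_fun_measurable fourier_measurable by auto
  have \<phi>i: "integrable lborel \<phi>" by (rule test_fun_integrable[OF \<phi>])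
  have fi: "integrable lborel (fourier \<phi>)" using decaying_fourier[OF \<phi>] by (simp add: decaying_def)
  define E where "E d \<xi> = complex_of_real (exp (- (d * \<bar>\<xi>\<bar>)))" for d \<xi> :: real
  have [measurable]: "E d \<in> borel_measurable borel" for d unfolding E_def by measurable
  have eq: "(LINT \<xi>|lborel. E d \<xi> * (fourier \<phi> \<xi> * cis (x * \<xi>))) = complex_of_real (2 * (LINT s|lborel. \<phi> (x - d * s) * (1 / (1 + s\<^sup>2))))"
    if d: "d > 0" for d
  proof -
    define f where "f y \<xi> = complex_of_real (\<phi> y) * (E d \<xi> * cis ((x - y) * \<xi>))" for y \<xi>
    have Ei: "integrable lborel (\<lambda>\<xi>. E d \<xi> * cis (s * \<xi>))" for s
      unfolding E_def by (intro integrable_cis_mult integrable_of_real integrable_exp_abs d)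
    have m: "(\<lambda>(y, \<xi>). f y \<xi>) \<in> borel_measurable (lborel \<Otimes>\<^sub>M lborel)" unfolding f_def by measurable
    have 1: "AE y in lborel. integrable lborel (f y)"
      unfolding f_def by (intro AE_I2 integrable_mult_right Ei)
    have 2: "integrable lborel (\<lambda>y. LINT \<xi>|lborel. norm (f y \<xi>))"
      unfolding f_def using \<phi>i by (simp add: norm_mult)
    note F = Fubini_swap(4)[OF m 1 2]
    have "(LINT \<xi>|lborel. E d \<xi> * (fourier \<phi> \<xi> * cis (x * \<xi>))) = (LINT \<xi>|lborel. LINT y|lborel. f y \<xi>)"
    proof (rule Bochner_Integration.integral_cong[OF refl])
      fix \<xi>
      have "f y \<xi> = E d \<xi> * cis (x * \<xi>) * (complex_of_real (\<phi> y) * cis (- \<xi> * y))" for y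
      proof -
        have "cis ((x - y) * \<xi>) = cis (x * \<xi>) * cis (- \<xi> * y)" by (simp add: cis_mult algebra_simps)
        then show ?thesis unfolding f_def by (simp only: mult_ac)
      qed
      then have "(LINT y|lborel. f y \<xi>) = E d \<xi> * cis (x * \<xi>) * fourier \<phi> \<xi>"
        by (simp only: fourier_alt integral_mult_right_zero)
      then show "E d \<xi> * (fourier \<phi> \<xi> * cis (x * \<xi>)) = (LINT y|lborel. f y \<xi>)"
        by (simp only: mult_ac)
    qed
    also have "\<dots> = (LINT y|lborel. complex_of_real (\<phi> y) * complex_of_real (2 * d / (d\<^sup>2 + (x - y)\<^sup>2)))"
    proof (subst F, rule Bochner_Integration.integral_cong[OF refl])
      fix y
      show "(LINT \<xi>|lborel. f y \<xi>) = complex_of_real (\<phi> y) * complex_of_real (2 * d / (d\<^sup>2 + (x - y)\<^sup>2))"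
        unfolding f_def E_def by (simp only: integral_mult_right_zero exp_abs_cis[OF d])
    qed
    also have "\<dots> = (LINT y|lborel. complex_of_real (\<phi> y * (2 * d / (d\<^sup>2 + (x - y)\<^sup>2))))"
      by simp
    also have "\<dots> = complex_of_real (LINT y|lborel. \<phi> y * (2 * d / (d\<^sup>2 + (x - y)\<^sup>2)))"
      by (rule integral_complex_of_real)
    also have "(LINT y|lborel. \<phi> y * (2 * d / (d\<^sup>2 + (x - y)\<^sup>2))) = 2 * (LINT s|lborel. \<phi> (x - d * s) * (1 / (1 + s\<^sup>2)))"
    proof -
      \<comment> \<open>The substitution y = x - d s moves the dependence on d from the Poisson
        kernel into the argument of \<phi> and leaves the fixed weight 1 / (1 + s^2).\<close>
      have "(LINT y|lborel. \<phi> y * (2 * d / (d\<^sup>2 + (x - y)\<^sup>2)))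
          = d * (LINT s|lborel. \<phi> (x + (- d) * s) * (2 * d / (d\<^sup>2 + (x - (x + (- d) * s))\<^sup>2)))"
        using lborel_integral_real_affine[of "- d" "\<lambda>y. \<phi> y * (2 * d / (d\<^sup>2 + (x - y)\<^sup>2))" x] d by simp
      also have "\<dots> = (LINT s|lborel. 2 * (\<phi> (x - d * s) * (1 / (1 + s\<^sup>2))))"
      proof (subst integral_mult_right_zero[symmetric], rule Bochner_Integration.integral_cong[OF refl])
        fix s :: real
        have "d\<^sup>2 + (x - (x + (- d) * s))\<^sup>2 = d\<^sup>2 * (1 + s\<^sup>2)" by (simp add: power_mult_distrib algebra_simps)
        then show "d * (\<phi> (x + (- d) * s) * (2 * d / (d\<^sup>2 + (x - (x + (- d) * s))\<^sup>2))) = 2 * (\<phi> (x - d * s) * (1 / (1 + s\<^sup>2)))"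
          using d by (simp add: power2_eq_square)
      qed
      finally show ?thesis by (simp only: integral_mult_right_zero)
    qed
    finally show ?thesis .
  qed
  have "(\<lambda>m. LINT \<xi>|lborel. E (cutoff m) \<xi> * (fourier \<phi> \<xi> * cis (x * \<xi>))) \<longlonglongrightarrow> (LINT \<xi>|lborel. fourier \<phi> \<xi> * cis (x * \<xi>))"
  proof (rule integral_dominated_convergence)
    show "integrable lborel (\<lambda>\<xi>. cmod (fourier \<phi> \<xi>))" using fi by simp
    show "AE \<xi> in lborel. (\<lambda>m. E (cutoff m) \<xi> * (fourier \<phi> \<xi> * cis (x * \<xi>))) \<longlonglongrightarrow> fourier \<phi> \<xi> * cis (x * \<xi>)"
    proof (rule AE_I2)
      fix \<xi>
      have "(\<lambda>m. E (cutoff m) \<xi> * (fourier \<phi> \<xi> * cis (x * \<xi>))) \<longlonglongrightarrow> complex_of_real (exp (- (0 * \<bar>\<xi>\<bar>))) * (fourier \<phi> \<xi> * cis (x * \<xi>))"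
        unfolding E_def by (intro tendsto_intros cutoff_tendsto)
      then show "(\<lambda>m. E (cutoff m) \<xi> * (fourier \<phi> \<xi> * cis (x * \<xi>))) \<longlonglongrightarrow> fourier \<phi> \<xi> * cis (x * \<xi>)" by simp
    qed
    show "AE \<xi> in lborel. norm (E (cutoff m) \<xi> * (fourier \<phi> \<xi> * cis (x * \<xi>))) \<le> cmod (fourier \<phi> \<xi>)" for m
    proof (rule AE_I2)
      fix \<xi>
      have "cmod (E (cutoff m) \<xi>) \<le> 1" using cutoff_bounds(1)[of m] by (simp add: E_def)
      then show "norm (E (cutoff m) \<xi> * (fourier \<phi> \<xi> * cis (x * \<xi>))) \<le> cmod (fourier \<phi> \<xi>)"
        using mult_right_mono[of "cmod (E (cutoff m) \<xi>)" 1 "cmod (fourier \<phi> \<xi>)"] by (simp add: norm_mult)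
    qed
  qed measurable
  moreover have "(\<lambda>m. LINT s|lborel. \<phi> (x - cutoff m * s) * (1 / (1 + s\<^sup>2))) \<longlonglongrightarrow> (LINT s|lborel. \<phi> x * (1 / (1 + s\<^sup>2)))"
  proof (rule integral_dominated_convergence)
    show "integrable lborel (\<lambda>s. M * (1 / (1 + s\<^sup>2)))" using inverse_square_integral(1) by (rule integrable_mult_right)
    have c: "isCont \<phi> x" using test_fun_DERIV[OF \<phi>] by (rule DERIV_isCont)
    show "AE s in lborel. (\<lambda>m. \<phi> (x - cutoff m * s) * (1 / (1 + s\<^sup>2))) \<longlonglongrightarrow> \<phi> x * (1 / (1 + s\<^sup>2))"
    proof (rule AE_I2)
      fix s :: real
      have "(\<lambda>m. x - cutoff m * s) \<longlonglongrightarrow> x - 0 * s" by (intro tendsto_intros cutoff_tendsto)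
      then have "(\<lambda>m. \<phi> (x - cutoff m * s)) \<longlonglongrightarrow> \<phi> x" using isCont_tendsto_compose[OF c] by simp
      then show "(\<lambda>m. \<phi> (x - cutoff m * s) * (1 / (1 + s\<^sup>2))) \<longlonglongrightarrow> \<phi> x * (1 / (1 + s\<^sup>2))" by (intro tendsto_intros)
    qed
    show "AE s in lborel. norm (\<phi> (x - cutoff m * s) * (1 / (1 + s\<^sup>2))) \<le> M * (1 / (1 + s\<^sup>2))" for m
      using M by (intro AE_I2) (auto simp: abs_mult intro!: divide_right_mono)
  qed measurable
  then have "(\<lambda>m. complex_of_real (2 * (LINT s|lborel. \<phi> (x - cutoff m * s) * (1 / (1 + s\<^sup>2))))) \<longlonglongrightarrow> complex_of_real (2 * (LINT s|lborel. \<phi> x * (1 / (1 + s\<^sup>2))))"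
    by (intro tendsto_intros)
  then have "(\<lambda>m. LINT \<xi>|lborel. E (cutoff m) \<xi> * (fourier \<phi> \<xi> * cis (x * \<xi>))) \<longlonglongrightarrow> complex_of_real (2 * (LINT s|lborel. \<phi> x * (1 / (1 + s\<^sup>2))))"
    by (simp only: eq[OF cutoff_bounds(1)])
  moreover have "(LINT s|lborel. \<phi> x * (1 / (1 + s\<^sup>2))) = \<phi> x * pi"
    by (simp only: integral_mult_right_zero inverse_square_integral(2))
  ultimately show ?thesis using LIMSEQ_unique by (auto simp: mult_ac)
qed

section \<open>One-sided Gamma kernels\<close>

definition gamma_ker :: "real \<Rightarrow> real \<Rightarrow> real" where
  "gamma_ker s y = (if y > 0 then y powr (s - 1) * exp (- y) else 0)"

lemma gamma_ker_measurable [measurable]: "gamma_ker s \<in> borel_measurable borel"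
  unfolding gamma_ker_def[abs_def] by measurable

lemma gamma_ker_nonneg [simp]: "gamma_ker s y \<ge> 0" by (simp add: gamma_ker_def)

lemma gamma_ker_integral:
  assumes s: "s > 0"
  shows "integrable lborel (gamma_ker s)" "(LINT y|lborel. gamma_ker s y) = Gamma s"
proof -
  have i: "((\<lambda>t. t powr (s - 1) / exp t) has_integral Gamma s) {0..}" by (rule Gamma_integral_real[OF s])
  then have "(\<lambda>t. t powr (s - 1) / exp t) absolutely_integrable_on {0..}"
    by (intro nonnegative_absolutely_integrable_1) (auto simp: has_integral_integrable)
  then have 1: "set_integrable lborel {0..} (\<lambda>t. t powr (s - 1) / exp t)"
    unfolding set_integrable_def by (subst (asm) integrable_completion) auto
  have 2: "(LINT t:{0..}|lborel. t powr (s - 1) / exp t) = Gamma s"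
    using set_borel_integral_eq_integral(2)[OF 1] integral_unique[OF i] by simp
  have e: "indicator {0..} t *\<^sub>R (t powr (s - 1) / exp t) = gamma_ker s t" for t
    by (cases "t = 0") (auto simp: indicator_def gamma_ker_def exp_minus divide_inverse)
  show "integrable lborel (gamma_ker s)" using 1 unfolding set_integrable_def e .
  show "(LINT y|lborel. gamma_ker s y) = Gamma s" using 2 unfolding set_lebesgue_integral_def e .
qed

lemma gamma_ker_Suc: "y * gamma_ker s y = gamma_ker (s + 1) y"
proof (cases "y > 0")
  case True
  then have "y * y powr (s - 1) = y powr s" using powr_mult_base[of y "s - 1"] by simp
  then show ?thesis using True by (simp add: gamma_ker_def mult.assoc[symmetric])
qed (simp add: gamma_ker_def)

section \<open>Fourier transform of the Gamma kernel\<close>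

lemma DERIV_integral_dilate:
  fixes k g g' :: "real \<Rightarrow> real"
  assumes k: "integrable lborel k" and yk: "integrable lborel (\<lambda>y. y * k y)"
    and g: "\<And>x. DERIV g x :> g' x" and g': "\<And>x. \<bar>g' x\<bar> \<le> 1" and gb: "\<And>x. \<bar>g x\<bar> \<le> 1"
    and [measurable]: "g' \<in> borel_measurable borel"
  shows "DERIV (\<lambda>\<xi>. LINT y|lborel. k y * g (\<xi> * y)) \<xi> :> (LINT y|lborel. y * k y * g' (\<xi> * y))"
  unfolding has_field_derivative_iff tendsto_at_iff_sequentially
proof (intro allI impI)
  fix X :: "nat \<Rightarrow> real" assume X: "\<forall>i. X i \<in> UNIV - {\<xi>}" and lim: "X \<longlonglongrightarrow> \<xi>"
  have [measurable]: "k \<in> borel_measurable borel" using k by auto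
  have [measurable]: "g \<in> borel_measurable borel"
    using g by (intro borel_measurable_continuous_onI continuous_at_imp_continuous_on) (auto intro: DERIV_isCont)
  have lip: "\<bar>g a - g b\<bar> \<le> \<bar>a - b\<bar>" for a b
    using field_differentiable_bound[of UNIV g g' 1 a b] g g' by simp
  have ki: "integrable lborel (\<lambda>y. k y * g (c * y))" for c
    by (rule Bochner_Integration.integrable_bound[OF k]) (use gb in \<open>auto simp: abs_mult intro!: AE_I2 mult_left_le\<close>)
  have q: "(LINT y|lborel. k y * ((g (X n * y) - g (\<xi> * y)) / (X n - \<xi>)))
     = ((LINT y|lborel. k y * g (X n * y)) - (LINT y|lborel. k y * g (\<xi> * y))) / (X n - \<xi>)" for n
  proof -
    have "(LINT y|lborel. k y * ((g (X n * y) - g (\<xi> * y)) / (X n - \<xi>)))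
      = (LINT y|lborel. (k y * g (X n * y) - k y * g (\<xi> * y)) / (X n - \<xi>))"
      by (simp add: right_diff_distrib)
    then show ?thesis using ki by simp
  qed
  have "(\<lambda>n. LINT y|lborel. k y * ((g (X n * y) - g (\<xi> * y)) / (X n - \<xi>))) \<longlonglongrightarrow> (LINT y|lborel. y * k y * g' (\<xi> * y))"
  proof (rule integral_dominated_convergence)
    show "integrable lborel (\<lambda>y. \<bar>y * k y\<bar>)" using yk by simp
    show "AE y in lborel. (\<lambda>n. k y * ((g (X n * y) - g (\<xi> * y)) / (X n - \<xi>))) \<longlonglongrightarrow> y * k y * g' (\<xi> * y)"
    proof (rule AE_I2)
      fix y
      have "DERIV (\<lambda>\<xi>. g (\<xi> * y)) \<xi> :> g' (\<xi> * y) * y"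
        by (auto intro!: derivative_eq_intros DERIV_chain2[OF g])
      then have "(\<lambda>n. (g (X n * y) - g (\<xi> * y)) / (X n - \<xi>)) \<longlonglongrightarrow> g' (\<xi> * y) * y"
        using X lim unfolding has_field_derivative_iff tendsto_at_iff_sequentially by (auto simp: o_def)
      then have "(\<lambda>n. k y * ((g (X n * y) - g (\<xi> * y)) / (X n - \<xi>))) \<longlonglongrightarrow> k y * (g' (\<xi> * y) * y)"
        by (intro tendsto_intros)
      then show "(\<lambda>n. k y * ((g (X n * y) - g (\<xi> * y)) / (X n - \<xi>))) \<longlonglongrightarrow> y * k y * g' (\<xi> * y)"
        by (simp add: mult_ac)
    qed
    show "AE y in lborel. norm (k y * ((g (X n * y) - g (\<xi> * y)) / (X n - \<xi>))) \<le> \<bar>y * k y\<bar>" for n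
    proof (rule AE_I2)
      fix y
      have ne: "\<bar>X n - \<xi>\<bar> > 0" using X by auto
      have "\<bar>g (X n * y) - g (\<xi> * y)\<bar> \<le> \<bar>y\<bar> * \<bar>X n - \<xi>\<bar>"
      proof -
        have "X n * y - \<xi> * y = y * (X n - \<xi>)" by (simp add: algebra_simps)
        then show ?thesis using lip[of "X n * y" "\<xi> * y"] by (simp only: abs_mult)
      qed
      then have "\<bar>(g (X n * y) - g (\<xi> * y)) / (X n - \<xi>)\<bar> \<le> \<bar>y\<bar>"
        using ne by (simp add: abs_divide divide_le_eq)
      then show "norm (k y * ((g (X n * y) - g (\<xi> * y)) / (X n - \<xi>))) \<le> \<bar>y * k y\<bar>"
      proof -
        assume le: "\<bar>(g (X n * y) - g (\<xi> * y)) / (X n - \<xi>)\<bar> \<le> \<bar>y\<bar>"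
        have "\<bar>y * k y\<bar> = \<bar>k y\<bar> * \<bar>y\<bar>" by (simp add: abs_mult mult.commute)
        then show ?thesis unfolding real_norm_def abs_mult[of "k y"] using le by (simp only: mult_left_mono abs_ge_zero)
      qed
    qed
  qed measurable
  then show "((\<lambda>y. ((LINT ya|lborel. k ya * g (y * ya)) - (LINT y|lborel. k y * g (\<xi> * y))) / (y - \<xi>)) \<circ> X) \<longlonglongrightarrow> (LINT y|lborel. y * k y * g' (\<xi> * y))"
    unfolding q by (simp add: o_def)
qed

text \<open>The exponent has the sign opposite to that in \<open>kernel_fourier\<close>: this is the
  transform of the reflected kernel, the one that meets the test function after transposition. For s
  > 0 its value is Gamma(s) (1 - i \<xi>)^(-s).\<close>

definition gamma_ft :: "real \<Rightarrow> real \<Rightarrow> complex" where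
  "gamma_ft s \<xi> = (LINT y|lborel. complex_of_real (gamma_ker s y) * cis (\<xi> * y))"

lemma gamma_ft_integrable: "s > 0 \<Longrightarrow> integrable lborel (\<lambda>y. complex_of_real (gamma_ker s y) * cis (\<xi> * y))"
  by (intro integrable_cis_mult integrable_of_real gamma_ker_integral)

lemma gamma_ft_derivative:
  assumes s: "s > 0"
  shows "(gamma_ft s has_vector_derivative \<i> * gamma_ft (s + 1) \<xi>) (at \<xi>)"
proof -
  have 1: "integrable lborel (gamma_ker s)" "integrable lborel (\<lambda>y. y * gamma_ker s y)"
    using gamma_ker_integral(1)[of s] gamma_ker_integral(1)[of "s + 1"] s by (simp_all add: gamma_ker_Suc)
  have Re: "Re (gamma_ft s \<xi>) = (LINT y|lborel. gamma_ker s y * cos (\<xi> * y))" if "s > 0" for s \<xi>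
    unfolding gamma_ft_def integral_Re[OF gamma_ft_integrable[OF that], symmetric] by simp
  have Im: "Im (gamma_ft s \<xi>) = (LINT y|lborel. gamma_ker s y * sin (\<xi> * y))" if "s > 0" for s \<xi>
    unfolding gamma_ft_def integral_Im[OF gamma_ft_integrable[OF that], symmetric] by simp
  have "DERIV (\<lambda>\<xi>. LINT y|lborel. gamma_ker s y * cos (\<xi> * y)) \<xi> :> (LINT y|lborel. y * gamma_ker s y * - sin (\<xi> * y))"
    by (rule DERIV_integral_dilate[OF 1]) (auto intro!: derivative_eq_intros)
  moreover have "DERIV (\<lambda>\<xi>. LINT y|lborel. gamma_ker s y * sin (\<xi> * y)) \<xi> :> (LINT y|lborel. y * gamma_ker s y * cos (\<xi> * y))"
    by (rule DERIV_integral_dilate[OF 1]) (auto intro!: derivative_eq_intros)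
  ultimately show ?thesis
    unfolding has_vector_derivative_complex_iff
    using s by (simp add: Re Im gamma_ker_Suc has_real_derivative_iff_has_vector_derivative)
qed

lemma powr_exp_tendsto_0: "((\<lambda>y::real. y powr s * exp (- y)) \<longlongrightarrow> 0) at_top"
proof -
  obtain n :: nat where n: "s \<le> real n" using real_arch_simple by blast
  show ?thesis
  proof (rule Lim_null_comparison[OF _ tendsto_power_div_exp_0[of n]])
    show "\<forall>\<^sub>F y in at_top. norm (y powr s * exp (- y)) \<le> y ^ n / exp y"
    proof (rule eventually_at_top_linorderI[of 1])
      fix y :: real assume y: "y \<ge> 1"
      have "y powr s \<le> y powr real n" using n y by (intro powr_mono)
      then have "y powr s \<le> y ^ n" using y by (simp add: powr_realpow)
      then show "norm (y powr s * exp (- y)) \<le> y ^ n / exp y"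
        by (simp add: exp_minus divide_inverse)
    qed
  qed
qed

text \<open>The integral over the half-line of the derivative of y^s exp (- y) exp (i \<xi> y) is 0,
  since this function vanishes at both ends.\<close>

lemma gamma_ft_recurrence:
  assumes s: "s > 0"
  shows "(1 - \<i> * of_real \<xi>) * gamma_ft (s + 1) \<xi> = of_real s * gamma_ft s \<xi>"
proof -
  define F where "F y = complex_of_real (y powr s * exp (- y)) * cis (\<xi> * y)" for y
  define f where "f y = complex_of_real (s * (y powr (s - 1) * exp (- y)) - y powr s * exp (- y)) * cis (\<xi> * y)
    + complex_of_real (y powr s * exp (- y)) * (\<i> * of_real \<xi> * cis (\<xi> * y))" for y
  have D: "(F has_vector_derivative f y) (at y)" if y: "y > 0" for y
  proof -
    have "DERIV (\<lambda>y. y powr s * exp (- y)) y :> s * (y powr (s - 1) * exp (- y)) - y powr s * exp (- y)"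
      using y by (auto intro!: derivative_eq_intros simp: powr_diff field_simps)
    then have 1: "((\<lambda>y. complex_of_real (y powr s * exp (- y))) has_vector_derivative
        complex_of_real (s * (y powr (s - 1) * exp (- y)) - y powr s * exp (- y))) (at y)"
      by (rule has_vector_derivative_of_real)
    show ?thesis unfolding F_def
      by (rule has_vector_derivative_eq_rhs[OF has_vector_derivative_mult[OF 1 has_vector_derivative_cis]])
        (simp add: f_def algebra_simps)
  qed
  have fe: "indicator {0<..} y *\<^sub>R f y = of_real s * (complex_of_real (gamma_ker s y) * cis (\<xi> * y)) - (1 - \<i> * of_real \<xi>) * (complex_of_real (gamma_ker (s + 1) y) * cis (\<xi> * y))" for y
    by (cases "y > 0") (auto simp: indicator_def f_def gamma_ker_def algebra_simps)
  have i: "integrable lborel (\<lambda>y. indicator {0<..} y *\<^sub>R f y)"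
    unfolding fe using s by (intro Bochner_Integration.integrable_diff integrable_mult_right gamma_ft_integrable) auto
  have ei: "einterval 0 \<infinity> = {0<..}" by (auto simp: einterval_def zero_ereal_def)
  have "(CLBINT y=0..\<infinity>. f y) = 0 - 0"
  proof (rule interval_integral_FTC_integrable)
    show "(F has_vector_derivative f y) (at y)" if "0 < ereal y" for y using D that by simp
    have cf: "continuous_on {0<..} f"
      unfolding f_def by (intro continuous_intros) auto
    show "isCont f y" if "0 < ereal y" for y
      using that cf by (simp add: continuous_on_eq_continuous_at)
    show "set_integrable lborel (einterval 0 \<infinity>) f" using i by (simp add: ei set_integrable_def)
    have nF: "norm (F y) = y powr s * exp (- y)" for y by (simp add: F_def norm_mult abs_mult)
    have "((\<lambda>y. y powr s * exp (- y)) \<longlongrightarrow> 0 * exp (- 0)) (at_right 0)"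
      using s eventually_mono[OF eventually_at_right_less[of "0::real"] less_imp_le]
      by (intro tendsto_intros tendsto_zero_powrI[OF _ tendsto_const]) auto
    then have "(F \<longlongrightarrow> 0) (at_right 0)" by (intro Lim_null_comparison[of F]) (auto simp: nF)
    then show "((F \<circ> real_of_ereal) \<longlongrightarrow> 0) (at_right 0)" by (simp add: ereal_tendsto_simps zero_ereal_def)
    have "(F \<longlongrightarrow> 0) at_top" using powr_exp_tendsto_0[of s] by (intro Lim_null_comparison[of F]) (auto simp: nF)
    then show "((F \<circ> real_of_ereal) \<longlongrightarrow> 0) (at_left \<infinity>)" by (simp add: ereal_tendsto_simps)
  qed simp
  then have "(LINT y|lborel. indicator {0<..} y *\<^sub>R f y) = 0" by (simp add: interval_integral_0_infinity_eq)
  then have "of_real s * gamma_ft s \<xi> - (1 - \<i> * of_real \<xi>) * gamma_ft (s + 1) \<xi> = 0"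
    unfolding fe gamma_ft_def using s
    by (subst (asm) Bochner_Integration.integral_diff) (auto intro!: integrable_mult_right gamma_ft_integrable)
  then show ?thesis by simp
qed

text \<open>Derivative formula and recurrence combine to G' = i s G / (1 - i \<xi>) for G =
  \<open>gamma_ft s\<close>. The auxiliary E is (1 - i \<xi>)^s in polar form, so G E is constant,
  with value Gamma(s) at 0.\<close>

lemma gamma_ft_eq:
  assumes s: "s > 0"
  shows "gamma_ft s \<xi> = complex_of_real (Gamma s * (1 + \<xi>\<^sup>2) powr (- s / 2)) * cis (s * arctan \<xi>)"
proof -
  have pos: "1 + \<xi>\<^sup>2 > 0" for \<xi> :: real by (intro add_pos_nonneg) auto
  define E where "E \<xi> = complex_of_real ((1 + \<xi>\<^sup>2) powr (s / 2)) * cis (- s * arctan \<xi>)" for \<xi>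
  have DE: "(E has_vector_derivative E \<xi> * (of_real s * (of_real \<xi> - \<i>) / of_real (1 + \<xi>\<^sup>2))) (at \<xi>)" for \<xi>
  proof -
    have "DERIV (\<lambda>\<xi>. (1 + \<xi>\<^sup>2) powr (s / 2)) \<xi> :> (1 + \<xi>\<^sup>2) powr (s / 2) * (s * \<xi> / (1 + \<xi>\<^sup>2))"
    proof (rule DERIV_cong)
      show "DERIV (\<lambda>\<xi>. (1 + \<xi>\<^sup>2) powr (s / 2)) \<xi> :> s / 2 * (1 + \<xi>\<^sup>2) powr (s / 2 - 1) * (2 * \<xi>)"
        using pos[of \<xi>] by (auto intro!: derivative_eq_intros simp: powr_diff)
      show "s / 2 * (1 + \<xi>\<^sup>2) powr (s / 2 - 1) * (2 * \<xi>) = (1 + \<xi>\<^sup>2) powr (s / 2) * (s * \<xi> / (1 + \<xi>\<^sup>2))"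
      proof -
        have "(1 + \<xi>\<^sup>2) powr (s / 2 - 1) = (1 + \<xi>\<^sup>2) powr (s / 2) / (1 + \<xi>\<^sup>2)"
          using pos[of \<xi>] by (simp add: powr_diff)
        moreover have "s / 2 * (P / D) * (2 * \<xi>) = P * (s * \<xi> / D)" for P D :: real by simp
        ultimately show ?thesis by presburger
      qed
    qed
    then have 1: "((\<lambda>\<xi>. complex_of_real ((1 + \<xi>\<^sup>2) powr (s / 2))) has_vector_derivative complex_of_real ((1 + \<xi>\<^sup>2) powr (s / 2) * (s * \<xi> / (1 + \<xi>\<^sup>2)))) (at \<xi>)"
      by (rule has_vector_derivative_of_real)
    have "(arctan has_vector_derivative 1 / (1 + \<xi>\<^sup>2)) (at \<xi>)"
      using DERIV_arctan[of \<xi>] by (simp add: has_real_derivative_iff_has_vector_derivative divide_inverse)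
    from vector_diff_chain_at[OF this has_vector_derivative_cis[of "- s" "arctan \<xi>" UNIV]]
    have 2: "((\<lambda>\<xi>. cis (- s * arctan \<xi>)) has_vector_derivative (1 / (1 + \<xi>\<^sup>2)) *\<^sub>R (\<i> * of_real (- s) * cis (- s * arctan \<xi>))) (at \<xi>)"
      by (simp add: o_def)
    show ?thesis unfolding E_def
      by (rule has_vector_derivative_eq_rhs[OF has_vector_derivative_mult[OF 1 2]])
        (simp add: scaleR_conv_of_real algebra_simps diff_divide_distrib add_divide_distrib)
  qed
  have D0: "((\<lambda>\<xi>. gamma_ft s \<xi> * E \<xi>) has_vector_derivative 0) (at \<xi> within UNIV)" for \<xi>
  proof -
    have nz: "complex_of_real (1 + \<xi>\<^sup>2) \<noteq> 0" unfolding of_real_eq_0_iff using pos[of \<xi>] by simp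
    have r: "gamma_ft s \<xi> * of_real s = (1 - \<i> * of_real \<xi>) * gamma_ft (s + 1) \<xi>"
      using gamma_ft_recurrence[OF s, of \<xi>] by (simp add: mult.commute)
    have "gamma_ft s \<xi> * (of_real s * (of_real \<xi> - \<i>)) = gamma_ft (s + 1) \<xi> * ((1 - \<i> * of_real \<xi>) * (of_real \<xi> - \<i>))"
      unfolding mult.assoc[symmetric] r by (simp add: mult_ac)
    also have "(1 - \<i> * of_real \<xi>) * (of_real \<xi> - \<i>) = - \<i> * of_real (1 + \<xi>\<^sup>2)"
      by (simp add: complex_eq_iff power2_eq_square)
    finally have k: "gamma_ft s \<xi> * (of_real s * (of_real \<xi> - \<i>) / of_real (1 + \<xi>\<^sup>2)) = - (\<i> * gamma_ft (s + 1) \<xi>)"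
      using nz by (simp add: field_simps)
    have "gamma_ft s \<xi> * (E \<xi> * (of_real s * (of_real \<xi> - \<i>) / of_real (1 + \<xi>\<^sup>2))) + \<i> * gamma_ft (s + 1) \<xi> * E \<xi>
       = E \<xi> * (gamma_ft s \<xi> * (of_real s * (of_real \<xi> - \<i>) / of_real (1 + \<xi>\<^sup>2)) + \<i> * gamma_ft (s + 1) \<xi>)"
      by (simp only: distrib_left mult_ac)
    also have "\<dots> = 0" unfolding k by simp
    finally show ?thesis
      by (rule has_vector_derivative_eq_rhs[OF has_vector_derivative_mult[OF gamma_ft_derivative[OF s] DE]])
  qed
  obtain c where c: "\<And>\<xi>. gamma_ft s \<xi> * E \<xi> = c"
    using has_vector_derivative_zero_constant[OF convex_UNIV D0] by auto
  have "c = gamma_ft s 0" using c[of 0] by (simp add: E_def)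
  also have "\<dots> = complex_of_real (Gamma s)"
    unfolding gamma_ft_def using gamma_ker_integral(2)[OF s] by simp
  finally have q: "gamma_ft s \<xi> * E \<xi> = complex_of_real (Gamma s)" using c by simp
  have inv: "E \<xi> * (complex_of_real ((1 + \<xi>\<^sup>2) powr (- s / 2)) * cis (s * arctan \<xi>)) = 1"
  proof -
    have "(1 + \<xi>\<^sup>2) powr (s / 2) * (1 + \<xi>\<^sup>2) powr (- s / 2) = 1"
      using pos[of \<xi>] by (simp add: powr_add[symmetric])
    then have "complex_of_real ((1 + \<xi>\<^sup>2) powr (s / 2)) * complex_of_real ((1 + \<xi>\<^sup>2) powr (- s / 2)) = 1"
      by (metis of_real_1 of_real_mult)
    moreover have "cis (- s * arctan \<xi>) * cis (s * arctan \<xi>) = 1" by (simp add: cis_mult)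
    moreover have rearr: "(P * A) * (Q * B) = (P * Q) * (A * B)" for P Q A B :: complex by (simp only: mult_ac)
    ultimately show ?thesis unfolding E_def by (subst rearr) (simp only: mult_1_right)
  qed
  have "gamma_ft s \<xi> = gamma_ft s \<xi> * (E \<xi> * (complex_of_real ((1 + \<xi>\<^sup>2) powr (- s / 2)) * cis (s * arctan \<xi>)))"
    unfolding inv by simp
  also have "\<dots> = complex_of_real (Gamma s) * (complex_of_real ((1 + \<xi>\<^sup>2) powr (- s / 2)) * cis (s * arctan \<xi>))"
    by (simp only: mult.assoc[symmetric] q)
  finally show ?thesis by (simp add: mult.assoc)
qed

definition damped_ker :: "real \<Rightarrow> real \<Rightarrow> real" where
  "damped_ker s y = gamma_ker s y / Gamma s"

lemma damped_ker_measurable [measurable]: "damped_ker s \<in> borel_measurable borel"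
  unfolding damped_ker_def[abs_def] by measurable

lemma damped_ker_integrable: "s > 0 \<Longrightarrow> integrable lborel (damped_ker s)"
  unfolding damped_ker_def[abs_def] using gamma_ker_integral(1) by auto

lemma damped_ker_kernel_fourier:
  assumes s: "s > 0"
  shows "kernel_fourier (\<lambda>t. damped_ker s (- t)) \<xi> = exp (of_real (- s) * phase_mult \<xi>) * complex_of_real ((1 + \<xi>\<^sup>2) powr (- s / 2))"
proof -
  have G: "Gamma s \<noteq> 0" using Gamma_real_pos[OF s] by simp
  have "kernel_fourier (\<lambda>t. damped_ker s (- t)) \<xi> = (LINT t|lborel. complex_of_real (damped_ker s t) * cis (\<xi> * t))"
    unfolding kernel_fourier_def using lborel_integral_shift(4)[of "\<lambda>t. complex_of_real (damped_ker s t) * cis (\<xi> * t)"] by simp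
  also have "\<dots> = (LINT t|lborel. complex_of_real (1 / Gamma s) * (complex_of_real (gamma_ker s t) * cis (\<xi> * t)))"
    by (simp add: damped_ker_def)
  also have "\<dots> = complex_of_real (1 / Gamma s) * gamma_ft s \<xi>"
    unfolding gamma_ft_def by (rule integral_mult_right_zero)
  also have "\<dots> = complex_of_real ((1 + \<xi>\<^sup>2) powr (- s / 2)) * cis (s * arctan \<xi>)"
    unfolding gamma_ft_eq[OF s] using G by simp
  also have "cis (s * arctan \<xi>) = exp (of_real (- s) * phase_mult \<xi>)"
    by (simp add: cis_conv_exp phase_mult_def mult_ac)
  finally show ?thesis by (simp add: mult.commute)
qed

text \<open>Transposition moves the damped kernel to \<phi> and gives the symbol v, which is the
  Bessel symbol w times the phase exp (- \<alpha> \<open>phase_mult\<close>). By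
  \<open>phase_operator\<close> this phase can be carried by \<psi> instead, and that replaces
  \<psi> by h.\<close>

theorem bessel_rep_conv:
  assumes \<alpha>: "\<alpha> > 0" and p: "p > 1"
  obtains C where "C \<ge> 0" "\<And>\<psi>. Lp p \<psi> \<Longrightarrow> integrable lborel \<psi> \<Longrightarrow>
     \<exists>h. bessel_rep \<alpha> p (conv (damped_ker \<alpha>) \<psi>) h \<and> Lp_norm p h \<le> C * Lp_norm p \<psi>"
proof -
  define q where "q = p / (p - 1)"
  have q: "q > 1" "1/p + 1/q = 1" using p by (auto simp: q_def field_simps)
  obtain K where K: "K \<ge> 0" "\<And>\<psi>. Lp p \<psi> \<Longrightarrow> integrable lborel \<psi> \<Longrightarrow>
     \<exists>h. Lp p h \<and> Lp_norm p h \<le> K * Lp_norm p \<psi> \<and>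
       (\<forall>w. decaying w \<longrightarrow> Lp q (Finv w) \<longrightarrow>
         (LINT x|lborel. h x * Finv w x) = (LINT x|lborel. \<psi> x * Finv (\<lambda>\<xi>. exp (of_real (- \<alpha>) * phase_mult \<xi>) * w \<xi>) x))"
    using phase_operator[OF p q, of \<alpha>] by blast
  have k: "integrable lborel (damped_ker \<alpha>)" by (rule damped_ker_integrable[OF \<alpha>])
  have k': "integrable lborel (\<lambda>t. damped_ker \<alpha> (- t))" using k lborel_integrable_shift(4)[of "damped_ker \<alpha>"] by simp
  show ?thesis
  proof (rule that[OF K(1)])
    fix \<psi> assume \<psi>: "Lp p \<psi>" and \<psi>i: "integrable lborel \<psi>"
    obtain h where h: "Lp p h" "Lp_norm p h \<le> K * Lp_norm p \<psi>"
      "\<And>w. decaying w \<Longrightarrow> Lp q (Finv w) \<Longrightarrow>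
         (LINT x|lborel. h x * Finv w x) = (LINT x|lborel. \<psi> x * Finv (\<lambda>\<xi>. exp (of_real (- \<alpha>) * phase_mult \<xi>) * w \<xi>) x)"
      using K(2)[OF \<psi> \<psi>i] by blast
    have "(LINT x|lborel. conv (damped_ker \<alpha>) \<psi> x * \<phi> x) = (LINT x|lborel. h x * bessel_inv \<alpha> \<phi> x)" if \<phi>: "test_fun \<phi>" for \<phi>
    proof -
      define u where "u \<xi> = complex_of_real (1 / (2 * pi)) * fourier \<phi> \<xi>" for \<xi>
      define w where "w \<xi> = complex_of_real ((1 + \<xi>\<^sup>2) powr (- \<alpha> / 2)) * u \<xi>" for \<xi>
      define v where "v \<xi> = exp (of_real (- \<alpha>) * phase_mult \<xi>) * w \<xi>" for \<xi>
      have gu: "decaying u" unfolding u_def by (rule decaying_mult[OF decaying_fourier[OF \<phi>]]) auto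
      have gw: "decaying w" unfolding w_def
      proof (rule decaying_mult[OF gu])
        fix \<xi> :: real
        have "(1 + \<xi>\<^sup>2) powr (- \<alpha> / 2) \<le> 1 powr (- \<alpha> / 2)"
          using \<alpha> by (intro powr_mono2') auto
        then show "cmod (complex_of_real ((1 + \<xi>\<^sup>2) powr (- \<alpha> / 2))) \<le> 1" by simp
      qed measurable
      have em: "cmod (exp (of_real c * phase_mult \<xi>)) \<le> 1" for c \<xi> by (simp add: phase_mult_def)
      have gv: "decaying v" unfolding v_def by (rule decaying_mult[OF gw _ em]) measurable
      \<comment> \<open>Membership in L_q is clear for \<open>Finv v\<close>, an integrable kernel
        convolved with \<phi>; undoing the phase transfers it to \<open>Finv w\<close>.\<close>
      have wv: "w = (\<lambda>\<xi>. exp (of_real \<alpha> * phase_mult \<xi>) * v \<xi>)"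
        unfolding v_def by (simp add: mult.assoc[symmetric] exp_add[symmetric])
      have bw: "bessel_inv \<alpha> \<phi> = Finv w"
      proof
        fix x
        have "Finv w x = Re (LINT \<xi>|lborel. complex_of_real (1 / (2 * pi)) * (complex_of_real ((1 + \<xi>\<^sup>2) powr (- \<alpha> / 2)) * fourier \<phi> \<xi> * cis (x * \<xi>)))"
          unfolding Finv_def w_def u_def by (simp only: mult_ac)
        then show "bessel_inv \<alpha> \<phi> x = Finv w x"
          unfolding integral_mult_right_zero by (simp add: bessel_inv_def)
      qed
      have Fu: "Finv u = \<phi>"
      proof
        fix x
        have "Finv u x = Re (complex_of_real (1 / (2 * pi)) * (LINT \<xi>|lborel. fourier \<phi> \<xi> * cis (x * \<xi>)))"
          unfolding Finv_def u_def by (simp only: mult.assoc integral_mult_right_zero)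
        then show "Finv u x = \<phi> x" unfolding fourier_inversion[OF \<phi>] by simp
      qed
      have Fv: "Finv v = conv (\<lambda>t. damped_ker \<alpha> (- t)) \<phi>"
      proof
        fix x
        have "conv (\<lambda>t. damped_ker \<alpha> (- t)) (Finv u) x = Finv (\<lambda>\<xi>. kernel_fourier (\<lambda>t. damped_ker \<alpha> (- t)) \<xi> * u \<xi>) x"
          by (rule Finv_conv[OF k']) (use gu in \<open>simp add: decaying_def\<close>)
        then show "Finv v x = conv (\<lambda>t. damped_ker \<alpha> (- t)) \<phi> x"
          unfolding Fu damped_ker_kernel_fourier[OF \<alpha>] v_def w_def by (simp only: mult.assoc)
      qed
      have \<phi>q: "Lp q \<phi>" using q by (intro test_fun_Lp[OF \<phi>]) simp
      have vq: "Lp q (Finv v)" unfolding Fv by (rule Young_convolution(2)[OF k' \<phi>q q(1)])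
      have wq: "Lp q (Finv w)" unfolding wv by (rule Finv_exp_Lp[OF gv vq q(1)])
      have "(LINT x|lborel. conv (damped_ker \<alpha>) \<psi> x * \<phi> x) = (LINT x|lborel. \<psi> x * conv (\<lambda>t. damped_ker \<alpha> (- t)) \<phi> x)"
        by (rule conv_transpose[OF k \<psi> \<phi>q p q])
      also have "\<dots> = (LINT x|lborel. \<psi> x * Finv v x)" unfolding Fv ..
      also have "\<dots> = (LINT x|lborel. h x * Finv w x)" using h(3)[OF gw wq] by (simp add: v_def[abs_def])
      finally show ?thesis unfolding bw .
    qed
    then have "bessel_rep \<alpha> p (conv (damped_ker \<alpha>) \<psi>) h"
      using h(1) Young_convolution(2)[OF k \<psi> p] by (simp add: bessel_rep_def)
    then show "\<exists>h. bessel_rep \<alpha> p (conv (damped_ker \<alpha>) \<psi>) h \<and> Lp_norm p h \<le> K * Lp_norm p \<psi>"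
      using h(2) by blast
  qed
qed

section \<open>Riemann--Liouville potentials as Bessel-type potentials\<close>

definition power_ker :: "real \<Rightarrow> real \<Rightarrow> real" where
  "power_ker s y = pluspow (s - 1) y / Gamma s"

lemma power_ker_damped_ker: "power_ker s y = exp y * damped_ker s y"
  by (simp add: power_ker_def damped_ker_def pluspow_def gamma_ker_def exp_minus)

lemma damped_ker_nonpos [simp]: "y \<le> 0 \<Longrightarrow> damped_ker s y = 0"
  by (simp add: damped_ker_def gamma_ker_def)

lemma power_ker_nonpos [simp]: "y \<le> 0 \<Longrightarrow> power_ker s y = 0"
  by (simp add: power_ker_damped_ker)

lemma power_ker_measurable [measurable]: "power_ker s \<in> borel_measurable borel"
  unfolding power_ker_damped_ker[abs_def] by measurable

lemma damped_ker_nonneg: "s > 0 \<Longrightarrow> damped_ker s y \<ge> 0"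
  using Gamma_real_pos[of s] by (simp add: damped_ker_def)

text \<open>Substituting t = y s gives Euler's Beta integral, while the damping factors multiply to
  exp (- y). For y \<le> 0 the two factors are never nonzero together.\<close>

lemma conv_damped_ker:
  assumes a: "a > 0" and b: "b > 0"
  shows "conv (damped_ker a) (damped_ker b) y = damped_ker (a + b) y"
proof (cases "y > 0")
  case False
  have z: "damped_ker a t * damped_ker b (y - t) = 0" for t using False by (cases "t \<le> 0") auto
  show ?thesis using False unfolding conv_def z by simp
next
  case True
  have e: "gamma_ker a (0 + y * s) * gamma_ker b (y - (0 + y * s)) = exp (- y) * y powr (a + b - 2) * (indicator {0..1} s *\<^sub>R (s powr (a - 1) * (1 - s) powr (b - 1)))" for s
  proof (cases "0 < s \<and> s < 1")
    case s: True
    have m: "y - y * s = y * (1 - s)" by (simp add: algebra_simps)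
    have "gamma_ker a (0 + y * s) * gamma_ker b (y - (0 + y * s)) = (y powr (a - 1) * y powr (b - 1)) * (exp (- (y * s)) * exp (- (y * (1 - s)))) * (s powr (a - 1) * (1 - s) powr (b - 1))"
      using s True by (simp add: gamma_ker_def m powr_mult)
    also have "y powr (a - 1) * y powr (b - 1) = y powr (a + b - 2)" by (simp add: powr_add[symmetric])
    also have "exp (- (y * s)) * exp (- (y * (1 - s))) = exp (- y)" by (simp add: exp_add[symmetric] algebra_simps)
    finally show ?thesis using s by (simp add: mult_ac)
  next
    case False
    then have "gamma_ker a (0 + y * s) * gamma_ker b (y - (0 + y * s)) = 0"
      using True by (auto simp: gamma_ker_def zero_less_mult_iff)
    \<comment> \<open>At the endpoints s = 0 and s = 1 the product vanishes because 0 powr r is 0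
      for every r.\<close>
    moreover have "indicator {0..1} s *\<^sub>R (s powr (a - 1) * (1 - s) powr (b - 1)) = 0"
      using False by (cases "s = 0"; cases "s = 1") (auto simp: indicator_def)
    ultimately show ?thesis by (simp only: mult_zero_right)
  qed
  have B: "(LINT s:{0..1}|lborel. s powr (a - 1) * (1 - s) powr (b - 1)) = Beta a b"
    using set_borel_integral_eq_integral(2)[OF integrable_Beta[OF a b]] integral_unique[OF has_integral_Beta_real[OF a b]] by simp
  have "(LINT t|lborel. gamma_ker a t * gamma_ker b (y - t)) = \<bar>y\<bar> *\<^sub>R (LINT s|lborel. gamma_ker a (0 + y * s) * gamma_ker b (y - (0 + y * s)))"
    using True by (intro lborel_integral_real_affine) auto
  also have "\<dots> = y * (exp (- y) * y powr (a + b - 2) * Beta a b)"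
    unfolding e integral_mult_right_zero using True B by (simp add: set_lebesgue_integral_def)
  also have "\<dots> = exp (- y) * y powr (a + b - 1) * Beta a b"
    using True powr_mult_base[of y "a + b - 2"] by (simp add: mult_ac)
  finally have I: "(LINT t|lborel. gamma_ker a t * gamma_ker b (y - t)) = exp (- y) * y powr (a + b - 1) * Beta a b" .
  have "conv (damped_ker a) (damped_ker b) y = (LINT t|lborel. 1 / (Gamma a * Gamma b) * (gamma_ker a t * gamma_ker b (y - t)))"
    unfolding conv_def damped_ker_def by simp
  also have "\<dots> = 1 / (Gamma a * Gamma b) * (exp (- y) * y powr (a + b - 1) * Beta a b)"
    by (simp only: integral_mult_right_zero I)
  also have "\<dots> = damped_ker (a + b) y"
    using True Gamma_real_pos[OF a] Gamma_real_pos[OF b] by (simp add: damped_ker_def gamma_ker_def Beta_def)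
  finally show ?thesis .
qed

lemma conv_power_ker:
  assumes a: "a > 0" and b: "b > 0"
  shows "conv (power_ker a) (power_ker b) y = power_ker (a + b) y"
proof -
  have "power_ker a t * power_ker b (y - t) = exp y * (damped_ker a t * damped_ker b (y - t))" for t
    by (simp add: power_ker_damped_ker exp_diff)
  then have "conv (power_ker a) (power_ker b) y = exp y * conv (damped_ker a) (damped_ker b) y"
    unfolding conv_def by (simp only: integral_mult_right_zero)
  then show ?thesis by (simp add: conv_damped_ker[OF a b] power_ker_damped_ker)
qed

text \<open>A divergent Bochner integral has the value 0, so for y > 0 the nonzero value
  \<open>power_ker (a + b) y\<close> already proves integrability; for y \<le> 0 the product
  vanishes identically.\<close>

lemma power_ker_conv_integrable:
  assumes a: "a > 0" and b: "b > 0"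
  shows "integrable lborel (\<lambda>t. power_ker a (y - t) * power_ker b t)"
proof (cases "y > 0")
  case True
  have "power_ker (a + b) y > 0" using True a b by (simp add: power_ker_def pluspow_def Gamma_real_pos)
  then have "(LINT t|lborel. power_ker a (y - t) * power_ker b t) \<noteq> 0"
    using conv_power_ker[OF a b, of y] by (simp add: conv_alt)
  then show ?thesis using not_integrable_integral_eq by blast
next
  case False
  have z: "power_ker a (y - t) * power_ker b t = 0" for t using False by (cases "t \<le> 0") auto
  show ?thesis unfolding z by simp
qed

text \<open>The density whose potential equals one on the unit interval: it is the difference of two
  densities whose potentials are \<open>x + 1\<close> and \<open>x\<close>.\<close>

definition unit_density :: "real \<Rightarrow> real \<Rightarrow> real" where
  "unit_density \<alpha> t = indicator {-1..1} t * (power_ker (2 - \<alpha>) (t + 1) - power_ker (2 - \<alpha>) t)"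

text \<open>The orders \<alpha> and 2 - \<alpha> add up to 2, and \<open>power_ker 2\<close> is the
  identity on y \<ge> 0. The cut to [-1, 1] has no effect: \<open>power_ker \<alpha> (x - t)\<close>
  vanishes for t > 1, and both parts of the density vanish for t < -1.\<close>

lemma unit_density_potential:
  assumes \<alpha>: "0 < \<alpha>" "\<alpha> < 2" and x: "0 \<le> x" "x \<le> 1"
  shows "(LINT t|lborel. power_ker \<alpha> (x - t) * unit_density \<alpha> t) = 1"
proof -
  have b: "2 - \<alpha> > 0" using \<alpha> by simp
  have e: "power_ker \<alpha> (x - t) * unit_density \<alpha> t = power_ker \<alpha> (x + 1 - (t + 1)) * power_ker (2 - \<alpha>) (t + 1) - power_ker \<alpha> (x - t) * power_ker (2 - \<alpha>) t" for t
  proof (cases "t \<in> {-1..1}")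
    case False
    then consider "t > 1" | "t < - 1" by force
    then show ?thesis using x by cases (auto simp: unit_density_def)
  qed (simp add: unit_density_def algebra_simps)
  have i: "integrable lborel (\<lambda>t. power_ker \<alpha> (x + 1 - (t + 1)) * power_ker (2 - \<alpha>) (t + 1))"
    using power_ker_conv_integrable[OF \<alpha>(1) b, of "x + 1"] lborel_integrable_shift(2)[of "\<lambda>t. power_ker \<alpha> (x + 1 - t) * power_ker (2 - \<alpha>) t" 1] by simp
  have "Gamma (2 :: real) = 1" using Gamma_fact[of 1, where 'a = real] by simp
  then have P2: "power_ker 2 y = y" if "y \<ge> 0" for y using that by (cases "y = 0") (auto simp: power_ker_def pluspow_def)
  have "(LINT t|lborel. power_ker \<alpha> (x - t) * unit_density \<alpha> t) = (LINT t|lborel. power_ker \<alpha> (x + 1 - (t + 1)) * power_ker (2 - \<alpha>) (t + 1)) - (LINT t|lborel. power_ker \<alpha> (x - t) * power_ker (2 - \<alpha>) t)"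
    unfolding e by (rule Bochner_Integration.integral_diff[OF i power_ker_conv_integrable[OF \<alpha>(1) b]])
  also have "(LINT t|lborel. power_ker \<alpha> (x + 1 - (t + 1)) * power_ker (2 - \<alpha>) (t + 1)) = (LINT t|lborel. power_ker \<alpha> (x + 1 - t) * power_ker (2 - \<alpha>) t)"
    by (rule lborel_integral_shift(2)[of "\<lambda>t. power_ker \<alpha> (x + 1 - t) * power_ker (2 - \<alpha>) t"])
  finally show ?thesis unfolding conv_alt[symmetric] conv_power_ker[OF \<alpha>(1) b] using P2[of x] P2[of "x + 1"] x by simp
qed

lemma unit_density_measurable [measurable]: "unit_density \<alpha> \<in> borel_measurable borel"
  unfolding unit_density_def[abs_def] by measurable

text \<open>The exponent 1 - \<alpha> in both kernels is positive, so the density is bounded. The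
  more obvious density t^(-\<alpha>) / Gamma(1 - \<alpha>), with potential 1 for x > 0, would leave
  L_p as soon as \<alpha> p \<ge> 1.\<close>

lemma unit_density_Lp:
  assumes \<alpha>: "0 < \<alpha>" "\<alpha> < 1" and p: "p > 0"
  shows "Lp p (unit_density \<alpha>)"
proof -
  have G: "Gamma (2 - \<alpha>) > 0" using \<alpha> by (intro Gamma_real_pos) auto
  define B where "B = 2 powr (1 - \<alpha>) / Gamma (2 - \<alpha>)"
  have Pb: "0 \<le> power_ker (2 - \<alpha>) y \<and> power_ker (2 - \<alpha>) y \<le> B" if "y \<le> 2" for y
  proof (cases "y > 0")
    case True
    have "y powr (1 - \<alpha>) \<le> 2 powr (1 - \<alpha>)" using True that \<alpha> by (intro powr_mono2) auto
    then show ?thesis using True G by (simp add: power_ker_def pluspow_def B_def divide_right_mono)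
  qed (use G in \<open>simp add: B_def\<close>)
  show ?thesis
  proof (rule Lp_bounded_support[of _ B 1])
    show "\<bar>unit_density \<alpha> t\<bar> \<le> B" for t
      using Pb[of t] Pb[of "t + 1"] G by (cases "t \<in> {-1..1}") (auto simp: unit_density_def B_def abs_le_iff)
  qed (use p in \<open>auto simp: unit_density_def indicator_def\<close>)
qed

text \<open>The expansion \<open>e\<^sup>y = (\<Sum>n. y\<^sup>n / n!)\<close> converts the undamped power kernel into a sum of damped ones,
  each of which factors through \<open>damped_ker \<alpha>\<close> by \<open>conv_damped_ker\<close>.\<close>

definition rho_coeff :: "real \<Rightarrow> nat \<Rightarrow> real" where
  "rho_coeff \<alpha> n = pochhammer \<alpha> (Suc n) / fact (Suc n)"

definition resolvent_ker :: "real \<Rightarrow> real \<Rightarrow> real" where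
  "resolvent_ker \<alpha> y = (\<Sum>n. rho_coeff \<alpha> n * damped_ker (real n + 1) y)"

text \<open>As \<alpha> < 1, the rising factorial of \<alpha> is at most that of 1, which is the
  factorial.\<close>

lemma rho_coeff_bounds:
  assumes "0 < \<alpha>" "\<alpha> < 1"
  shows "0 \<le> rho_coeff \<alpha> n" "rho_coeff \<alpha> n \<le> 1"
proof -
  have *: "0 \<le> pochhammer \<alpha> k \<and> pochhammer \<alpha> k \<le> fact k" for k
  proof (induction k)
    case (Suc k)
    have "pochhammer \<alpha> k * (\<alpha> + real k) \<le> fact k * (1 + real k)"
      using Suc assms by (intro mult_mono) auto
    then show ?case using Suc assms by (simp add: pochhammer_Suc mult.commute)
  qed simp
  show "0 \<le> rho_coeff \<alpha> n" "rho_coeff \<alpha> n \<le> 1" using *[of "Suc n"] by (auto simp: rho_coeff_def divide_le_eq simp del: fact_Suc)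
qed

lemma damped_ker_nat: "y > 0 \<Longrightarrow> damped_ker (real n + 1) y = exp (- y) * (y ^ n / fact n)"
  using Gamma_fact[of n, where 'a = real] by (simp add: damped_ker_def gamma_ker_def powr_realpow add.commute)

text \<open>For y > 0 these are the Poisson weights exp (- y) y^n / n!. With coefficients between 0
  and 1 their sum stays in [0, 1], which bounds \<open>resolvent_ker\<close>.\<close>

lemma damped_ker_nat_sums: "(\<lambda>n. damped_ker (real n + 1) y) sums (if y > 0 then 1 else 0)"
proof (cases "y > 0")
  case True
  have "(\<lambda>n. y ^ n / fact n) sums exp y" using exp_converges[of y] by (simp add: divide_inverse mult.commute)
  from sums_mult[OF this, of "exp (- y)"] show ?thesis using True by (simp add: damped_ker_nat exp_minus)
qed simp

lemma resolvent_ker_sums: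
  assumes \<alpha>: "0 < \<alpha>" "\<alpha> < 1"
  shows "(\<lambda>n. rho_coeff \<alpha> n * damped_ker (real n + 1) y) sums resolvent_ker \<alpha> y"
    and "0 \<le> (\<Sum>n<N. rho_coeff \<alpha> n * damped_ker (real n + 1) y)" "(\<Sum>n<N. rho_coeff \<alpha> n * damped_ker (real n + 1) y) \<le> 1"
proof -
  have t: "0 \<le> rho_coeff \<alpha> n * damped_ker (real n + 1) y" "rho_coeff \<alpha> n * damped_ker (real n + 1) y \<le> damped_ker (real n + 1) y" for n
    using rho_coeff_bounds[OF \<alpha>, of n] damped_ker_nonneg[of "real n + 1" y] by (auto intro: mult_left_le_one_le)
  have "summable (\<lambda>n. rho_coeff \<alpha> n * damped_ker (real n + 1) y)"
    by (rule summable_comparison_test'[OF sums_summable[OF damped_ker_nat_sums[of y]], of 0]) (use t in auto)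
  then show "(\<lambda>n. rho_coeff \<alpha> n * damped_ker (real n + 1) y) sums resolvent_ker \<alpha> y"
    unfolding resolvent_ker_def by (rule summable_sums)
  show "0 \<le> (\<Sum>n<N. rho_coeff \<alpha> n * damped_ker (real n + 1) y)" using t by (intro sum_nonneg) auto
  have "(\<Sum>n<N. rho_coeff \<alpha> n * damped_ker (real n + 1) y) \<le> (\<Sum>n<N. damped_ker (real n + 1) y)" using t by (intro sum_mono) auto
  also have "\<dots> \<le> (\<Sum>n. damped_ker (real n + 1) y)"
    using damped_ker_nonneg by (intro sum_le_suminf sums_summable[OF damped_ker_nat_sums]) auto
  also have "\<dots> \<le> 1" using sums_unique[OF damped_ker_nat_sums[of y]] by (simp split: if_splits)
  finally show "(\<Sum>n<N. rho_coeff \<alpha> n * damped_ker (real n + 1) y) \<le> 1" .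
qed

lemma resolvent_ker_bounds:
  assumes \<alpha>: "0 < \<alpha>" "\<alpha> < 1"
  shows "0 \<le> resolvent_ker \<alpha> y" "resolvent_ker \<alpha> y \<le> 1" "y \<le> 0 \<Longrightarrow> resolvent_ker \<alpha> y = 0"
proof -
  have l: "(\<lambda>N. \<Sum>n<N. rho_coeff \<alpha> n * damped_ker (real n + 1) y) \<longlonglongrightarrow> resolvent_ker \<alpha> y"
    using resolvent_ker_sums(1)[OF \<alpha>] by (simp add: sums_def)
  show "0 \<le> resolvent_ker \<alpha> y" by (rule tendsto_lowerbound[OF l]) (use resolvent_ker_sums(2)[OF \<alpha>] in auto)
  show "resolvent_ker \<alpha> y \<le> 1" by (rule tendsto_upperbound[OF l]) (use resolvent_ker_sums(3)[OF \<alpha>] in auto)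
  show "y \<le> 0 \<Longrightarrow> resolvent_ker \<alpha> y = 0" by (simp add: resolvent_ker_def)
qed

lemma resolvent_ker_measurable [measurable]: "resolvent_ker \<alpha> \<in> borel_measurable borel"
  unfolding resolvent_ker_def[abs_def] by measurable

text \<open>For y > 0, \<open>damped_ker \<alpha> y\<close> times y^(n+1) / (n+1)! is
  \<open>rho_coeff \<alpha> n\<close> times the damped kernel of order \<alpha> + n + 1, by the
  ratio of Gamma values; the semigroup law splits off \<open>damped_ker \<alpha>\<close>. Summing
  over n gives the factor exp y - 1, the term of order 0 being the separate first summand.\<close>

lemma power_ker_decomposition:
  assumes \<alpha>: "0 < \<alpha>" "\<alpha> < 1"
  shows "power_ker \<alpha> y = damped_ker \<alpha> y + conv (damped_ker \<alpha>) (resolvent_ker \<alpha>) y"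
proof -
  define S where "S N y = (\<Sum>n<N. rho_coeff \<alpha> n * damped_ker (real n + 1) y)" for N y
  have [measurable]: "S N \<in> borel_measurable borel" for N unfolding S_def by measurable
  have k: "integrable lborel (damped_ker \<alpha>)" using \<alpha> by (intro damped_ker_integrable)
  have S1: "\<bar>S N y\<bar> \<le> 1" for N y using resolvent_ker_sums(2,3)[OF \<alpha>, where N = N and y = y] by (simp add: S_def)
  have "(\<lambda>N. LINT t|lborel. damped_ker \<alpha> t * S N (y - t)) \<longlonglongrightarrow> (LINT t|lborel. damped_ker \<alpha> t * resolvent_ker \<alpha> (y - t))"
  proof (rule integral_dominated_convergence)
    show "integrable lborel (\<lambda>t. \<bar>damped_ker \<alpha> t\<bar>)" using k by simp
    show "AE t in lborel. (\<lambda>N. damped_ker \<alpha> t * S N (y - t)) \<longlonglongrightarrow> damped_ker \<alpha> t * resolvent_ker \<alpha> (y - t)"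
      using resolvent_ker_sums(1)[OF \<alpha>] unfolding S_def sums_def by (intro AE_I2 tendsto_intros) auto
    show "AE t in lborel. norm (damped_ker \<alpha> t * S N (y - t)) \<le> \<bar>damped_ker \<alpha> t\<bar>" for N
      using S1 by (intro AE_I2) (simp add: abs_mult mult_left_le)
  qed measurable
  moreover have "(LINT t|lborel. damped_ker \<alpha> t * S N (y - t)) = (\<Sum>n<N. damped_ker \<alpha> y * (y ^ Suc n / fact (Suc n)))" for N
  proof -
    have i: "integrable lborel (\<lambda>t. damped_ker \<alpha> t * damped_ker (real n + 1) (y - t))" for n
    proof (rule Bochner_Integration.integrable_bound[OF k])
      have "\<bar>damped_ker (real n + 1) z\<bar> \<le> 1" for z
        using sum_le_suminf[OF sums_summable[OF damped_ker_nat_sums[of z]], of "{n}"] damped_ker_nonneg sums_unique[OF damped_ker_nat_sums[of z]]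
        by (auto split: if_splits)
      then show "AE t in lborel. norm (damped_ker \<alpha> t * damped_ker (real n + 1) (y - t)) \<le> norm (damped_ker \<alpha> t)"
        by (intro AE_I2) (simp add: abs_mult mult_left_le)
    qed measurable
    have "(LINT t|lborel. damped_ker \<alpha> t * S N (y - t)) = (LINT t|lborel. (\<Sum>n<N. rho_coeff \<alpha> n * (damped_ker \<alpha> t * damped_ker (real n + 1) (y - t))))"
      by (simp add: S_def sum_distrib_left mult_ac)
    also have "\<dots> = (\<Sum>n<N. rho_coeff \<alpha> n * conv (damped_ker \<alpha>) (damped_ker (real n + 1)) y)"
      using i by (subst Bochner_Integration.integral_sum) (auto simp: conv_def)
    also have "\<dots> = (\<Sum>n<N. damped_ker \<alpha> y * (y ^ Suc n / fact (Suc n)))"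
    proof (rule sum.cong[OF refl])
      fix n
      show "rho_coeff \<alpha> n * conv (damped_ker \<alpha>) (damped_ker (real n + 1)) y = damped_ker \<alpha> y * (y ^ Suc n / fact (Suc n))"
      proof (cases "y > 0")
        case True
        have "\<alpha> \<notin> \<int>\<^sub>\<le>\<^sub>0" using \<alpha> by (auto elim!: nonpos_Ints_cases)
        then have po: "pochhammer \<alpha> (Suc n) = Gamma (\<alpha> + (real n + 1)) / Gamma \<alpha>"
          using pochhammer_Gamma[of \<alpha> "Suc n"] by (simp add: add_ac)
        have G: "Gamma \<alpha> > 0" "Gamma (\<alpha> + (real n + 1)) > 0" using \<alpha> by (auto intro!: Gamma_real_pos)
        have pw: "y powr (\<alpha> + (real n + 1) - 1) = y powr (\<alpha> - 1) * y ^ Suc n"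
        proof -
          have "y powr (\<alpha> + (real n + 1) - 1) = y powr (\<alpha> - 1) * y powr real (Suc n)"
            by (simp add: powr_add[symmetric] algebra_simps)
          then show ?thesis using True by (simp only: powr_realpow)
        qed
        have "rho_coeff \<alpha> n * conv (damped_ker \<alpha>) (damped_ker (real n + 1)) y = rho_coeff \<alpha> n * damped_ker (\<alpha> + (real n + 1)) y"
          using \<alpha> by (subst conv_damped_ker) auto
        also have "\<dots> = damped_ker \<alpha> y * (y ^ Suc n / fact (Suc n))"
          unfolding rho_coeff_def po damped_ker_def gamma_ker_def pw using G True by (simp add: divide_simps del: fact_Suc power_Suc)
        finally show ?thesis .
      qed (use \<alpha> in \<open>simp add: conv_damped_ker\<close>)
    qed
    finally show ?thesis .
  qed
  moreover have "(\<lambda>N. \<Sum>n<N. damped_ker \<alpha> y * (y ^ Suc n / fact (Suc n))) \<longlonglongrightarrow> damped_ker \<alpha> y * (exp y - 1)"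
  proof -
    have "(\<lambda>n. y ^ n / fact n) sums exp y" using exp_converges[of y] by (simp add: divide_inverse mult.commute)
    then have "(\<lambda>n. y ^ Suc n / fact (Suc n)) sums (exp y - 1)"
      by (subst sums_Suc_iff) simp
    from sums_mult[OF this, of "damped_ker \<alpha> y"] show ?thesis by (simp only: sums_def)
  qed
  ultimately have "conv (damped_ker \<alpha>) (resolvent_ker \<alpha>) y = damped_ker \<alpha> y * (exp y - 1)"
    unfolding conv_def using LIMSEQ_unique by auto
  then show ?thesis by (simp add: power_ker_damped_ker algebra_simps)
qed

text \<open>Boundedness of l makes the inner integral converge for every s; at almost every x the
  double integral converges absolutely, by the L_1 theory applied to the absolute values.\<close>

lemma conv_assoc_AE:
  assumes k: "integrable lborel k" and l: "integrable lborel l" and lb: "\<And>x. \<bar>l x\<bar> \<le> B" and u: "integrable lborel u"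
  shows "AE x in lborel. conv (conv k l) u x = conv k (conv l u) x"
proof -
  have [measurable]: "k \<in> borel_measurable borel" "l \<in> borel_measurable borel" "u \<in> borel_measurable borel"
    using k l u by auto
  have k_abs: "integrable lborel (\<lambda>x. \<bar>k x\<bar>)" and la: "integrable lborel (\<lambda>x. \<bar>l x\<bar>)" and ua: "integrable lborel (\<lambda>x. \<bar>u x\<bar>)"
    using k l u by auto
  from conv_L1(1)[OF k_abs conv_L1(2)[OF la ua]] show ?thesis
  proof eventually_elim
    fix x assume i: "integrable lborel (\<lambda>s. \<bar>k s\<bar> * conv (\<lambda>x. \<bar>l x\<bar>) (\<lambda>x. \<bar>u x\<bar>) (x - s))"
    define f where "f s v = k s * (l (v - s) * u (x - v))" for s v
    have m: "(\<lambda>(s, v). f s v) \<in> borel_measurable (lborel \<Otimes>\<^sub>M lborel)" unfolding f_def by measurable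
    have ux: "integrable lborel (\<lambda>v. B * u (x - v))" using u lborel_integrable_shift(3)[of u x] by simp
    have lu: "integrable lborel (\<lambda>v. l (v - s) * u (x - v))" for s
      by (rule Bochner_Integration.integrable_bound[OF ux])
        (use lb in \<open>auto simp: abs_mult intro!: AE_I2 mult_right_mono order_trans[OF lb abs_ge_self]\<close>)
    have 1: "AE s in lborel. integrable lborel (f s)"
      unfolding f_def using lu by (intro AE_I2 integrable_mult_right)
    have shift: "(LINT v|lborel. \<bar>l (v - s)\<bar> * \<bar>u (x - v)\<bar>) = conv (\<lambda>x. \<bar>l x\<bar>) (\<lambda>x. \<bar>u x\<bar>) (x - s)" for s
      unfolding conv_def using lborel_integral_shift(1)[of "\<lambda>v. \<bar>l v\<bar> * \<bar>u (x - s - v)\<bar>" s] by (simp add: algebra_simps)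
    have shift': "(LINT v|lborel. l (v - s) * u (x - v)) = conv l u (x - s)" for s
      unfolding conv_def using lborel_integral_shift(1)[of "\<lambda>v. l v * u (x - s - v)" s] by (simp add: algebra_simps)
    have 2: "integrable lborel (\<lambda>s. LINT v|lborel. norm (f s v))"
      using i by (simp add: f_def abs_mult shift)
    have "conv (conv k l) u x = (LINT v|lborel. LINT s|lborel. f s v)"
    proof -
      have "(LINT s|lborel. f s v) = conv k l v * u (x - v)" for v
        unfolding f_def conv_def by (subst integral_mult_left_zero[symmetric]) (simp add: mult.assoc)
      then show ?thesis by (simp add: conv_def[of "conv k l"])
    qed
    also have "\<dots> = (LINT s|lborel. LINT v|lborel. f s v)" by (rule Fubini_swap(4)[OF m 1 2])
    also have "\<dots> = conv k (conv l u) x"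
      unfolding f_def by (simp add: shift' conv_def[of k])
    finally show "conv (conv k l) u x = conv k (conv l u) x" .
  qed
qed

section \<open>Assembling the embedding\<close>

lemma Lp_truncate_integrable:
  assumes f: "Lp p f" and p: "p \<ge> 1" and supp: "\<And>x. \<bar>x\<bar> > R \<Longrightarrow> f x = 0"
  shows "integrable lborel f"
proof -
  have "integrable lborel (\<lambda>x. indicator {-R..R} x + \<bar>f x\<bar> powr p)"
    by (intro Bochner_Integration.integrable_add Lp_int[OF f] integrable_real_indicator) (auto simp: emeasure_lborel_Icc_eq)
  then show ?thesis
  proof (rule Bochner_Integration.integrable_bound)
    show "AE x in lborel. norm (f x) \<le> norm (indicator {-R..R} x + \<bar>f x\<bar> powr p)"
    proof (rule AE_I2)
      fix x
      show "norm (f x) \<le> norm (indicator {-R..R} x + \<bar>f x\<bar> powr p)"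
      proof (cases "\<bar>x\<bar> > R")
        case False
        then have i: "indicator {-R..R} x = (1 :: real)" by (auto simp: indicator_def)
        have "\<bar>f x\<bar> \<le> 1 + \<bar>f x\<bar> powr p"
        proof (cases "\<bar>f x\<bar> \<le> 1")
          case True
          then show ?thesis by (simp add: add_increasing2)
        next
          case False
          then have "\<bar>f x\<bar> powr 1 \<le> \<bar>f x\<bar> powr p" using p by (intro powr_mono) auto
          then show ?thesis using False by simp
        qed
        then show ?thesis unfolding i by simp
      qed (use supp in simp)
    qed
  qed (use Lp_meas[OF f] in simp)
qed

lemma RL_rep_at_0: "RL_rep \<alpha> p f c ft \<Longrightarrow> f 0 = c"
proof -
  assume r: "RL_rep \<alpha> p f c ft"
  have z: "indicator {0..1} t *\<^sub>R (ft t * pluspow (\<alpha> - 1) (0 - t)) = 0" for t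
    by (auto simp: indicator_def pluspow_def)
  have "(LINT t:{0..1}|lborel. ft t * pluspow (\<alpha> - 1) (0 - t)) = 0"
    unfolding set_lebesgue_integral_def z by simp
  moreover have "f 0 = c + (1 / Gamma \<alpha>) * (LINT t:{0..1}|lborel. ft t * pluspow (\<alpha> - 1) (0 - t))"
    using r unfolding RL_rep_def by (metis atLeastAtMost_iff order_refl zero_le_one)
  ultimately show "f 0 = c" by simp
qed

text \<open>If \<psi>0 represents f through the power kernel, then \<psi>0 plus r1 convolved with
  \<psi>0 represents it through the damped kernel, by associativity and the decomposition of the
  power kernel. Here \<psi>0 is c times \<open>unit_density\<close> plus the given density, so the
  constant needs no treatment of its own.\<close>

lemma RL_embedding_bound:
  assumes \<alpha>: "0 < \<alpha>" "\<alpha> < 1" and p: "p > 1"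
  obtains C where "C > 0" "\<And>f c ft. RL_rep \<alpha> p f c ft \<Longrightarrow>
     \<exists>g h. bessel_rep \<alpha> p g h \<and> extends01 g f \<and> Lp_norm p h \<le> C * (\<bar>c\<bar> + Lp01_norm p ft / Gamma \<alpha>)"
proof -
  have p1: "p \<ge> 1" and p0: "p > 0" using p by auto
  have G: "Gamma \<alpha> > 0" by (rule Gamma_real_pos[OF \<alpha>(1)])
  obtain K where K: "K \<ge> 0" "\<And>\<psi>. Lp p \<psi> \<Longrightarrow> integrable lborel \<psi> \<Longrightarrow>
     \<exists>h. bessel_rep \<alpha> p (conv (damped_ker \<alpha>) \<psi>) h \<and> Lp_norm p h \<le> K * Lp_norm p \<psi>"
    using bessel_rep_conv[OF \<alpha>(1) p] by blast
  \<comment> \<open>Only arguments x - t with x in [0, 1] and t in [-1, 1] occur, and these are at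
    most 2. The cut turns the merely bounded \<open>resolvent_ker\<close> into an integrable
    kernel.\<close>
  define r1 where "r1 y = indicator {..2} y * resolvent_ker \<alpha> y" for y
  have r1m [measurable]: "r1 \<in> borel_measurable borel" unfolding r1_def by measurable
  have r1b: "\<bar>r1 y\<bar> \<le> 1" for y using resolvent_ker_bounds[OF \<alpha>, of y] by (simp add: r1_def indicator_def)
  have r1i: "integrable lborel r1"
  proof (rule Lp_truncate_integrable)
    show "r1 y = 0" if "\<bar>y\<bar> > 2" for y using that resolvent_ker_bounds(3)[OF \<alpha>, of y] by (cases "y \<le> 0") (auto simp: r1_def)
    then show "Lp 1 r1" by (intro Lp_bounded_support[of r1 1 2] r1b r1m) auto
  qed simp
  have k: "integrable lborel (damped_ker \<alpha>)" by (rule damped_ker_integrable[OF \<alpha>(1)])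
  \<comment> \<open>The factors 1 here and below match the shape of \<open>conv_lin_left\<close> and
    \<open>conv_lin_right\<close>.\<close>
  define L where "L y = 1 * (damped_ker \<alpha> y + conv (damped_ker \<alpha>) r1 y)" for y
  have kr: "integrable lborel (conv (damped_ker \<alpha>) r1)" by (rule conv_L1(2)[OF k r1i])
  have Li: "integrable lborel L" unfolding L_def using k kr by simp
  have Leq: "L y = power_ker \<alpha> y" if "y \<le> 2" for y
  proof -
    \<comment> \<open>For t > 0 and y \<le> 2 the argument y - t stays below the cut; for t \<le> 0
      the damped kernel vanishes.\<close>
    have z: "damped_ker \<alpha> t * r1 (y - t) = damped_ker \<alpha> t * resolvent_ker \<alpha> (y - t)" for t
      using that by (cases "t \<le> 0") (auto simp: r1_def indicator_def)
    show ?thesis unfolding L_def power_ker_decomposition[OF \<alpha>] conv_def z by simp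
  qed
  have \<eta>: "Lp p (unit_density \<alpha>)" by (rule unit_density_Lp[OF \<alpha> p0])
  define r where "r = (LINT y|lborel. \<bar>r1 y\<bar>)"
  define e where "e = Lp_norm p (unit_density \<alpha>)"
  have nn: "r \<ge> 0" "e \<ge> 0" by (simp_all add: r_def e_def)
  \<comment> \<open>K comes from the Bessel representation, 1 + r from passing from \<psi>0 to
    \<psi>, and e + Gamma \<alpha> from |c| e + N \<le> (e + Gamma \<alpha>) (|c| + N / Gamma
    \<alpha>), where N is the norm of the density. The last summand makes C positive.\<close>
  define C where "C = K * (1 + r) * (e + Gamma \<alpha>) + 1"
  have "0 \<le> K * (1 + r) * (e + Gamma \<alpha>)" using K nn G by (intro mult_nonneg_nonneg) auto
  then have C0: "C > 0" by (simp add: C_def)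
  show ?thesis
  proof (rule that[OF C0])
    fix f c ft assume rep: "RL_rep \<alpha> p f c ft"
    define ft1 where "ft1 t = indicator {0..1} t * ft t" for t
    have m1: "ft1 \<in> borel_measurable borel"
      using rep by (simp add: RL_rep_def Lp01_def ft1_def[abs_def] set_borel_measurable_def)
    have pw: "\<bar>ft1 t\<bar> powr p = indicator {0..1} t *\<^sub>R \<bar>ft t\<bar> powr p" for t
      by (auto simp: ft1_def indicator_def)
    have ft1: "Lp p ft1"
      using rep m1 by (simp add: RL_rep_def Lp01_def Lp_def set_integrable_def pw)
    have ft1n: "Lp_norm p ft1 = Lp01_norm p ft"
      by (simp add: Lp_norm_def Lp01_norm_def set_lebesgue_integral_def pw)
    define \<psi>0 where "\<psi>0 t = c * unit_density \<alpha> t + 1 * ft1 t" for t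
    have c\<eta>: "Lp p (\<lambda>t. c * unit_density \<alpha> t)" "Lp_norm p (\<lambda>t. c * unit_density \<alpha> t) = \<bar>c\<bar> * e"
      using Lp_scale[OF \<eta> p0, of c] by (auto simp: e_def)
    have \<psi>0: "Lp p \<psi>0" "Lp_norm p \<psi>0 \<le> \<bar>c\<bar> * e + Lp01_norm p ft"
      using Lp_add[OF c\<eta>(1) ft1 p1] Lp_norm_add[OF c\<eta>(1) ft1 p1] unfolding \<psi>0_def c\<eta>(2) ft1n by auto
    have \<psi>0i: "integrable lborel \<psi>0"
      by (rule Lp_truncate_integrable[OF \<psi>0(1) p1, of 1]) (auto simp: \<psi>0_def unit_density_def ft1_def indicator_def)
    define \<psi> where "\<psi> t = 1 * \<psi>0 t + 1 * conv r1 \<psi>0 t" for t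
    have c\<psi>: "Lp p (conv r1 \<psi>0)" "Lp_norm p (conv r1 \<psi>0) \<le> r * Lp_norm p \<psi>0"
      unfolding r_def by (rule Young_convolution(2,3)[OF r1i \<psi>0(1) p])+
    have \<psi>L: "Lp p \<psi>" unfolding \<psi>_def using Lp_add[OF \<psi>0(1) c\<psi>(1) p1] by simp
    have \<psi>n: "Lp_norm p \<psi> \<le> (1 + r) * (\<bar>c\<bar> * e + Lp01_norm p ft)"
    proof -
      have "Lp_norm p \<psi> \<le> Lp_norm p \<psi>0 + Lp_norm p (conv r1 \<psi>0)"
        unfolding \<psi>_def using Lp_norm_add[OF \<psi>0(1) c\<psi>(1) p1] by simp
      also have "\<dots> \<le> (1 + r) * Lp_norm p \<psi>0" using c\<psi>(2) by (simp add: distrib_right)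
      also have "\<dots> \<le> (1 + r) * (\<bar>c\<bar> * e + Lp01_norm p ft)" using \<psi>0(2) nn by (intro mult_left_mono) auto
      finally show ?thesis .
    qed
    have \<psi>i: "integrable lborel \<psi>" unfolding \<psi>_def using \<psi>0i conv_L1(2)[OF r1i \<psi>0i] by simp
    obtain h where h: "bessel_rep \<alpha> p (conv (damped_ker \<alpha>) \<psi>) h" "Lp_norm p h \<le> K * Lp_norm p \<psi>"
      using K(2)[OF \<psi>L \<psi>i] by blast
    have fx: "f x = c * conv L (unit_density \<alpha>) x + 1 * conv L ft1 x" if x: "x \<in> {0..1}" for x
    proof -
      have z1: "L (x - t) * unit_density \<alpha> t = power_ker \<alpha> (x - t) * unit_density \<alpha> t" for t
        using x by (cases "t \<in> {-1..1}") (auto simp: Leq unit_density_def)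
      have 1: "conv L (unit_density \<alpha>) x = 1" unfolding conv_alt z1 using unit_density_potential[of \<alpha> x] \<alpha> x by simp
      have z2: "L (x - t) * ft1 t = 1 / Gamma \<alpha> * (indicator {0..1} t *\<^sub>R (ft t * pluspow (\<alpha> - 1) (x - t)))" for t
        using x by (cases "t \<in> {0..1}") (auto simp: Leq ft1_def power_ker_def)
      have 2: "conv L ft1 x = 1 / Gamma \<alpha> * (LINT t:{0..1}|lborel. ft t * pluspow (\<alpha> - 1) (x - t))"
        unfolding conv_alt set_lebesgue_integral_def z2 by (rule integral_mult_right_zero)
      show ?thesis using rep x unfolding RL_rep_def 1 2 by simp
    qed
    \<comment> \<open>The formula \<open>fx\<close> holds at every point of [0, 1], but linearity
      and associativity of the convolutions hold only almost everywhere, which is what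
      \<open>extends01\<close> asks for.\<close>
    have "AE x in lborel. x \<in> {0..1} \<longrightarrow> conv (damped_ker \<alpha>) \<psi> x = f x"
      using conv_lin_right[OF Li \<eta> ft1 p, of c 1] conv_lin_left[OF k kr \<psi>0(1) p, of 1]
        conv_assoc_AE[OF k r1i r1b \<psi>0i] conv_lin_right[OF k \<psi>0(1) c\<psi>(1) p, of 1 1]
    proof eventually_elim
      fix x
      assume 1: "conv L (\<lambda>x. c * unit_density \<alpha> x + 1 * ft1 x) x = c * conv L (unit_density \<alpha>) x + 1 * conv L ft1 x"
        and 2: "conv (\<lambda>x. 1 * (damped_ker \<alpha> x + conv (damped_ker \<alpha>) r1 x)) \<psi>0 x = 1 * (conv (damped_ker \<alpha>) \<psi>0 x + conv (conv (damped_ker \<alpha>) r1) \<psi>0 x)"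
        and 3: "conv (conv (damped_ker \<alpha>) r1) \<psi>0 x = conv (damped_ker \<alpha>) (conv r1 \<psi>0) x"
        and 4: "conv (damped_ker \<alpha>) (\<lambda>x. 1 * \<psi>0 x + 1 * conv r1 \<psi>0 x) x = 1 * conv (damped_ker \<alpha>) \<psi>0 x + 1 * conv (damped_ker \<alpha>) (conv r1 \<psi>0) x"
      show "x \<in> {0..1} \<longrightarrow> conv (damped_ker \<alpha>) \<psi> x = f x"
      proof
        assume "x \<in> {0..1}"
        then have "f x = conv L \<psi>0 x" using fx 1 by (simp only: \<psi>0_def[abs_def])
        also have "\<dots> = conv (damped_ker \<alpha>) \<psi> x" using 2 3 4 by (simp add: L_def[abs_def] \<psi>_def[abs_def])
        finally show "conv (damped_ker \<alpha>) \<psi> x = f x" by simp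
      qed
    qed
    then have ext: "extends01 (conv (damped_ker \<alpha>) \<psi>) f" by (simp add: extends01_def)
    have "Lp_norm p h \<le> C * (\<bar>c\<bar> + Lp01_norm p ft / Gamma \<alpha>)"
    proof -
      define N where "N = Lp01_norm p ft"
      have N0: "N \<ge> 0" by (simp add: N_def Lp01_norm_def)
      have "Lp_norm p h \<le> K * ((1 + r) * (\<bar>c\<bar> * e + N))"
        using h(2) mult_left_mono[OF \<psi>n K(1)] by (simp add: N_def)
      also have "\<dots> \<le> K * ((1 + r) * ((e + Gamma \<alpha>) * (\<bar>c\<bar> + N / Gamma \<alpha>)))"
      proof (intro mult_left_mono)
        have "(e + Gamma \<alpha>) * (\<bar>c\<bar> + N / Gamma \<alpha>) = (\<bar>c\<bar> * e + N) + (e * N / Gamma \<alpha> + Gamma \<alpha> * \<bar>c\<bar>)"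
          using G by (simp add: field_simps)
        moreover have "0 \<le> e * N / Gamma \<alpha> + Gamma \<alpha> * \<bar>c\<bar>" using nn N0 G by simp
        ultimately show "\<bar>c\<bar> * e + N \<le> (e + Gamma \<alpha>) * (\<bar>c\<bar> + N / Gamma \<alpha>)" by linarith
      qed (use nn K in auto)
      also have "\<dots> = (K * (1 + r) * (e + Gamma \<alpha>)) * (\<bar>c\<bar> + N / Gamma \<alpha>)" by (simp only: mult.assoc)
      also have "\<dots> \<le> C * (\<bar>c\<bar> + N / Gamma \<alpha>)"
        using N0 G unfolding C_def by (intro mult_right_mono) auto
      finally show ?thesis by (simp add: N_def)
    qed
    then show "\<exists>g h. bessel_rep \<alpha> p g h \<and> extends01 g f \<and> Lp_norm p h \<le> C * (\<bar>c\<bar> + Lp01_norm p ft / Gamma \<alpha>)"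
      using h(1) ext by blast
  qed
qed

theorem theorem7:
  fixes \<alpha> p :: real
  assumes "0 < \<alpha>" "\<alpha> < 1" "1 / \<alpha> < p"
  shows "RL_space \<alpha> p \<subseteq> Bessel01 \<alpha> p \<and>
         (\<exists>C. \<forall>f\<in>RL_space \<alpha> p. Bessel01_norm \<alpha> p f \<le> C * RL_norm \<alpha> p f)"
proof -
  have "1 < 1 / \<alpha>" using assms by simp
  then have p: "p > 1" using assms(3) by linarith
  obtain C where C: "C > 0" "\<And>f c ft. RL_rep \<alpha> p f c ft \<Longrightarrow>
     \<exists>g h. bessel_rep \<alpha> p g h \<and> extends01 g f \<and> Lp_norm p h \<le> C * (\<bar>c\<bar> + Lp01_norm p ft / Gamma \<alpha>)"
    using RL_embedding_bound[OF assms(1,2) p] by blast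
  have "RL_space \<alpha> p \<subseteq> Bessel01 \<alpha> p"
    using C(2) unfolding RL_space_def Bessel01_def by fast
  moreover have "Bessel01_norm \<alpha> p f \<le> C * RL_norm \<alpha> p f" if f: "f \<in> RL_space \<alpha> p" for f
  proof -
    define X where "X = {\<bar>f 0\<bar> + Lp01_norm p ft / Gamma \<alpha> | c ft. RL_rep \<alpha> p f c ft}"
    have ne: "X \<noteq> {}" using f by (auto simp: X_def RL_space_def)
    \<comment> \<open>Dividing by the positive C turns the claim into a lower bound for the infimum
      on the right, which can be checked for one representation at a time.\<close>
    have "Bessel01_norm \<alpha> p f / C \<le> Inf X"
    proof (rule cInf_greatest[OF ne])
      fix y assume "y \<in> X"
      then obtain c ft where y: "y = \<bar>f 0\<bar> + Lp01_norm p ft / Gamma \<alpha>" and rep: "RL_rep \<alpha> p f c ft"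
        by (auto simp: X_def)
      obtain g h where gh: "bessel_rep \<alpha> p g h" "extends01 g f" "Lp_norm p h \<le> C * (\<bar>c\<bar> + Lp01_norm p ft / Gamma \<alpha>)"
        using C(2)[OF rep] by blast
      have "Bessel01_norm \<alpha> p f \<le> Lp_norm p h"
        unfolding Bessel01_norm_def
        by (rule cInf_lower) (use gh in \<open>auto intro!: bdd_belowI[of _ 0]\<close>)
      also have "\<dots> \<le> C * y" using gh(3) by (simp add: y RL_rep_at_0[OF rep])
      finally show "Bessel01_norm \<alpha> p f / C \<le> y" using C(1) by (simp add: divide_le_eq mult.commute)
    qed
    then show ?thesis using C(1) by (simp add: RL_norm_def X_def[symmetric] divide_le_eq mult.commute)
  qed
  ultimately show ?thesis by blast
qed

end
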